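(* Let $(X,S)$ be an association scheme, $x\in X$, and $T_x$ its complex Terwilliger algebra with respect to $x$. Suppose $V$ is a thin irreducible $T_x$-module whose character is $\chi$. Then $\chi$ has rational Schur index equal to $1$. In particular, the simple component of the rational Terwilliger algebra $\mathbb{Q}T_x$ determined by $V$ and $\chi$ is isomorphic to $M_{d'}(\mathbb{Q}(\chi))$, where $d'$ is the dual diameter of $V$.
   Context: Let $(X,S)$ be an association scheme on $X=\{1,\dots,n\}$ with adjacency matrices $A_0=I_n,A_1,\dots,A_d$. For $x\in X$, the dual idempotents $E_0^*,\dots,E_d^*$ are diagonal $01$-matrices with $(E_i^* )_{yy}=1$ iff $(A_i)_{xy}=1$. The (complex) Terwilliger algebra $T_x$ is the subalgebra of $M_n(\mathbb{C})$ generated by all $A_i$ and $E_i^*$; the rational Terwilliger algebra $\mathbb{Q}T_x$ is the $\mathbb{Q}$-subalgebra of $M_n(\mathbb{Q})$ generated by the same matrices; both are semisimple and $T_x\cong\mathbb{C}\otimes_{\mathbb{Q}}\mathbb{Q}T_x$. An irreducible $T_x$-module $V$ is thin if $\dim E_i^*V\le1$ for all $i$; its dual diameter is the number of $i$ with $E_i^*V\neq0$. $\mathbb{Q}(\chi)$ is the field generated over $\mathbb{Q}$ by the values of $\chi$. The simple component of $\mathbb{Q}T_x$ determined by $\chi$ is $\mathbb{Q}T_xe$, where $e$ is the centrally primitive idempotent of $\mathbb{Q}T_x$ equal to the sum of the Galois conjugates of the centrally primitive idempotent $e_\chi$ of $T_x$ (over a splitting field); it is isomorphic to $M_r(D)$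 for a division algebra $D$ with center $\mathbb{Q}(\chi)$, and the rational Schur index of $\chi$ is $\sqrt{[D:\mathbb{Q}(\chi)]}$. *)

theory Defs
  imports
    "HOL-Analysis.Analysis"
    "HOL-Library.Disjoint_Sets"
    "HOL-Algebra.Generated_Fields"
    "HOL-Algebra.Algebraic_Closure_Type"
begin

section \<open>Association schemes and Terwilliger algebras\<close>

text \<open>The point set is the finite type \<open>'n\<close>, and the scheme is the set \<open>S\<close> of its basis relations.
  Neither symmetry nor commutativity is required.\<close>

definition association_scheme :: "('n::finite \<times> 'n) set set \<Rightarrow> bool" where
  "association_scheme S \<longleftrightarrow>
     partition_on UNIV S \<and>
     Id \<in> S \<and>
     (\<forall>s\<in>S. converse s \<in> S) \<and>
     (\<forall>p\<in>S. \<forall>q\<in>S. \<forall>r\<in>S. \<exists>a. \<forall>(y, z)\<in>r. card {w. (y, w) \<in> p \<and> (w, z) \<in> q} = a)"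

definition adjacency_matrix :: "('n::finite \<times> 'n) set \<Rightarrow> 'a::zero_neq_one^'n^'n" where
  "adjacency_matrix s = (\<chi> y z. if (y, z) \<in> s then 1 else 0)"

definition dual_idempotent :: "'n::finite \<Rightarrow> ('n \<times> 'n) set \<Rightarrow> 'a::zero_neq_one^'n^'n" where
  "dual_idempotent x s = (\<chi> y z. if y = z \<and> (x, y) \<in> s then 1 else 0)"

definition matrix_subalgebra :: "('a::field^'n::finite^'n) set \<Rightarrow> bool" where
  "matrix_subalgebra A \<longleftrightarrow>
     mat 1 \<in> A \<and>
     (\<forall>M\<in>A. \<forall>N\<in>A. M + N \<in> A \<and> M ** N \<in> A) \<and>
     (\<forall>c. \<forall>M\<in>A. map_matrix ((*) c) M \<in> A)"

text \<open>At coefficient type \<^typ>\<open>complex\<close> this is \<open>T\<^sub>x\<close>, at \<^typ>\<open>rat\<close> it is \<open>\<rat>T\<^sub>x\<close>.\<close>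

definition terwilliger_algebra ::
    "('n::finite \<times> 'n) set set \<Rightarrow> 'n \<Rightarrow> ('a::field^'n^'n) set" where
  "terwilliger_algebra S x =
     matrix_subalgebra hull (adjacency_matrix ` S \<union> dual_idempotent x ` S)"


section \<open>Modules and characters\<close>

text \<open>The trace of a linear endomorphism \<open>f\<close> of a finite-dimensional subspace \<open>V\<close>; it does not
  depend on the chosen basis.\<close>

definition (in vector_space) trace_on :: "'b set \<Rightarrow> ('b \<Rightarrow> 'b) \<Rightarrow> 'a" where
  "trace_on V f =
     (let B = (SOME B. B \<subseteq> V \<and> independent B \<and> span B = V)
      in \<Sum>b\<in>B. representation B (f b) b)"

locale matrix_algebra_module = vector_space scl
  for scl :: "'a::field \<Rightarrow> 'v::ab_group_add \<Rightarrow> 'v" +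
  fixes T :: "('a^'n::finite^'n) set"
    and act :: "'a^'n^'n \<Rightarrow> 'v \<Rightarrow> 'v"
    and V :: "'v set"
  assumes subspace_V: "subspace V"
    and act_closed: "\<lbrakk>M \<in> T; v \<in> V\<rbrakk> \<Longrightarrow> act M v \<in> V"
    and act_add_right: "\<lbrakk>M \<in> T; v \<in> V; w \<in> V\<rbrakk> \<Longrightarrow> act M (v + w) = act M v + act M w"
    and act_scale_right: "\<lbrakk>M \<in> T; v \<in> V\<rbrakk> \<Longrightarrow> act M (scl c v) = scl c (act M v)"
    and act_add_left: "\<lbrakk>M \<in> T; N \<in> T; v \<in> V\<rbrakk> \<Longrightarrow> act (M + N) v = act M v + act N v"
    and act_scale_left: "\<lbrakk>M \<in> T; v \<in> V\<rbrakk> \<Longrightarrow> act (map_matrix ((*) c) M) v = scl c (act M v)"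
    and act_mult: "\<lbrakk>M \<in> T; N \<in> T; v \<in> V\<rbrakk> \<Longrightarrow> act (M ** N) v = act M (act N v)"
    and act_one: "v \<in> V \<Longrightarrow> act (mat 1) v = v"

text \<open>An irreducible module over a subalgebra \<open>T\<close> of a matrix algebra is automatically
  finite-dimensional, being equal to \<open>T v\<close> for any nonzero \<open>v\<close>.  Hence neither the convention
  that \<^const>\<open>vector_space.dim\<close> is \<open>0\<close> on infinite-dimensional spaces nor the arbitrary value of
  \<^const>\<open>vector_space.trace_on\<close> there ever applies to such a module.\<close>

locale irreducible_module = matrix_algebra_module +
  assumes nonzero: "V \<noteq> {0}"
    and simple: "\<lbrakk>subspace W; W \<subseteq> V; \<And>M w. \<lbrakk>M \<in> T; w \<in> W\<rbrakk> \<Longrightarrow> act M w \<in> W\<rbrakk>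
                 \<Longrightarrow> W = {0} \<or> W = V"

definition thin_module ::
    "('n::finite \<times> 'n) set set \<Rightarrow> 'n \<Rightarrow> (complex \<Rightarrow> 'v::ab_group_add \<Rightarrow> 'v) \<Rightarrow>
     (complex^'n^'n \<Rightarrow> 'v \<Rightarrow> 'v) \<Rightarrow> 'v set \<Rightarrow> bool" where
  "thin_module S x scl act V \<longleftrightarrow>
     (\<forall>s\<in>S. vector_space.dim scl (act (dual_idempotent x s) ` V) \<le> 1)"

definition dual_diameter ::
    "('n::finite \<times> 'n) set set \<Rightarrow> 'n \<Rightarrow> (complex^'n^'n \<Rightarrow> 'v::zero \<Rightarrow> 'v) \<Rightarrow> 'v set \<Rightarrow> nat" where
  "dual_diameter S x act V = card {s \<in> S. act (dual_idempotent x s) ` V \<noteq> {0}}"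

definition is_character ::
    "('a::field^'n::finite^'n) set \<Rightarrow> ('a \<Rightarrow> 'v::ab_group_add \<Rightarrow> 'v) \<Rightarrow> ('a^'n^'n \<Rightarrow> 'v \<Rightarrow> 'v) \<Rightarrow>
     'v set \<Rightarrow> ('a^'n^'n \<Rightarrow> 'a) \<Rightarrow> bool" where
  "is_character T scl act V ch \<longleftrightarrow> (\<forall>M\<in>T. ch M = vector_space.trace_on scl V (act M))"


section \<open>Ring-theoretic notions\<close>

definition ring_center :: "('a, 'm) ring_scheme \<Rightarrow> 'a set" where
  "ring_center R = {z \<in> carrier R. \<forall>a\<in>carrier R. z \<otimes>\<^bsub>R\<^esub> a = a \<otimes>\<^bsub>R\<^esub> z}"

locale division_algebra = ring +
  assumes division: "\<one> \<noteq> \<zero>" "Units R = carrier R - {\<zero>}"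

definition matrix_ring :: "nat \<Rightarrow> ('a, 'm) ring_scheme \<Rightarrow> (nat \<times> nat \<Rightarrow> 'a) ring" where
  "matrix_ring r R =
     \<lparr>carrier = {..<r} \<times> {..<r} \<rightarrow>\<^sub>E carrier R,
      monoid.mult = (\<lambda>M N. \<lambda>(i, j)\<in>{..<r} \<times> {..<r}. \<Oplus>\<^bsub>R\<^esub>k\<in>{..<r}. M (i, k) \<otimes>\<^bsub>R\<^esub> N (k, j)),
      one = (\<lambda>(i, j)\<in>{..<r} \<times> {..<r}. if i = j then \<one>\<^bsub>R\<^esub> else \<zero>\<^bsub>R\<^esub>),
      ring.zero = (\<lambda>(i, j)\<in>{..<r} \<times> {..<r}. \<zero>\<^bsub>R\<^esub>),
      add = (\<lambda>M N. \<lambda>(i, j)\<in>{..<r} \<times> {..<r}. M (i, j) \<oplus>\<^bsub>R\<^esub> N (i, j))\<rparr>"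

definition central_idempotent :: "('a::field^'n::finite^'n) set \<Rightarrow> 'a^'n^'n \<Rightarrow> bool" where
  "central_idempotent A e \<longleftrightarrow> e \<in> A \<and> e ** e = e \<and> (\<forall>M\<in>A. e ** M = M ** e)"

definition centrally_primitive :: "('a::field^'n::finite^'n) set \<Rightarrow> 'a^'n^'n \<Rightarrow> bool" where
  "centrally_primitive A e \<longleftrightarrow>
     central_idempotent A e \<and> e \<noteq> 0 \<and>
     (\<forall>f g. central_idempotent A f \<and> central_idempotent A g \<and> f ** g = 0 \<and> f + g = e
            \<longrightarrow> f = 0 \<or> g = 0)"

definition corner_ring :: "('a::field^'n::finite^'n) set \<Rightarrow> 'a^'n^'n \<Rightarrow> ('a^'n^'n) ring" where
  "corner_ring A e =
     \<lparr>carrier = (\<lambda>M. M ** e) ` A, monoid.mult = (**), one = e, ring.zero = 0, add = (+)\<rparr>"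


section \<open>The simple component of the rational Terwilliger algebra\<close>

text \<open>Since \<open>\<chi>\<close> is \<open>\<complex>\<close>-linear on \<open>T\<^sub>x\<close>, the field \<open>\<rat>(\<chi>)\<close> is generated by the values of \<open>\<chi>\<close> on
  the rational form \<open>\<rat>T\<^sub>x\<close>.\<close>

definition character_field ::
    "('n::finite \<times> 'n) set set \<Rightarrow> 'n \<Rightarrow> (complex^'n^'n \<Rightarrow> complex) \<Rightarrow> complex ring" where
  "character_field S x ch =
     ring_of_type_algebra\<lparr>carrier :=
       generate_field ring_of_type_algebra
         ((\<lambda>M. ch (map_matrix of_rat M)) ` (terwilliger_algebra S x :: (rat^'n^'n) set))\<rparr>"

text \<open>The idempotent \<open>e\<^sub>\<chi>\<close> of \<open>T\<^sub>x\<close>: the one that does not annihilate the module affording \<open>\<chi>\<close>.\<close>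

definition character_idempotent ::
    "('n::finite \<times> 'n) set set \<Rightarrow> 'n \<Rightarrow> (complex^'n^'n \<Rightarrow> complex) \<Rightarrow> complex^'n^'n" where
  "character_idempotent S x ch =
     (THE e. centrally_primitive (terwilliger_algebra S x) e \<and> ch e \<noteq> 0)"

text \<open>As splitting field of \<open>\<rat>T\<^sub>x\<close> we take the algebraic closure of \<open>\<rat>\<close> in \<open>\<complex>\<close>; the entries of
  \<open>e\<^sub>\<chi>\<close> lie in it.  Its automorphisms restrict onto the Galois group of every finite Galois
  extension of \<open>\<rat>\<close> in \<open>\<complex>\<close>, so any splitting field that is Galois over \<open>\<rat>\<close> yields the same
  conjugates.  The values of \<open>\<sigma>\<close> outside the algebraic numbers are irrelevant.\<close>

definition algebraic_numbers :: "complex ring" where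
  "algebraic_numbers = ring_of_type_algebra\<lparr>carrier := {z. algebraic z}\<rparr>"

definition galois_conjugates :: "complex^'n::finite^'n \<Rightarrow> (complex^'n^'n) set" where
  "galois_conjugates M =
     {map_matrix \<sigma> M | \<sigma>. \<sigma> \<in> ring_iso algebraic_numbers algebraic_numbers}"

definition rational_idempotent ::
    "('n::finite \<times> 'n) set set \<Rightarrow> 'n \<Rightarrow> (complex^'n^'n \<Rightarrow> complex) \<Rightarrow> rat^'n^'n" where
  "rational_idempotent S x ch =
     (THE e. centrally_primitive (terwilliger_algebra S x) e \<and>
             map_matrix of_rat e = \<Sum> (galois_conjugates (character_idempotent S x ch)))"

definition simple_component ::
    "('n::finite \<times> 'n) set set \<Rightarrow> 'n \<Rightarrow> (complex^'n^'n \<Rightarrow> complex) \<Rightarrow> (rat^'n^'n) ring" where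
  "simple_component S x ch =
     corner_ring (terwilliger_algebra S x) (rational_idempotent S x ch)"

text \<open>The value \<open>\<surd>[D : \<rat>(\<chi>)]\<close>, where the simple component is isomorphic to \<open>M\<^sub>r(D)\<close> and the centre
  of \<open>D\<close> is identified with \<open>\<rat>(\<chi>)\<close>.  Up to isomorphism \<open>D\<close> is \<open>f A f\<close> for a primitive idempotent
  \<open>f\<close> of the simple component \<open>A\<close>, so it is no restriction that the elements of \<open>D\<close> are rational
  matrices.  Unital ring homomorphisms between \<open>\<rat>\<close>-algebras are \<open>\<rat>\<close>-linear, so \<open>\<simeq>\<close> is isomorphism
  of \<open>\<rat>\<close>-algebras here.\<close>

definition rational_schur_index ::
    "('n::finite \<times> 'n) set set \<Rightarrow> 'n \<Rightarrow> (complex^'n^'n \<Rightarrow> complex) \<Rightarrow> real" where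
  "rational_schur_index S x ch =
     (THE m. \<exists>(D :: (rat^'n^'n) ring) r k.
        division_algebra D \<and>
        simple_component S x ch \<simeq> matrix_ring r D \<and>
        D\<lparr>carrier := ring_center D\<rparr> \<simeq> character_field S x ch \<and>
        ring.dimension D k (ring_center D) (carrier D) \<and>
        m = sqrt (real k))"

end

theory Submission
  imports Defs
begin

text \<open>
  A thin irreducible module \<open>V\<close> has a basis of vectors \<open>v\<^sub>s \<in> E\<^sub>s\<^sup>* V\<close>, and \<open>E\<^sub>s\<^sup>* T E\<^sub>s\<^sup>*\<close> acts on
  the line spanned by \<open>v\<^sub>s\<close> through a linear character.  Since \<open>\<chi>(E\<^sub>s\<^sup>* M)\<close> is the \<open>(s, s)\<close> matrix
  coefficient of \<open>M\<close>, the diagonal coefficients of \<open>\<rat>T\<^sub>x\<close> take exactly the values of \<open>\<chi>\<close>; they form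
  a finite-dimensional \<open>\<rat>\<close>-algebra without zero divisors, that is, the field \<open>K = \<rat>(\<chi>)\<close>.  Choosing
  each \<open>v\<^sub>s\<close> in \<open>\<rat>T\<^sub>x v\<close> for one fixed \<open>v = v\<^sub>t\<close> makes all coefficients of \<open>\<rat>T\<^sub>x\<close> lie in \<open>K\<close>, and
  \<open>\<rat>T\<^sub>x\<close> maps onto the full matrix ring over \<open>K\<close>.

  The kernel of this map is the complement of the simple component: \<open>e\<^sub>\<chi>\<close> is a multiple of the
  element \<open>z\<close> with \<open>trace (z M) = \<chi>(M)\<close>, hence is killed by every element acting as zero on \<open>V\<close> and has
  entries in \<open>K\<close>; so each Galois conjugate of \<open>e\<^sub>\<chi>\<close>, and therefore their sum, is killed by the kernel.

  The Schur index is well defined because \<open>M\<^sub>r(D) \<simeq> M\<^sub>d(K)\<close> forces \<open>D\<close> to be commutative: \<open>D\<close> is the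
  corner of an idempotent which, having a corner without zero divisors, has rank one over \<open>K\<close>.
\<close>

text \<open>Positivity is the engine. \<open>\<rat>T_x\<close> is closed under transposition, and on
  rational matrices the form \<open>trace (transpose A ** B)\<close> is a sum of squares at
  \<open>A = B\<close>. Hence \<open>\<rat>T_x\<close> has an orthogonal spanning set, whose
  coordinate formula is valid for \<open>T_x\<close> as well. This one formula produces
  \<open>z\<close>, gives nondegeneracy of the trace form, shows that conjugation and field
  automorphisms preserve \<open>T_x\<close>, and brings rational matrices in \<open>T_x\<close> down
  to \<open>\<rat>T_x\<close>. That \<open>z\<close> acts by a nonzero scalar is positivity again:
  \<open>z\<close> is normal, and a normal nilpotent matrix vanishes.

  The sum of the conjugates of \<open>e\<close> is rational only because automorphisms of the
  algebraic numbers move every irrational number. Embeddings are therefore extended by Zorn's lemma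
  at the start.

  The Schur index is a definite description ranging over all \<open>D\<close> and \<open>r\<close>.
  Its uniqueness rests on \<open>corner_commutative\<close>, a property of the component alone that
  constrains every decomposition into a matrix ring over some \<open>D\<close>.\<close>

hide_const (open) up_ring.coeff up_ring.monom module.smult Polynomials.degree
no_notation fps_nth (infixl \<open>$\<close> 75)

section \<open>Automorphisms of the field of algebraic numbers\<close>

interpretation rat_vs: vector_space "\<lambda>(q::rat) (z::'a::field_char_0). of_rat q * z"
  by unfold_locales (auto simp: algebra_simps of_rat_add of_rat_mult)

lemma rat_span_mult_left:
  fixes z :: "'a::field_char_0"
  assumes "\<And>b. b \<in> B \<Longrightarrow> z * b \<in> rat_vs.span B" and "w \<in> rat_vs.span B"
  shows "z * w \<in> rat_vs.span B"
  using assms(2)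
proof (induction rule: rat_vs.span_induct_alt)
  case base
  then show ?case by (simp add: rat_vs.span_zero)
next
  case (step c x y)
  have "z * (of_rat c * x + y) = of_rat c * (z * x) + z * y"
    by (simp add: algebra_simps)
  then show ?case
    using step assms(1) by (metis rat_vs.span_add rat_vs.span_scale)
qed

text \<open>Multiplication by \<open>z\<close> preserves the span, so all powers of \<open>z\<close>
  lie in it, and \<open>card B + 1\<close> of them must be linearly related.\<close>

lemma algebraic_if_finite_rat_span:
  fixes z :: "'a::field_char_0"
  assumes "finite B" and one: "1 \<in> rat_vs.span B"
    and closed: "\<And>b. b \<in> B \<Longrightarrow> z * b \<in> rat_vs.span B"
  shows "algebraic z"
proof -
  have pow: "z ^ i \<in> rat_vs.span B" for i
    by (induction i) (auto simp: one intro: rat_span_mult_left closed)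
  show ?thesis
  \<comment> \<open>Dependence is a statement about the set of powers; it yields a polynomial with
    one coefficient per power only if the powers are distinct. A coincidence of two powers is itself
    a relation.\<close>
  proof (cases "inj_on (\<lambda>i. z ^ i) {..card B}")
    case False
    then obtain i j where ij: "i \<noteq> j" "z ^ i = z ^ j"
      by (auto simp: inj_on_def)
    define p where "p = monom 1 i - (monom 1 j :: 'a poly)"
    have "coeff p i \<noteq> 0"
      using ij by (simp add: p_def)
    then have "p \<noteq> 0" by force
    moreover have "poly p z = 0"
      using ij by (simp add: p_def poly_monom)
    moreover have "coeff p k \<in> \<rat>" for k
      by (simp add: p_def)
    ultimately show ?thesis
      unfolding algebraic_altdef by blast
  next
    case True
    let ?P = "(\<lambda>i. z ^ i) ` {..card B}"
    have "card ?P = Suc (card B)"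
      using True by (simp add: card_image)
    moreover have "?P \<subseteq> rat_vs.span B"
      using pow by auto
    ultimately have "rat_vs.dependent ?P"
      using rat_vs.independent_span_bound[OF assms(1), of ?P] by auto
    then obtain u v where uv: "v \<in> ?P" "u v \<noteq> 0" "(\<Sum>v\<in>?P. of_rat (u v) * v) = 0"
      using rat_vs.dependent_finite[of ?P] by auto
    then obtain k where k: "k \<le> card B" "v = z ^ k" by auto
    define p where "p = (\<Sum>i\<le>card B. monom (of_rat (u (z ^ i)) :: 'a) i)"
    have cp: "coeff p i = (if i \<le> card B then of_rat (u (z ^ i)) else 0)" for i
      by (auto simp: p_def coeff_sum)
    have "coeff p k \<noteq> 0"
      using k uv by (simp add: cp)
    then have "p \<noteq> 0" by force
    moreover have "poly p z = 0"
      using uv(3) True by (simp add: p_def poly_sum poly_monom sum.reindex)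
    moreover have "coeff p i \<in> \<rat>" for i
      by (simp add: cp)
    ultimately show ?thesis
      unfolding algebraic_altdef by blast
  qed
qed

text \<open>A polynomial relation of degree \<open>n\<close> expresses \<open>z ^ n\<close> by lower
  powers, so their span is stable under multiplication by \<open>z\<close>.\<close>

lemma algebraic_imp_finite_rat_span:
  fixes z :: "'a::field_char_0"
  assumes "algebraic z"
  obtains n where "\<And>i. z ^ i \<in> rat_vs.span ((\<lambda>i. z ^ i) ` {..<n::nat})"
proof -
  obtain p where p: "\<And>i. coeff p i \<in> \<rat>" "p \<noteq> 0" "poly p z = 0"
    using assms unfolding algebraic_altdef by blast
  define n where "n = degree p"
  let ?B = "(\<lambda>i. z ^ i) ` {..<n}"
  define a where "a = coeff p n"
  have a: "a \<noteq> 0" "a \<in> \<rat>" using p by (auto simp: a_def n_def)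
  have "0 = (\<Sum>i\<le>n. coeff p i * z ^ i)"
    using p(3) by (simp add: poly_altdef n_def)
  also have "\<dots> = (\<Sum>i<n. coeff p i * z ^ i) + a * z ^ n"
    by (simp add: a_def n_def lessThan_Suc_atMost [symmetric])
  finally have "a * z ^ n = - (\<Sum>i<n. coeff p i * z ^ i)"
    by (metis add_eq_0_iff2 minus_unique)
  then have "z ^ n = - (\<Sum>i<n. coeff p i * z ^ i) / a"
    using a by (simp add: field_simps)
  also have "\<dots> = (\<Sum>i<n. (- coeff p i / a) * z ^ i)"
    by (simp add: sum_divide_distrib sum_negf)
  finally have zn: "z ^ n = (\<Sum>i<n. (- coeff p i / a) * z ^ i)" .
  have "\<exists>q. of_rat q = - coeff p i / a" for i
    using p(1)[of i] a(2) by (metis Rats_cases Rats_divide Rats_minus_iff)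
  then obtain q where q: "\<And>i. of_rat (q i) = - coeff p i / a" by metis
  have step: "z ^ n \<in> rat_vs.span ?B"
    unfolding zn q [symmetric]
    by (intro rat_vs.span_sum rat_vs.span_scale rat_vs.span_base) auto
  have cl: "z * b \<in> rat_vs.span ?B" if bB: "b \<in> ?B" for b
  proof -
    obtain i where i: "i < n" "b = z ^ i" using bB by auto
    then show ?thesis
      by (cases "Suc i = n") (use step in \<open>auto intro!: rat_vs.span_base simp flip: power_Suc\<close>)
  qed
  have "1 \<in> rat_vs.span ?B"
  \<comment> \<open>For \<open>n = 0\<close> the spanning set is empty, but then \<open>p\<close>
    would be a nonzero constant with a root.\<close>
  proof (cases n)
    case 0
    with p(3) have "coeff p (degree p) = 0" by (simp add: n_def poly_altdef)
    with p(2) have False by simp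
    then show ?thesis ..
  next
    case (Suc m)
    then show ?thesis by (intro rat_vs.span_base image_eqI[of _ _ 0]) auto
  qed
  then have "z ^ i \<in> rat_vs.span ?B" for i
    by (induction i) (auto intro: rat_span_mult_left cl)
  then show ?thesis by (rule that)
qed

text \<open>The products \<open>x ^ i * y ^ j\<close> with bounded exponents span a space that
  contains 1 and is stable under multiplication by \<open>x\<close> and by \<open>y\<close>, hence
  also by their sum and product.\<close>

lemma
  fixes x y :: "'a::field_char_0"
  assumes "algebraic x" "algebraic y"
  shows algebraic_add: "algebraic (x + y)" and algebraic_mult: "algebraic (x * y)"
proof -
  obtain m where m: "\<And>i. x ^ i \<in> rat_vs.span ((\<lambda>i. x ^ i) ` {..<m::nat})"
    using algebraic_imp_finite_rat_span[OF assms(1)] by blast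
  obtain n where n: "\<And>i. y ^ i \<in> rat_vs.span ((\<lambda>i. y ^ i) ` {..<n::nat})"
    using algebraic_imp_finite_rat_span[OF assms(2)] by blast
  define B where "B = (\<lambda>(i, j). x ^ i * y ^ j) ` ({..<m} \<times> {..<n})"
  have "finite B" by (simp add: B_def)
  have xy: "x ^ i * y ^ j \<in> rat_vs.span B" for i j
  proof -
    have *: "x ^ i * w \<in> rat_vs.span B" if "w \<in> (\<lambda>i. y ^ i) ` {..<n}" for i w
      using m[of i]
    proof (induction rule: rat_vs.span_induct_alt)
      case base
      then show ?case by (simp add: rat_vs.span_zero)
    next
      case (step c u v)
      have "u * w \<in> rat_vs.span B"
        using step that by (intro rat_vs.span_base) (auto simp: B_def)
      then have "of_rat c * (u * w) + v * w \<in> rat_vs.span B"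
        using step by (intro rat_vs.span_add rat_vs.span_scale)
      then show ?case by (simp add: algebra_simps)
    qed
    show ?thesis
      using n[of j]
    proof (induction rule: rat_vs.span_induct_alt)
      case base
      then show ?case by (simp add: rat_vs.span_zero)
    next
      case (step c u v)
      then have "of_rat c * (x ^ i * u) + x ^ i * v \<in> rat_vs.span B"
        using step * by (intro rat_vs.span_add rat_vs.span_scale)
      then show ?case by (simp add: algebra_simps)
    qed
  qed
  have xb: "x * b \<in> rat_vs.span B" and yb: "y * b \<in> rat_vs.span B" if bB: "b \<in> B" for b
  proof -
    obtain i j where b: "b = x ^ i * y ^ j" using bB by (auto simp: B_def)
    show "x * b \<in> rat_vs.span B" "y * b \<in> rat_vs.span B"
      using xy[of "Suc i" j] xy[of i "Suc j"] by (simp_all add: b algebra_simps)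
  qed
  have one: "1 \<in> rat_vs.span B" using xy[of 0 0] by simp
  show "algebraic (x + y)"
    by (rule algebraic_if_finite_rat_span[OF \<open>finite B\<close> one])
      (auto simp: distrib_right intro!: rat_vs.span_add xb yb)
  show "algebraic (x * y)"
    by (rule algebraic_if_finite_rat_span[OF \<open>finite B\<close> one])
      (use rat_span_mult_left[OF xb yb] in \<open>simp add: mult.assoc\<close>)
qed

lemma algebraic_sum:
  fixes f :: "'b \<Rightarrow> 'a::field_char_0"
  assumes "\<And>i. i \<in> A \<Longrightarrow> algebraic (f i)"
  shows "algebraic (sum f A)"
  using assms by (induction A rule: infinite_finite_induct) (auto intro: algebraic_add)

lemma algebraic_poly:
  fixes z :: "'a::field_char_0"
  assumes "\<And>i. algebraic (coeff p i)" "algebraic z"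
  shows "algebraic (poly p z)"
proof -
  have "algebraic (z ^ i)" for i
    by (induction i) (auto intro: algebraic_mult assms)
  then show ?thesis
    unfolding poly_altdef by (intro algebraic_sum algebraic_mult assms)
qed

text \<open>Factors of the indeterminate are stripped from an annihilating polynomial until its
  constant term \<open>c\<close> is nonzero; then \<open>z * poly q z = - c\<close> exhibits the
  inverse.\<close>

lemma inverse_eq_poly_if_algebraic:
  fixes z :: "'a::field_char_0"
  assumes "algebraic z" "z \<noteq> 0"
  obtains r where "\<And>i. coeff r i \<in> \<rat>" "inverse z = poly r z"
proof -
  obtain p where "\<forall>i. coeff p i \<in> \<rat>" "p \<noteq> 0" "poly p z = 0"
    using assms unfolding algebraic_altdef by blast
  then have "\<exists>r. (\<forall>i. coeff r i \<in> \<rat>) \<and> inverse z = poly r z"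
  proof (induction p)
    case 0
    then show ?case by simp
  next
    case (pCons c q)
    have cq: "c \<in> \<rat>" "\<And>i. coeff q i \<in> \<rat>"
      using pCons.prems(1) by (metis coeff_pCons_0, metis coeff_pCons_Suc)
    show ?case
    proof (cases "c = 0")
      case True
      then show ?thesis using pCons cq assms(2) by auto
    next
      case False
      have "z * poly q z = - c"
        using pCons.prems(3) by (simp add: eq_neg_iff_add_eq_0 add.commute)
      then have "inverse z = poly (smult (- inverse c) q) z"
        using False assms(2) by (simp add: field_simps)
      moreover have "coeff (smult (- inverse c) q) i \<in> \<rat>" for i
        using cq by simp
      ultimately show ?thesis by blast
    qed
  qed
  then show ?thesis using that by blast
qed


text \<open>Graphs of ring homomorphisms between subrings of the field of algebraic numbers.  Closure under
  inverses need not be required: the inverse of an algebraic number \<open>a\<close> is a rational polynomial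
  in \<open>a\<close>.\<close>

definition partial_embedding :: "('a::field_char_0 \<times> 'a) set \<Rightarrow> bool" where
  "partial_embedding G \<longleftrightarrow>
     G \<subseteq> {z. algebraic z} \<times> {z. algebraic z} \<and>
     (\<forall>q\<in>\<rat>. (q, q) \<in> G) \<and>
     (\<forall>a b c d. (a, b) \<in> G \<longrightarrow> (c, d) \<in> G \<longrightarrow> (a + c, b + d) \<in> G \<and> (a * c, b * d) \<in> G) \<and>
     (\<forall>b. (0, b) \<in> G \<longrightarrow> b = 0)"

context
  fixes G :: "('a::field_char_0 \<times> 'a) set"
  assumes G: "partial_embedding G"
begin

lemma partial_embedding_Rats: "q \<in> \<rat> \<Longrightarrow> (q, q) \<in> G"
  and partial_embedding_add: "(a, b) \<in> G \<Longrightarrow> (c, d) \<in> G \<Longrightarrow> (a + c, b + d) \<in> G"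
  and partial_embedding_mult: "(a, b) \<in> G \<Longrightarrow> (c, d) \<in> G \<Longrightarrow> (a * c, b * d) \<in> G"
  and partial_embedding_zero: "(0, b) \<in> G \<Longrightarrow> b = 0"
  and partial_embedding_algebraic: "(a, b) \<in> G \<Longrightarrow> algebraic a" "(a, b) \<in> G \<Longrightarrow> algebraic b"
proof -
  show "q \<in> \<rat> \<Longrightarrow> (q, q) \<in> G"
    using G unfolding partial_embedding_def by (elim conjE) simp
  show "(a, b) \<in> G \<Longrightarrow> (c, d) \<in> G \<Longrightarrow> (a + c, b + d) \<in> G"
    using G unfolding partial_embedding_def by (elim conjE) simp
  show "(a, b) \<in> G \<Longrightarrow> (c, d) \<in> G \<Longrightarrow> (a * c, b * d) \<in> G"
    using G unfolding partial_embedding_def by (elim conjE) simp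
  show "(0, b) \<in> G \<Longrightarrow> b = 0"
    using G unfolding partial_embedding_def by (elim conjE) simp
  show "(a, b) \<in> G \<Longrightarrow> algebraic a" "(a, b) \<in> G \<Longrightarrow> algebraic b"
    using G unfolding partial_embedding_def by blast+
qed

lemma partial_embedding_diff:
  assumes "(a, b) \<in> G" "(c, d) \<in> G"
  shows "(a - c, b - d) \<in> G"
  using partial_embedding_add[OF assms(1) partial_embedding_mult[OF partial_embedding_Rats[of "-1"] assms(2)]]
  by simp

lemma partial_embedding_sum:
  assumes "\<And>i. i \<in> A \<Longrightarrow> (f i, g i) \<in> G"
  shows "(sum f A, sum g A) \<in> G"
  using assms
  by (induction A rule: infinite_finite_induct)
    (auto intro: partial_embedding_add partial_embedding_Rats)

lemma partial_embedding_unique: "(a, b) \<in> G \<Longrightarrow> (a, b') \<in> G \<Longrightarrow> b = b'"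
  using partial_embedding_zero[of "b - b'"] partial_embedding_diff[of a b a b'] by simp

text \<open>With \<open>inverse a = poly r a\<close> for a rational \<open>r\<close>, the relation
  \<open>a * poly r a = 1\<close> is carried to \<open>b * poly r b = 1\<close>.\<close>

lemma partial_embedding_inverse:
  assumes "(a, b) \<in> G" "a \<noteq> 0"
  shows "b \<noteq> 0" "(inverse a, inverse b) \<in> G"
proof -
  obtain r where r: "\<And>i. coeff r i \<in> \<rat>" "inverse a = poly r a"
    using inverse_eq_poly_if_algebraic partial_embedding_algebraic assms by metis
  have pow: "(a ^ i, b ^ i) \<in> G" for i
    by (induction i) (auto intro: partial_embedding_mult partial_embedding_Rats assms)
  have inv: "(inverse a, poly r b) \<in> G"
    unfolding r(2) unfolding poly_altdef
    by (intro partial_embedding_sum partial_embedding_mult partial_embedding_Rats r(1) pow)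
  have "(1, b * poly r b) \<in> G"
    using partial_embedding_mult[OF assms(1) inv] assms(2) by simp
  then have *: "b * poly r b = 1"
    using partial_embedding_unique partial_embedding_Rats[of 1] by auto
  then show "b \<noteq> 0" by auto
  then show "(inverse a, inverse b) \<in> G"
    using inv * by (metis inverse_unique)
qed

lemma partial_embedding_eq_zero_iff: "(a, b) \<in> G \<Longrightarrow> a = 0 \<longleftrightarrow> b = 0"
  using partial_embedding_inverse(1) partial_embedding_zero by auto

text \<open>The coefficientwise image of a polynomial under the embedding, as a relation because
  \<open>G\<close> is a graph.\<close>

definition poly_pair :: "'a poly \<Rightarrow> 'a poly \<Rightarrow> bool" where
  "poly_pair u v \<longleftrightarrow> (\<forall>i. (coeff u i, coeff v i) \<in> G)"

lemma poly_pair_add: "poly_pair u v \<Longrightarrow> poly_pair u' v' \<Longrightarrow> poly_pair (u + u') (v + v')"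
  and poly_pair_diff: "poly_pair u v \<Longrightarrow> poly_pair u' v' \<Longrightarrow> poly_pair (u - u') (v - v')"
  and poly_pair_mult: "poly_pair u v \<Longrightarrow> poly_pair u' v' \<Longrightarrow> poly_pair (u * u') (v * v')"
  and poly_pair_monom: "(a, b) \<in> G \<Longrightarrow> poly_pair (monom a n) (monom b n)"
  and poly_pair_rat: "(\<And>i. coeff u i \<in> \<rat>) \<Longrightarrow> poly_pair u u"
  by (simp_all add: poly_pair_def coeff_mult coeff_monom partial_embedding_add partial_embedding_diff
      partial_embedding_sum partial_embedding_mult partial_embedding_Rats)

lemma poly_pair_eq_0_iff: "poly_pair u v \<Longrightarrow> u = 0 \<longleftrightarrow> v = 0"
  unfolding poly_pair_def poly_eq_iff using partial_embedding_eq_zero_iff by auto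

lemma poly_pair_degree: "poly_pair u v \<Longrightarrow> degree u = degree v"
proof -
  assume "poly_pair u v"
  then have "coeff u i = 0 \<longleftrightarrow> coeff v i = 0" for i
    unfolding poly_pair_def using partial_embedding_eq_zero_iff by blast
  then show ?thesis by (simp add: degree_def)
qed

text \<open>Division by a minimal polynomial \<open>p\<close> of \<open>a\<close>, performed in
  parallel on both sides: subtracting \<open>monom c k * p\<close> cancels the leading term of
  \<open>u\<close>, and the corresponding step is made for \<open>v\<close>. Minimality leaves no
  nonzero remainder of smaller degree.\<close>

lemma poly_pair_transfer_root:
  assumes p: "poly_pair p p'" "p \<noteq> 0" "poly p a = 0" "poly p' b = 0"
    and min: "\<And>u v. poly_pair u v \<Longrightarrow> u \<noteq> 0 \<Longrightarrow> poly u a = 0 \<Longrightarrow> degree p \<le> degree u"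
    and uv: "poly_pair u v" "poly u a = 0"
  shows "poly v b = 0"
  using uv
proof (induction "degree u" arbitrary: u v rule: less_induct)
  case less
  show ?case
  proof (cases "u = 0")
    case True
    then show ?thesis using poly_pair_eq_0_iff less.prems by auto
  next
    case False
    define k where "k = degree u - degree p"
    define c where "c = coeff u (degree u) * inverse (coeff p (degree p))"
    define c' where "c' = coeff v (degree u) * inverse (coeff p' (degree p))"
    define u1 where "u1 = u - monom c k * p"
    define v1 where "v1 = v - monom c' k * p'"
    have deg: "degree p \<le> degree u" using min[OF less.prems(1) False less.prems(2)] .
    have cc: "(c, c') \<in> G"
      unfolding c_def c'_def using less.prems(1) p(1,2)
      by (intro partial_embedding_mult partial_embedding_inverse(2))
        (auto simp: poly_pair_def)
    have pp: "poly_pair u1 v1"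
      unfolding u1_def v1_def
      by (rule poly_pair_diff[OF less.prems(1) poly_pair_mult[OF poly_pair_monom[OF cc] p(1)]])
    have u1a: "poly u1 a = 0"
      using less.prems p by (simp add: u1_def)
    have "poly v1 b = 0"
    proof (cases "u1 = 0")
      case True
      then show ?thesis using poly_pair_eq_0_iff[OF pp] by simp
    next
      case u1: False
      have "degree (monom c k * p) \<le> degree u"
        using degree_mult_le[of "monom c k" p] degree_monom_le[of c k] deg by (simp add: k_def)
      then have "degree u1 \<le> degree u"
        unfolding u1_def by (intro degree_diff_le) simp_all
      moreover have "coeff u1 (degree u) = 0"
        using deg p(2) by (simp add: u1_def k_def coeff_monom_mult c_def)
      ultimately have "degree u1 < degree u"
        using u1 by (metis le_neq_implies_less leading_coeff_0_iff)
      then show ?thesis using less.hyps pp u1a by blast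
    qed
    then show ?thesis using p(4) by (simp add: v1_def)
  qed
qed

text \<open>The enlarged ring consists of the values of polynomials at \<open>a\<close>; that the
  value 0 has only the image 0 is \<open>poly_pair_transfer_root\<close>. A rational polynomial
  corresponds to itself, so \<open>b\<close> is a root of any rational polynomial vanishing at
  \<open>a\<close>, hence algebraic.\<close>

lemma partial_embedding_extend:
  assumes p: "poly_pair p p'" "p \<noteq> 0" "poly p a = 0" "poly p' b = 0"
    and min: "\<And>u v. poly_pair u v \<Longrightarrow> u \<noteq> 0 \<Longrightarrow> poly u a = 0 \<Longrightarrow> degree p \<le> degree u"
    and "algebraic a"
  obtains G' where "partial_embedding G'" "G \<subseteq> G'" "(a, b) \<in> G'"
proof
  define G' where "G' = {(poly u a, poly v b) | u v. poly_pair u v}"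
  obtain f where f: "\<And>i. coeff f i \<in> \<rat>" "f \<noteq> 0" "poly f a = 0"
    using \<open>algebraic a\<close> unfolding algebraic_altdef by blast
  have "poly f b = 0"
    using poly_pair_transfer_root[OF p _ poly_pair_rat[OF f(1)] f(3)] min by blast
  then have "algebraic b"
    using f unfolding algebraic_altdef by blast
  have G'I: "poly_pair u v \<Longrightarrow> x = poly u a \<Longrightarrow> y = poly v b \<Longrightarrow> (x, y) \<in> G'" for x y u v
    unfolding G'_def by blast
  have const: "(x, y) \<in> G \<Longrightarrow> (x, y) \<in> G'" for x y
    by (rule G'I[OF poly_pair_monom[of x y 0]]) (auto simp: poly_monom)
  show "G \<subseteq> G'" using const by auto
  show "(a, b) \<in> G'"
    by (rule G'I[OF poly_pair_monom[of 1 1 1]])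
      (auto simp: poly_monom intro: partial_embedding_Rats)
  show "partial_embedding G'"
    unfolding partial_embedding_def
  proof (intro conjI allI impI ballI)
    show "G' \<subseteq> {z. algebraic z} \<times> {z. algebraic z}"
      unfolding G'_def poly_pair_def
      by (auto intro!: algebraic_poly \<open>algebraic a\<close> \<open>algebraic b\<close> dest: partial_embedding_algebraic)
    show "(q, q) \<in> G'" if "q \<in> \<rat>" for q
      using const partial_embedding_Rats that by blast
    fix x y z w
    assume "(x, y) \<in> G'" "(z, w) \<in> G'"
    then obtain u v u' v' where uv: "poly_pair u v" "poly_pair u' v'"
        "x = poly u a" "y = poly v b" "z = poly u' a" "w = poly v' b"
      unfolding G'_def by blast
    show "(x + z, y + w) \<in> G'"
      by (rule G'I[OF poly_pair_add[OF uv(1,2)]]) (simp_all add: uv)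
    show "(x * z, y * w) \<in> G'"
      by (rule G'I[OF poly_pair_mult[OF uv(1,2)]]) (simp_all add: uv)
  next
    fix y
    assume "(0, y) \<in> G'"
    then show "y = 0"
      unfolding G'_def using poly_pair_transfer_root[OF p] min
      by (smt (verit, best) Pair_inject mem_Collect_eq)
  qed
qed

end

text \<open>A least-degree polynomial over the domain of \<open>G\<close> vanishing at
  \<open>a\<close> is not constant; neither is its image under \<open>G\<close>, which therefore has
  a complex root to serve as \<open>b\<close>.\<close>

lemma partial_embedding_extend_total:
  fixes G :: "(complex \<times> complex) set"
  assumes G: "partial_embedding G" and "algebraic a"
  obtains G' b where "partial_embedding G'" "G \<subseteq> G'" "(a, b) \<in> G'"
proof -
  let ?P = "\<lambda>u. u \<noteq> 0 \<and> poly u a = 0 \<and> (\<exists>v. poly_pair G u v)"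
  obtain f where f: "\<forall>i. coeff f i \<in> \<rat>" "f \<noteq> 0" "poly f a = 0"
    using \<open>algebraic a\<close> unfolding algebraic_altdef by blast
  have "?P f"
    using f poly_pair_rat[OF G, of f] by auto
  then have "\<exists>p. ?P p \<and> (\<forall>u. ?P u \<longrightarrow> degree p \<le> degree u)"
    by (rule ex_has_least_nat)
  then obtain p p' where p: "p \<noteq> 0" "poly p a = 0" and p': "poly_pair G p p'"
    and min: "\<And>u v. poly_pair G u v \<Longrightarrow> u \<noteq> 0 \<Longrightarrow> poly u a = 0 \<Longrightarrow> degree p \<le> degree u"
    by blast
  have "degree p \<noteq> 0"
    using p by (metis degree_eq_zeroE mult_zero_right pCons_0_0 poly_0 poly_pCons add_0_right)
  then have "\<not> constant (poly p')"
    using poly_pair_degree[OF G p'] by (simp add: constant_degree)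
  then obtain b where "poly p' b = 0"
    using fundamental_theorem_of_algebra by blast
  then obtain G' where "partial_embedding G'" "G \<subseteq> G'" "(a, b) \<in> G'"
    using partial_embedding_extend[OF G p' p _ _ assms(2)] min by metis
  then show ?thesis by (rule that)
qed

text \<open>By Zorn's lemma there is a maximal extension;
  \<open>partial_embedding_extend_total\<close> would enlarge it if some algebraic number had no
  image.\<close>

lemma partial_embedding_total:
  fixes G :: "(complex \<times> complex) set"
  assumes "partial_embedding G"
  obtains H where "partial_embedding H" "G \<subseteq> H" "\<And>a. algebraic a \<Longrightarrow> \<exists>b. (a, b) \<in> H"
proof -
  let ?A = "{H. partial_embedding H \<and> G \<subseteq> H}"
  have "\<exists>H\<in>?A. \<forall>Y\<in>?A. H \<subseteq> Y \<longrightarrow> Y = H"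
  proof (rule subset_Zorn_nonempty)
    show "?A \<noteq> {}" using assms by blast
    fix \<C>
    assume C: "\<C> \<noteq> {}" "subset.chain ?A \<C>"
    then have sub: "\<C> \<subseteq> ?A" and chain: "\<And>Y Z. Y \<in> \<C> \<Longrightarrow> Z \<in> \<C> \<Longrightarrow> Y \<subseteq> Z \<or> Z \<subseteq> Y"
      by (auto simp: subset_chain_def)
    have pe: "partial_embedding Y" if "Y \<in> \<C>" for Y using sub that by auto
    have "partial_embedding (\<Union>\<C>)"
      unfolding partial_embedding_def
    proof (intro conjI allI impI ballI)
      show "\<Union>\<C> \<subseteq> {z. algebraic z} \<times> {z. algebraic z}"
        using pe by (auto dest: partial_embedding_algebraic)
      show "(q, q) \<in> \<Union>\<C>" if "q \<in> \<rat>" for q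
        using partial_embedding_Rats[OF pe that] C(1) by blast
      show "b = 0" if "(0, b) \<in> \<Union>\<C>" for b
        using partial_embedding_zero[OF pe] that by blast
      fix a b c d
      assume "(a, b) \<in> \<Union>\<C>" "(c, d) \<in> \<Union>\<C>"
      then obtain Y Z where "Y \<in> \<C>" "(a, b) \<in> Y" "Z \<in> \<C>" "(c, d) \<in> Z"
        by blast
      then obtain W where W: "W \<in> \<C>" "(a, b) \<in> W" "(c, d) \<in> W"
        using chain[of Y Z] by blast
      show "(a + c, b + d) \<in> \<Union>\<C>"
        using partial_embedding_add[OF pe[OF W(1)] W(2,3)] W(1) by blast
      show "(a * c, b * d) \<in> \<Union>\<C>"
        using partial_embedding_mult[OF pe[OF W(1)] W(2,3)] W(1) by blast
    qed
    then show "\<Union>\<C> \<in> ?A" using C(1) sub by blast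
  qed
  then obtain H where "H \<in> ?A" and maxA: "\<forall>Y\<in>?A. H \<subseteq> Y \<longrightarrow> Y = H" ..
  then have H: "partial_embedding H" "G \<subseteq> H" by simp_all
  have max: "Y = H" if "partial_embedding Y" "H \<subseteq> Y" for Y
    using maxA that H(2) by (simp add: order_trans[OF H(2)])
  have "\<exists>b. (a, b) \<in> H" if "algebraic a" for a
    using partial_embedding_extend_total[OF H(1) that] max by metis
  then show ?thesis using H that by blast
qed

section \<open>Automorphisms move every irrational algebraic number\<close>

text \<open>Dividing the minimal polynomial by its factor at \<open>z\<close> leaves positive degree
  because \<open>z\<close> is irrational, and \<open>w\<close> is a root of the quotient. If
  \<open>w\<close> were \<open>z\<close>, the derivative would vanish at \<open>z\<close>, against
  minimality.\<close>

lemma rational_conjugate_exists: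
  fixes z :: complex
  assumes "algebraic z" "z \<notin> \<rat>"
  obtains p w where "\<And>i. coeff p i \<in> \<rat>" "p \<noteq> 0" "poly p z = 0" "poly p w = 0" "w \<noteq> z"
    "\<And>u. (\<And>i. coeff u i \<in> \<rat>) \<Longrightarrow> u \<noteq> 0 \<Longrightarrow> poly u z = 0 \<Longrightarrow> degree p \<le> degree u"
proof -
  let ?P = "\<lambda>p. (\<forall>i. coeff p i \<in> \<rat>) \<and> p \<noteq> 0 \<and> poly p z = 0"
  obtain f where "?P f"
    using assms(1) unfolding algebraic_altdef by blast
  then have "\<exists>p. ?P p \<and> (\<forall>u. ?P u \<longrightarrow> degree p \<le> degree u)"
    by (rule ex_has_least_nat)
  then obtain p where p: "\<And>i. coeff p i \<in> \<rat>" "p \<noteq> 0" "poly p z = 0"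
    and min: "\<And>u. (\<And>i. coeff u i \<in> \<rat>) \<Longrightarrow> u \<noteq> 0 \<Longrightarrow> poly u z = 0 \<Longrightarrow> degree p \<le> degree u"
    by blast
  obtain q where q: "p = [:- z, 1:] * q"
    using p(3) poly_eq_0_iff_dvd by (metis dvdE)
  have q0: "q \<noteq> 0" using p(2) q by auto
  have "degree p = Suc (degree q)"
    unfolding q using q0 by (subst degree_mult_eq) auto
  have "degree q \<noteq> 0"
  proof
    assume "degree q = 0"
    then obtain c where c: "q = [:c:]" by (metis degree_eq_zeroE)
    then have "c \<in> \<rat>" "c * z \<in> \<rat>" "c \<noteq> 0"
      using p(1)[of 0] p(1)[of 1] q0 by (auto simp: q)
    then have "z \<in> \<rat>"
      by (metis Rats_divide nonzero_mult_div_cancel_left)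
    then show False using assms(2) by simp
  qed
  then have "\<not> constant (poly q)" by (simp add: constant_degree)
  then obtain w where w: "poly q w = 0"
    using fundamental_theorem_of_algebra by blast
  have "w \<noteq> z"
  proof
    assume "w = z"
    with w have "poly (pderiv p) z = 0"
      unfolding q pderiv_mult by (simp add: pderiv_pCons)
    moreover have "coeff (pderiv p) i \<in> \<rat>" for i
      using p(1) by (simp add: coeff_pderiv)
    moreover have "pderiv p \<noteq> 0"
      using \<open>degree p = Suc (degree q)\<close> by (simp add: pderiv_eq_0_iff)
    ultimately have "degree p \<le> degree (pderiv p)" by (rule min[rotated 2])
    then show False
      using \<open>degree p = Suc (degree q)\<close> by (simp add: degree_pderiv)
  qed
  then show ?thesis
    using that[OF p, of w] w min by (simp add: q)
qed

text \<open>An irrational \<open>z\<close> has a conjugate \<open>w\<close> other than itself; the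
  embedding of \<open>\<rat>[z]\<close> that sends \<open>z\<close> to \<open>w\<close> extends to
  an automorphism, which moves \<open>z\<close>.\<close>

theorem rational_if_fixed_by_automorphisms:
  assumes "algebraic z"
    and fixed: "\<And>\<sigma>. \<sigma> \<in> ring_iso algebraic_numbers algebraic_numbers \<Longrightarrow> \<sigma> z = z"
  shows "z \<in> \<rat>"
proof (rule ccontr)
  assume "z \<notin> \<rat>"
  then obtain p w where p: "\<And>i. coeff p i \<in> \<rat>" "p \<noteq> 0" "poly p z = 0" "poly p w = 0" "w \<noteq> z"
    and min: "\<And>u. (\<And>i. coeff u i \<in> \<rat>) \<Longrightarrow> u \<noteq> 0 \<Longrightarrow> poly u z = 0 \<Longrightarrow> degree p \<le> degree u"
    using rational_conjugate_exists[OF assms(1)] by metis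
  \<comment> \<open>The identity of \<open>\<rat>\<close>: a \<open>poly_pair\<close> over it has
    rational coefficients, so \<open>min\<close> is the minimality that the extension step asks
    for.\<close>
  define G0 :: "(complex \<times> complex) set" where "G0 = {(q, q) | q. q \<in> \<rat>}"
  have G0: "partial_embedding G0"
    unfolding partial_embedding_def G0_def by (auto dest: rat_imp_algebraic)
  have rat: "coeff u i \<in> \<rat>" if "poly_pair G0 u v" for u v i
    using that unfolding poly_pair_def[OF G0] by (auto simp: G0_def)
  obtain G1 where "partial_embedding G1" "(z, w) \<in> G1"
    using partial_embedding_extend[OF G0 poly_pair_rat[OF G0 p(1)] p(2-4) _ assms(1)] min rat
    by metis
  then obtain H where H: "partial_embedding H" "(z, w) \<in> H"
    and total: "\<And>a. algebraic a \<Longrightarrow> \<exists>b. (a, b) \<in> H"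
    using partial_embedding_total by (metis subset_iff)
  define \<sigma> where "\<sigma> a = (THE b. (a, b) \<in> H)" for a
  have \<sigma>I: "\<sigma> a = b" if "(a, b) \<in> H" for a b
    unfolding \<sigma>_def using that partial_embedding_unique[OF H(1)] by blast
  have \<sigma>: "(a, \<sigma> a) \<in> H" if "algebraic a" for a
    using total[OF that] \<sigma>I by blast
  have add: "\<sigma> (a + b) = \<sigma> a + \<sigma> b" and mult: "\<sigma> (a * b) = \<sigma> a * \<sigma> b"
    if "algebraic a" "algebraic b" for a b
    by (rule \<sigma>I[OF partial_embedding_add[OF H(1) \<sigma>[OF that(1)] \<sigma>[OF that(2)]]],
        rule \<sigma>I[OF partial_embedding_mult[OF H(1) \<sigma>[OF that(1)] \<sigma>[OF that(2)]]])
  have ratq: "\<sigma> q = q" if "q \<in> \<rat>" for q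
    using partial_embedding_Rats[OF H(1) that] \<sigma>I by blast
  have inj: "inj_on \<sigma> {a. algebraic a}"
  proof (rule inj_onI)
    fix a b
    assume ab: "a \<in> {a. algebraic a}" "b \<in> {a. algebraic a}" "\<sigma> a = \<sigma> b"
    then have "(a - b, 0) \<in> H"
      using partial_embedding_diff[OF H(1) \<sigma>[of a] \<sigma>[of b]] by simp
    then show "a = b"
      using partial_embedding_eq_zero_iff[OF H(1)] by fastforce
  qed
  have roots: "poly f (\<sigma> a) = 0" if "\<And>i. coeff f i \<in> \<rat>" "poly f a = 0" "algebraic a" for f a
  proof -
    have pow: "(a ^ i, \<sigma> a ^ i) \<in> H" for i
      by (induction i)
        (use partial_embedding_mult[OF H(1)] partial_embedding_Rats[OF H(1)] \<sigma>[OF that(3)] in auto)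
    have "(poly f a, poly f (\<sigma> a)) \<in> H"
      unfolding poly_altdef
      using partial_embedding_mult[OF H(1) partial_embedding_Rats[OF H(1) that(1)] pow]
      by (rule partial_embedding_sum[OF H(1)])
    then show ?thesis using that(2) partial_embedding_zero[OF H(1)] by simp
  qed
  \<comment> \<open>Surjectivity: the finite root set of a rational polynomial is mapped injectively
    into itself, hence onto itself.\<close>
  have "\<sigma> ` {a. algebraic a} = {a. algebraic a}"
  proof (intro equalityI subsetI)
    show "b \<in> {a. algebraic a}" if "b \<in> \<sigma> ` {a. algebraic a}" for b
      using that partial_embedding_algebraic(2)[OF H(1) \<sigma>] by auto
    fix b :: complex
    assume "b \<in> {a. algebraic a}"
    then obtain f where f: "\<And>i. coeff f i \<in> \<rat>" "f \<noteq> 0" "poly f b = 0"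
      unfolding algebraic_altdef by blast
    let ?R = "{a. poly f a = 0}"
    have R: "?R \<subseteq> {a. algebraic a}"
      using f unfolding algebraic_altdef by blast
    have "finite ?R" using f(2) by (rule poly_roots_finite)
    moreover have "\<sigma> ` ?R \<subseteq> ?R" using roots[OF f(1)] R by auto
    moreover have "inj_on \<sigma> ?R" using inj R by (rule inj_on_subset)
    ultimately have "\<sigma> ` ?R = ?R" by (metis endo_inj_surj)
    then show "b \<in> \<sigma> ` {a. algebraic a}" using f(3) R by blast
  qed
  then have "\<sigma> \<in> ring_iso algebraic_numbers algebraic_numbers"
    using add mult ratq[of 1] inj
    by (auto simp: ring_iso_def ring_hom_def algebraic_numbers_def ring_of_type_algebra_def bij_betw_def)
  then have "\<sigma> z = z" by (rule fixed)
  then show False using \<sigma>I[OF H(2)] p(5) by simp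
qed


section \<open>Matrix rings over division algebras\<close>

lemma matrix_ring_iso:
  assumes "ring R" "ring S" "h \<in> ring_iso R S"
  shows "matrix_ring r R \<simeq> matrix_ring r S"
proof -
  interpret R: ring R by fact
  interpret S: ring S by fact
  note h = ring_iso_memE[OF assms(3)]
  have bij: "bij_betw h (carrier R) (carrier S)" by (rule h(5))
  interpret hom: ring_hom_ring R S h
    using h by unfold_locales (auto simp: ring_hom_def)
  let ?I = "{..<r} \<times> {..<r}"
  define H where "H M = (\<lambda>p\<in>?I. h (M p))" for M :: "nat \<times> nat \<Rightarrow> 'a"
  define g where "g = inv_into (carrier R) h"
  define H' where "H' M = (\<lambda>p\<in>?I. g (M p))" for M :: "nat \<times> nat \<Rightarrow> 'c"
  have g: "h (g y) = y" "g y \<in> carrier R" if "y \<in> carrier S" for y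
    using bij that unfolding g_def by (auto simp: bij_betw_inv_into_right bij_betw_def inv_into_into)
  have gh: "g (h y) = y" if "y \<in> carrier R" for y
    using bij that unfolding g_def by (simp add: bij_betw_inv_into_left)
  have closed: "H M \<in> carrier (matrix_ring r S)" if "M \<in> carrier (matrix_ring r R)" for M
    using that h(1) by (auto simp: matrix_ring_def H_def PiE_iff)
  have "H \<in> ring_iso (matrix_ring r R) (matrix_ring r S)"
  proof (rule ring_iso_memI)
    fix M N
    assume M: "M \<in> carrier (matrix_ring r R)" and N: "N \<in> carrier (matrix_ring r R)"
    show "H M \<in> carrier (matrix_ring r S)"
      using M by (rule closed)
    show "H (M \<otimes>\<^bsub>matrix_ring r R\<^esub> N) = H M \<otimes>\<^bsub>matrix_ring r S\<^esub> H N"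
    proof
      fix p
      have "h (\<Oplus>\<^bsub>R\<^esub>k\<in>{..<r}. M (i, k) \<otimes>\<^bsub>R\<^esub> N (k, j)) =
          (\<Oplus>\<^bsub>S\<^esub>k\<in>{..<r}. h (M (i, k)) \<otimes>\<^bsub>S\<^esub> h (N (k, j)))" if "i < r" "j < r" for i j
      proof -
        have "h (\<Oplus>\<^bsub>R\<^esub>k\<in>{..<r}. M (i, k) \<otimes>\<^bsub>R\<^esub> N (k, j)) =
            (\<Oplus>\<^bsub>S\<^esub>k\<in>{..<r}. (h \<circ> (\<lambda>k. M (i, k) \<otimes>\<^bsub>R\<^esub> N (k, j))) k)"
          using M N that by (subst hom.hom_finsum) (auto simp: matrix_ring_def PiE_iff comp_def)
        also have "\<dots> = (\<Oplus>\<^bsub>S\<^esub>k\<in>{..<r}. h (M (i, k)) \<otimes>\<^bsub>S\<^esub> h (N (k, j)))"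
          using M N that h
          by (intro S.finsum_cong') (auto simp: matrix_ring_def PiE_iff)
        finally show ?thesis .
      qed
      moreover have "(\<Oplus>\<^bsub>S\<^esub>k\<in>{..<r}. h (M (i, k)) \<otimes>\<^bsub>S\<^esub> h (N (k, j))) =
          (\<Oplus>\<^bsub>S\<^esub>k\<in>{..<r}. H M (i, k) \<otimes>\<^bsub>S\<^esub> H N (k, j))" if "i < r" "j < r" for i j
        using M N that h
        by (intro S.finsum_cong') (auto simp: matrix_ring_def PiE_iff H_def)
      ultimately show "H (M \<otimes>\<^bsub>matrix_ring r R\<^esub> N) p = (H M \<otimes>\<^bsub>matrix_ring r S\<^esub> H N) p"
        by (cases p) (auto simp: matrix_ring_def H_def)
    qed
    show "H (M \<oplus>\<^bsub>matrix_ring r R\<^esub> N) = H M \<oplus>\<^bsub>matrix_ring r S\<^esub> H N"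
      using M N h(3) by (auto simp: matrix_ring_def H_def PiE_iff fun_eq_iff)
  next
    show "H \<one>\<^bsub>matrix_ring r R\<^esub> = \<one>\<^bsub>matrix_ring r S\<^esub>"
      using h(4) by (auto simp: matrix_ring_def H_def fun_eq_iff)
    show "bij_betw H (carrier (matrix_ring r R)) (carrier (matrix_ring r S))"
    proof (rule bij_betw_byWitness[of _ H'])
      show "\<forall>M\<in>carrier (matrix_ring r R). H' (H M) = M"
        using gh by (auto simp: matrix_ring_def H_def H'_def PiE_iff fun_eq_iff extensional_def)
      show "\<forall>M\<in>carrier (matrix_ring r S). H (H' M) = M"
        using g by (auto simp: matrix_ring_def H_def H'_def PiE_iff fun_eq_iff extensional_def)
      show "H ` carrier (matrix_ring r R) \<subseteq> carrier (matrix_ring r S)"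
        using closed by (rule image_subsetI)
      show "H' ` carrier (matrix_ring r S) \<subseteq> carrier (matrix_ring r R)"
      proof (rule image_subsetI)
        fix M assume "M \<in> carrier (matrix_ring r S)"
        then show "H' M \<in> carrier (matrix_ring r R)"
          using g(2) by (auto simp: matrix_ring_def H'_def PiE_iff)
      qed
    qed
  qed
  then show ?thesis unfolding is_ring_iso_def by blast
qed

section \<open>Detecting commutativity of \<open>D\<close> through corners\<close>

text \<open>Stated without reference to \<open>D\<close>, so that it can be verified on one concrete
  ring and then used for every isomorphism to some \<open>matrix_ring r D\<close>.\<close>

definition corner_commutative :: "('a, 'm) ring_scheme \<Rightarrow> bool" where
  "corner_commutative R \<longleftrightarrow>
     (\<forall>f\<in>carrier R. f \<otimes>\<^bsub>R\<^esub> f = f \<longrightarrow> f \<noteq> \<zero>\<^bsub>R\<^esub> \<longrightarrow>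
       (\<forall>x\<in>carrier R. \<forall>y\<in>carrier R.
          (f \<otimes>\<^bsub>R\<^esub> x \<otimes>\<^bsub>R\<^esub> f) \<otimes>\<^bsub>R\<^esub> (f \<otimes>\<^bsub>R\<^esub> y \<otimes>\<^bsub>R\<^esub> f) = \<zero>\<^bsub>R\<^esub> \<longrightarrow>
          f \<otimes>\<^bsub>R\<^esub> x \<otimes>\<^bsub>R\<^esub> f = \<zero>\<^bsub>R\<^esub> \<or> f \<otimes>\<^bsub>R\<^esub> y \<otimes>\<^bsub>R\<^esub> f = \<zero>\<^bsub>R\<^esub>) \<longrightarrow>
       (\<forall>x\<in>carrier R. \<forall>y\<in>carrier R.
          (f \<otimes>\<^bsub>R\<^esub> x \<otimes>\<^bsub>R\<^esub> f) \<otimes>\<^bsub>R\<^esub> (f \<otimes>\<^bsub>R\<^esub> y \<otimes>\<^bsub>R\<^esub> f) =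
          (f \<otimes>\<^bsub>R\<^esub> y \<otimes>\<^bsub>R\<^esub> f) \<otimes>\<^bsub>R\<^esub> (f \<otimes>\<^bsub>R\<^esub> x \<otimes>\<^bsub>R\<^esub> f)))"

text \<open>The embedding of \<open>R\<close> into its matrix ring as the corner cut out by the
  first matrix unit.\<close>

definition matrix_corner :: "nat \<Rightarrow> ('a, 'm) ring_scheme \<Rightarrow> 'a \<Rightarrow> nat \<times> nat \<Rightarrow> 'a" where
  "matrix_corner r R a =
     (\<lambda>(i, j)\<in>{..<r} \<times> {..<r}. if i = 0 \<and> j = 0 then a else \<zero>\<^bsub>R\<^esub>)"

context ring
begin

lemma finsum_single_left:
  assumes "0 < r" "a \<in> carrier R" "\<And>k. k < r \<Longrightarrow> f k \<in> carrier R"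
  shows "(\<Oplus>k\<in>{..<r::nat}. (if k = 0 then a else \<zero>) \<otimes> f k) = a \<otimes> f 0"
proof -
  have "(\<Oplus>k\<in>{..<r::nat}. (if k = 0 then a else \<zero>) \<otimes> f k) =
      (\<Oplus>k\<in>{..<r}. if 0 = k then a \<otimes> f k else \<zero>)"
    using assms by (intro finsum_cong') auto
  also have "\<dots> = a \<otimes> f 0"
    using assms by (intro add.finprod_singleton) auto
  finally show ?thesis .
qed

lemma finsum_single_right:
  assumes "0 < r" "a \<in> carrier R" "\<And>k. k < r \<Longrightarrow> f k \<in> carrier R"
  shows "(\<Oplus>k\<in>{..<r::nat}. f k \<otimes> (if k = 0 then a else \<zero>)) = f 0 \<otimes> a"
proof -
  have "(\<Oplus>k\<in>{..<r::nat}. f k \<otimes> (if k = 0 then a else \<zero>)) =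
      (\<Oplus>k\<in>{..<r}. if 0 = k then f k \<otimes> a else \<zero>)"
    using assms by (intro finsum_cong') auto
  also have "\<dots> = f 0 \<otimes> a"
    using assms by (intro add.finprod_singleton) auto
  finally show ?thesis .
qed

lemma matrix_corner_closed: "a \<in> carrier R \<Longrightarrow> matrix_corner r R a \<in> carrier (matrix_ring r R)"
  by (auto simp: matrix_ring_def matrix_corner_def PiE_iff)

lemma matrix_corner_inject: "0 < r \<Longrightarrow> matrix_corner r R a = matrix_corner r R b \<longleftrightarrow> a = b"
  by (auto simp: matrix_corner_def fun_eq_iff split: if_splits)

lemma matrix_corner_mult_left:
  assumes "0 < r" "a \<in> carrier R" "M \<in> carrier (matrix_ring r R)"
  shows "matrix_corner r R a \<otimes>\<^bsub>matrix_ring r R\<^esub> M =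
    (\<lambda>(i, j)\<in>{..<r} \<times> {..<r}. if i = 0 then a \<otimes> M (0, j) else \<zero>)"
proof -
  have "(\<Oplus>k\<in>{..<r}. matrix_corner r R a (i, k) \<otimes> M (k, j)) =
      (if i = 0 then a \<otimes> M (0, j) else \<zero>)" if "i < r" "j < r" for i j
  proof (cases "i = 0")
    case True
    have "(\<Oplus>k\<in>{..<r}. matrix_corner r R a (i, k) \<otimes> M (k, j)) =
        (\<Oplus>k\<in>{..<r}. (if k = 0 then a else \<zero>) \<otimes> M (k, j))"
      using assms that True
      by (intro finsum_cong') (auto simp: matrix_corner_def matrix_ring_def PiE_iff)
    then show ?thesis
      using assms that True finsum_single_left[of r a "\<lambda>k. M (k, j)"]
      by (simp add: matrix_ring_def PiE_iff)
  next
    case False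
    have "(\<Oplus>k\<in>{..<r}. matrix_corner r R a (i, k) \<otimes> M (k, j)) = (\<Oplus>k\<in>{..<r}. \<zero>)"
      using assms that False
      by (intro finsum_cong') (auto simp: matrix_corner_def matrix_ring_def PiE_iff)
    then show ?thesis using False by simp
  qed
  then show ?thesis
    by (auto simp: matrix_ring_def restrict_def fun_eq_iff)
qed

lemma matrix_mult_corner_right:
  assumes "0 < r" "a \<in> carrier R" "M \<in> carrier (matrix_ring r R)"
  shows "M \<otimes>\<^bsub>matrix_ring r R\<^esub> matrix_corner r R a =
    (\<lambda>(i, j)\<in>{..<r} \<times> {..<r}. if j = 0 then M (i, 0) \<otimes> a else \<zero>)"
proof -
  have "(\<Oplus>k\<in>{..<r}. M (i, k) \<otimes> matrix_corner r R a (k, j)) =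
      (if j = 0 then M (i, 0) \<otimes> a else \<zero>)" if "i < r" "j < r" for i j
  proof (cases "j = 0")
    case True
    have "(\<Oplus>k\<in>{..<r}. M (i, k) \<otimes> matrix_corner r R a (k, j)) =
        (\<Oplus>k\<in>{..<r}. M (i, k) \<otimes> (if k = 0 then a else \<zero>))"
      using assms that True
      by (intro finsum_cong') (auto simp: matrix_corner_def matrix_ring_def PiE_iff)
    then show ?thesis
      using assms that True finsum_single_right[of r a "\<lambda>k. M (i, k)"]
      by (simp add: matrix_ring_def PiE_iff)
  next
    case False
    have "(\<Oplus>k\<in>{..<r}. M (i, k) \<otimes> matrix_corner r R a (k, j)) = (\<Oplus>k\<in>{..<r}. \<zero>)"
      using assms that False
      by (intro finsum_cong') (auto simp: matrix_corner_def matrix_ring_def PiE_iff)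
    then show ?thesis using False by simp
  qed
  then show ?thesis
    by (auto simp: matrix_ring_def restrict_def fun_eq_iff)
qed

lemma matrix_corner_mult:
  assumes "0 < r" "a \<in> carrier R" "b \<in> carrier R"
  shows "matrix_corner r R a \<otimes>\<^bsub>matrix_ring r R\<^esub> matrix_corner r R b = matrix_corner r R (a \<otimes> b)"
  using assms
  by (simp add: matrix_corner_mult_left matrix_corner_closed)
    (auto simp: matrix_corner_def fun_eq_iff)

lemma matrix_corner_compress:
  assumes "0 < r" "M \<in> carrier (matrix_ring r R)"
  shows "matrix_corner r R \<one> \<otimes>\<^bsub>matrix_ring r R\<^esub> M \<otimes>\<^bsub>matrix_ring r R\<^esub> matrix_corner r R \<one> =
    matrix_corner r R (M (0, 0))"
proof -
  let ?N = "\<lambda>(i, j)\<in>{..<r} \<times> {..<r}. if i = 0 then \<one> \<otimes> M (0, j) else \<zero>"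
  have "?N \<in> carrier (matrix_ring r R)"
    using assms by (auto simp: matrix_ring_def PiE_iff)
  then show ?thesis
    using assms
    by (simp add: matrix_corner_mult_left matrix_mult_corner_right)
      (auto simp: matrix_corner_def fun_eq_iff matrix_ring_def PiE_iff)
qed

end

text \<open>A ring isomorphism onto \<open>M\<^sub>r(D)\<close> identifies \<open>D\<close> with the corner of the preimage of the
  matrix unit \<open>E\<^sub>1\<^sub>1\<close>.\<close>

lemma division_algebra_commutative:
  assumes "division_algebra D" "ring A" "\<one>\<^bsub>A\<^esub> \<noteq> \<zero>\<^bsub>A\<^esub>" "corner_commutative A"
    and h: "h \<in> ring_iso A (matrix_ring r D)"
    and ab: "a \<in> carrier D" "b \<in> carrier D"
  shows "a \<otimes>\<^bsub>D\<^esub> b = b \<otimes>\<^bsub>D\<^esub> a"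
proof -
  interpret D: division_algebra D by fact
  interpret A: ring A by fact
  let ?M = "matrix_ring r D"
  let ?E = "matrix_corner r D"
  note hE = ring_iso_memE[OF h]
  have inj: "h x = h y \<longleftrightarrow> x = y" if "x \<in> carrier A" "y \<in> carrier A" for x y
    using hE(5) that by (auto simp: bij_betw_def inj_on_eq_iff)
  have surj: "\<exists>x\<in>carrier A. h x = M" if "M \<in> carrier ?M" for M
    using hE(5) that by (metis bij_betw_def image_iff)
  \<comment> \<open>\<open>ring_iso\<close> speaks of sums, products and the unit only. That zero is
    preserved follows from \<open>0 + 0 = 0\<close>, entry by entry in \<open>D\<close>.\<close>
  have h0: "h \<zero>\<^bsub>A\<^esub> = \<zero>\<^bsub>?M\<^esub>"
  proof
    fix p
    have z: "h \<zero>\<^bsub>A\<^esub> \<in> carrier ?M" using hE(1) by simp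
    have "h \<zero>\<^bsub>A\<^esub> = h \<zero>\<^bsub>A\<^esub> \<oplus>\<^bsub>?M\<^esub> h \<zero>\<^bsub>A\<^esub>"
      using hE(3)[of "\<zero>\<^bsub>A\<^esub>" "\<zero>\<^bsub>A\<^esub>"] by simp
    then have *: "h \<zero>\<^bsub>A\<^esub> p = (h \<zero>\<^bsub>A\<^esub> \<oplus>\<^bsub>?M\<^esub> h \<zero>\<^bsub>A\<^esub>) p" by simp
    show "h \<zero>\<^bsub>A\<^esub> p = \<zero>\<^bsub>?M\<^esub> p"
    proof (cases "p \<in> {..<r} \<times> {..<r}")
      case True
      then have "h \<zero>\<^bsub>A\<^esub> p \<in> carrier D" "h \<zero>\<^bsub>A\<^esub> p = h \<zero>\<^bsub>A\<^esub> p \<oplus>\<^bsub>D\<^esub> h \<zero>\<^bsub>A\<^esub> p"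
        using z * by (auto simp: matrix_ring_def PiE_iff)
      then have "h \<zero>\<^bsub>A\<^esub> p = \<zero>\<^bsub>D\<^esub>"
        using D.add.r_cancel_one' by metis
      then show ?thesis using True by (auto simp: matrix_ring_def)
    next
      case False
      then show ?thesis using z by (cases p) (auto simp: matrix_ring_def PiE_iff extensional_def)
    qed
  qed
  \<comment> \<open>The matrix ring of size 0 has a single element, which would identify one and
    zero of \<open>A\<close>.\<close>
  have "0 < r"
  proof (rule ccontr)
    assume "\<not> 0 < r"
    then have "h \<one>\<^bsub>A\<^esub> = h \<zero>\<^bsub>A\<^esub>"
      using hE(1)[of "\<one>\<^bsub>A\<^esub>"] hE(1)[of "\<zero>\<^bsub>A\<^esub>"] by (simp add: matrix_ring_def)
    then show False using inj assms(3) by simp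
  qed
  note corner = D.matrix_corner_mult[OF this] D.matrix_corner_compress[OF this]
    D.matrix_corner_inject[OF this] D.matrix_corner_closed
  have E0: "?E \<zero>\<^bsub>D\<^esub> = \<zero>\<^bsub>?M\<^esub>"
    by (auto simp: matrix_corner_def matrix_ring_def fun_eq_iff)
  obtain f where f: "f \<in> carrier A" "h f = ?E \<one>\<^bsub>D\<^esub>"
    using surj corner(4) D.one_closed by metis
  have comp: "h (f \<otimes>\<^bsub>A\<^esub> x \<otimes>\<^bsub>A\<^esub> f) = ?E (h x (0, 0))" if "x \<in> carrier A" for x
    using that f hE(1) by (simp add: hE(2) corner)
  have prod: "h ((f \<otimes>\<^bsub>A\<^esub> x \<otimes>\<^bsub>A\<^esub> f) \<otimes>\<^bsub>A\<^esub> (f \<otimes>\<^bsub>A\<^esub> y \<otimes>\<^bsub>A\<^esub> f)) =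
      ?E (h x (0, 0)) \<otimes>\<^bsub>?M\<^esub> ?E (h y (0, 0))" if "x \<in> carrier A" "y \<in> carrier A" for x y
    unfolding comp[OF that(1), symmetric] comp[OF that(2), symmetric]
    using that f by (intro hE(2)) simp_all
  have h00: "h x (0, 0) \<in> carrier D" if "x \<in> carrier A" for x
    using hE(1)[OF that] \<open>0 < r\<close> by (auto simp: matrix_ring_def PiE_iff)
  have idem: "f \<otimes>\<^bsub>A\<^esub> f = f"
    using f by (subst inj[symmetric]) (auto simp: hE(2) corner)
  have nz: "f \<noteq> \<zero>\<^bsub>A\<^esub>"
    using f h0 E0 corner(3) D.division(1) by metis
  \<comment> \<open>The corner of \<open>f\<close> inherits the absence of zero divisors from
    \<open>D\<close>, read off at the entry \<open>(0, 0)\<close>.\<close>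
  have zd: "f \<otimes>\<^bsub>A\<^esub> x \<otimes>\<^bsub>A\<^esub> f = \<zero>\<^bsub>A\<^esub> \<or> f \<otimes>\<^bsub>A\<^esub> y \<otimes>\<^bsub>A\<^esub> f = \<zero>\<^bsub>A\<^esub>"
    if xy: "x \<in> carrier A" "y \<in> carrier A"
      "(f \<otimes>\<^bsub>A\<^esub> x \<otimes>\<^bsub>A\<^esub> f) \<otimes>\<^bsub>A\<^esub> (f \<otimes>\<^bsub>A\<^esub> y \<otimes>\<^bsub>A\<^esub> f) = \<zero>\<^bsub>A\<^esub>" for x y
  proof -
    have "?E (h x (0, 0) \<otimes>\<^bsub>D\<^esub> h y (0, 0)) = ?E \<zero>\<^bsub>D\<^esub>"
      using prod[OF xy(1,2)] h00[OF xy(1)] h00[OF xy(2)] unfolding xy(3) h0 E0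
      by (simp add: corner)
    then have 0: "h x (0, 0) \<otimes>\<^bsub>D\<^esub> h y (0, 0) = \<zero>\<^bsub>D\<^esub>"
      by (simp add: corner)
    have "h x (0, 0) = \<zero>\<^bsub>D\<^esub> \<or> h y (0, 0) = \<zero>\<^bsub>D\<^esub>"
    proof (rule ccontr)
      assume "\<not> ?thesis"
      then have "h x (0, 0) \<in> Units D" "h y (0, 0) \<in> Units D"
        using D.division(2) h00 xy by auto
      then have "h x (0, 0) \<otimes>\<^bsub>D\<^esub> h y (0, 0) \<in> Units D" by (rule D.Units_m_closed)
      then show False using 0 D.division by simp
    qed
    then show ?thesis
      using comp[OF xy(1)] comp[OF xy(2)] f xy(1,2)
      by (auto simp: E0 h0[symmetric] inj)
  qed
  obtain x where x: "x \<in> carrier A" "h x = ?E a" using surj corner(4) ab by metis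
  obtain y where y: "y \<in> carrier A" "h y = ?E b" using surj corner(4) ab by metis
  have "(f \<otimes>\<^bsub>A\<^esub> x \<otimes>\<^bsub>A\<^esub> f) \<otimes>\<^bsub>A\<^esub> (f \<otimes>\<^bsub>A\<^esub> y \<otimes>\<^bsub>A\<^esub> f) =
      (f \<otimes>\<^bsub>A\<^esub> y \<otimes>\<^bsub>A\<^esub> f) \<otimes>\<^bsub>A\<^esub> (f \<otimes>\<^bsub>A\<^esub> x \<otimes>\<^bsub>A\<^esub> f)"
    using assms(4)[unfolded corner_commutative_def, rule_format, OF f(1) idem nz zd x(1) y(1)] .
  then have "h ((f \<otimes>\<^bsub>A\<^esub> x \<otimes>\<^bsub>A\<^esub> f) \<otimes>\<^bsub>A\<^esub> (f \<otimes>\<^bsub>A\<^esub> y \<otimes>\<^bsub>A\<^esub> f)) =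
      h ((f \<otimes>\<^bsub>A\<^esub> y \<otimes>\<^bsub>A\<^esub> f) \<otimes>\<^bsub>A\<^esub> (f \<otimes>\<^bsub>A\<^esub> x \<otimes>\<^bsub>A\<^esub> f))" by simp
  moreover have "h x (0, 0) = a" "h y (0, 0) = b"
    using x y \<open>0 < r\<close> by (simp_all add: matrix_corner_def)
  ultimately have "?E (a \<otimes>\<^bsub>D\<^esub> b) = ?E (b \<otimes>\<^bsub>D\<^esub> a)"
    using x y ab by (simp add: prod corner)
  then show ?thesis by (simp add: corner)
qed

text \<open>A commutative \<open>D\<close> is a field and its own centre, and a field has dimension
  1 over itself.\<close>

lemma division_algebra_dimension_eq_1:
  assumes "division_algebra D" and comm: "\<And>a b. a \<in> carrier D \<Longrightarrow> b \<in> carrier D \<Longrightarrow> a \<otimes>\<^bsub>D\<^esub> b = b \<otimes>\<^bsub>D\<^esub> a"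
    and dim: "ring.dimension D k (ring_center D) (carrier D)"
  shows "k = 1"
proof -
  interpret D: division_algebra D by fact
  interpret D: cring D
    by unfold_locales (use comm in auto)
  interpret D: field D
    by (rule D.cring_fieldI) (rule D.division(2))
  have "ring_center D = carrier D"
    using comm by (auto simp: ring_center_def)
  then have "D.dimension k (carrier D) (carrier D)" using dim by simp
  moreover have "D.dimension 1 (carrier D) (carrier D)"
    using D.dimension_one[OF D.carrier_is_subfield] .
  ultimately show ?thesis
    using D.dimension_is_inj[OF D.carrier_is_subfield] by blast
qed

text \<open>In the definition \<open>D\<close> ranges over rings of rational matrices, so the field
  of character values, a set of complex numbers, enters as its copy under \<open>\<phi>\<close>.
  Every competing \<open>D\<close> is commutative by \<open>division_algebra_commutative\<close>,
  which makes the described value unique.\<close>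

lemma rational_schur_index_eq_1I:
  fixes S :: "('n::finite \<times> 'n) set set" and \<phi> :: "complex \<Rightarrow> rat^'n^'n"
  assumes A: "ring (simple_component S x ch)"
      "\<one>\<^bsub>simple_component S x ch\<^esub> \<noteq> \<zero>\<^bsub>simple_component S x ch\<^esub>"
      "corner_commutative (simple_component S x ch)"
    and iso: "simple_component S x ch \<simeq> matrix_ring d (character_field S x ch)"
    and K: "field (character_field S x ch)"
    and \<phi>: "inj_on \<phi> (carrier (character_field S x ch))"
  shows "rational_schur_index S x ch = 1"
  unfolding rational_schur_index_def
proof (rule the_equality)
  let ?K = "character_field S x ch"
  interpret K: field ?K by fact
  define D where "D = image_ring \<phi> ?K"
  interpret D: field D
    unfolding D_def by (rule K.inj_imp_image_ring_is_field[OF \<phi>])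
  have iD: "\<phi> \<in> ring_iso ?K D"
    unfolding D_def by (rule inj_imp_image_ring_iso[OF \<phi>])
  have cD: "ring_center D = carrier D"
    using D.m_comm by (auto simp: ring_center_def)
  show "\<exists>(D :: (rat^'n^'n) ring) r k.
        division_algebra D \<and>
        simple_component S x ch \<simeq> matrix_ring r D \<and>
        D\<lparr>carrier := ring_center D\<rparr> \<simeq> ?K \<and>
        ring.dimension D k (ring_center D) (carrier D) \<and>
        1 = sqrt (real k)"
  proof (rule exI[of _ D], rule exI[of _ d], rule exI[of _ 1], intro conjI)
    show "division_algebra D"
      by unfold_locales (simp_all add: D.field_Units)
    show "simple_component S x ch \<simeq> matrix_ring d D"
      using iso matrix_ring_iso[OF K.ring_axioms D.ring_axioms iD] by (rule ring_iso_trans)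
    show "D\<lparr>carrier := ring_center D\<rparr> \<simeq> ?K"
      using ring_iso_sym[OF K.ring_axioms] iD by (auto simp: cD is_ring_iso_def)
    show "D.dimension 1 (ring_center D) (carrier D)"
      unfolding cD using D.dimension_one[OF D.carrier_is_subfield] .
  qed simp
next
  fix m
  assume "\<exists>(D :: (rat^'n^'n) ring) r k.
        division_algebra D \<and>
        simple_component S x ch \<simeq> matrix_ring r D \<and>
        D\<lparr>carrier := ring_center D\<rparr> \<simeq> character_field S x ch \<and>
        ring.dimension D k (ring_center D) (carrier D) \<and>
        m = sqrt (real k)"
  then obtain D :: "(rat^'n^'n) ring" and r k h where D: "division_algebra D"
      "h \<in> ring_iso (simple_component S x ch) (matrix_ring r D)"
      "ring.dimension D k (ring_center D) (carrier D)" "m = sqrt (real k)"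
    unfolding is_ring_iso_def by blast
  have "k = 1"
    using D(1) division_algebra_commutative[OF D(1) A D(2)] D(3)
    by (rule division_algebra_dimension_eq_1)
  then show "m = 1" using D(4) by simp
qed


section \<open>Rational matrix algebras closed under transposition\<close>

interpretation mat_vs: vector_space "\<lambda>c (M::'a::field^'n::finite^'m::finite). map_matrix ((*) c) M"
  by unfold_locales (auto simp: vec_eq_iff algebra_simps)

lemma map_matrix_mult_left: "map_matrix ((*) c) A ** B = map_matrix ((*) c) (A ** B)"
  for A :: "'a::comm_semiring_1^'n::finite^'m::finite"
  by (simp add: vec_eq_iff matrix_matrix_mult_def sum_distrib_left mult.assoc)

lemma map_matrix_mult_right: "A ** map_matrix ((*) c) B = map_matrix ((*) c) (A ** B)"
  for A :: "'a::comm_semiring_1^'n::finite^'m::finite"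
  by (simp add: vec_eq_iff matrix_matrix_mult_def sum_distrib_left mult.left_commute)

lemma matrix_add_rdistrib: "(A + B) ** M = A ** M + B ** M"
  for M :: "'a::semiring_1^'n::finite^'m::finite"
  by (simp add: vec_eq_iff matrix_matrix_mult_def distrib_right sum.distrib)

lemma matrix_mult_sum_left: "sum f A ** M = (\<Sum>a\<in>A. f a ** M)"
  for M :: "'a::comm_ring_1^'n::finite^'m::finite"
  by (induction A rule: infinite_finite_induct) (auto simp: matrix_add_rdistrib)

lemma matrix_mult_sum_right: "M ** sum f A = (\<Sum>a\<in>A. M ** f a)"
  for M :: "'a::comm_ring_1^'n::finite^'m::finite"
  by (induction A rule: infinite_finite_induct) (auto simp: matrix_add_ldistrib)

lemma sum_nth2: "sum f A $ i $ j = (\<Sum>a\<in>A. f a $ i $ j)"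
  by (induction A rule: infinite_finite_induct) auto

abbreviation cmat :: "rat^'n^'m \<Rightarrow> complex^'n::finite^'m::finite" where
  "cmat \<equiv> map_matrix of_rat"

lemma
  fixes M N :: "rat^'n::finite^'n"
  shows cmat_add: "cmat (M + N) = cmat M + cmat N"
    and cmat_mult: "cmat (M ** N) = cmat M ** cmat N"
    and cmat_scale: "cmat (map_matrix ((*) q) M) = map_matrix ((*) (of_rat q)) (cmat M)"
    and cmat_one: "cmat (mat 1) = (mat 1 :: complex^'n^'n)"
    and cmat_zero: "cmat 0 = (0 :: complex^'n^'n)"
    and cmat_transpose: "cmat (transpose M) = transpose (cmat M)"
    and cmat_eq_iff: "cmat M = cmat N \<longleftrightarrow> M = N"
  by (auto simp: vec_eq_iff of_rat_add matrix_matrix_mult_def of_rat_sum of_rat_mult mat_def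
      transpose_def)

lemma cnj_of_rat [simp]: "cnj (of_rat q) = of_rat q"
  by (cases q) (simp add: of_rat_rat)

lemma cmat_sum: "cmat (sum f A) = (\<Sum>a\<in>A. cmat (f a))"
  for f :: "'b \<Rightarrow> rat^'n::finite^'n"
  by (induction A rule: infinite_finite_induct) (auto simp: cmat_add cmat_zero)

text \<open>The trace form \<open>trace (transpose A ** B)\<close>. It is bilinear, without
  conjugation, at complex type too: there it is used to pair with rational matrices.\<close>

definition matrix_inner :: "'a::comm_ring_1^'n::finite^'m::finite \<Rightarrow> 'a^'n^'m \<Rightarrow> 'a" where
  "matrix_inner A B = (\<Sum>i\<in>UNIV. \<Sum>j\<in>UNIV. A $ i $ j * B $ i $ j)"

lemma matrix_inner_sum_scale:
  "matrix_inner A (\<Sum>a\<in>S. map_matrix ((*) (c a)) (f a)) = (\<Sum>a\<in>S. c a * matrix_inner A (f a))"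
proof (induction S rule: infinite_finite_induct)
  case (insert x F)
  have "matrix_inner A (map_matrix ((*) (c x)) (f x) + B) = c x * matrix_inner A (f x) + matrix_inner A B" for B
    by (simp add: matrix_inner_def sum_distrib_left sum.distrib distrib_left mult.left_commute)
  then show ?case using insert by simp
qed (auto simp: matrix_inner_def)

lemma matrix_inner_commute: "matrix_inner A B = matrix_inner B A"
  by (simp add: matrix_inner_def mult.commute)

lemma matrix_inner_diff_right: "matrix_inner A (B - C) = matrix_inner A B - matrix_inner A C"
  by (simp add: matrix_inner_def right_diff_distrib sum_subtractf)

lemma matrix_inner_eq_trace: "matrix_inner A B = trace (transpose A ** B)"
  unfolding matrix_inner_def trace_def matrix_matrix_mult_def transpose_def
  by (simp, subst sum.swap) simp

lemma matrix_inner_self_eq_0: "matrix_inner A A = 0 \<longleftrightarrow> A = 0"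
  for A :: "rat^'n::finite^'m::finite"
  by (auto simp: matrix_inner_def vec_eq_iff sum_nonneg_eq_0_iff sum_nonneg)

lemma cmat_inner: "matrix_inner (cmat A) (cmat B) = of_rat (matrix_inner A B)"
  by (simp add: matrix_inner_def of_rat_sum of_rat_mult)

lemma orthogonal_expansion:
  fixes C :: "(rat^'n::finite^'m::finite) set"
  assumes C: "finite C" "\<And>c d. c \<in> C \<Longrightarrow> d \<in> C \<Longrightarrow> c \<noteq> d \<Longrightarrow> matrix_inner c d = 0"
    and M: "M \<in> mat_vs.span C"
  shows "M = (\<Sum>c\<in>C. map_matrix ((*) (matrix_inner c M / matrix_inner c c)) c)"
proof -
  obtain u where u: "M = (\<Sum>c\<in>C. map_matrix ((*) (u c)) c)"
    using M mat_vs.span_finite[OF C(1)] by auto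
  have "matrix_inner c M = u c * matrix_inner c c" if "c \<in> C" for c
  proof -
    have "matrix_inner c M = (\<Sum>d\<in>C. if d = c then u c * matrix_inner c c else 0)"
      unfolding u matrix_inner_sum_scale using C(2) that by (intro sum.cong) auto
    then show ?thesis using C(1) that by simp
  qed
  \<comment> \<open>For \<open>c = 0\<close> the coefficient is a meaningless quotient by 0, but
    both sides vanish.\<close>
  then have eq: "map_matrix ((*) (matrix_inner c M / matrix_inner c c)) c = map_matrix ((*) (u c)) c"
    if "c \<in> C" for c
    using that by (cases "c = 0") (auto simp: matrix_inner_self_eq_0 vec_eq_iff)
  have "(\<Sum>c\<in>C. map_matrix ((*) (u c)) c) =
      (\<Sum>c\<in>C. map_matrix ((*) (matrix_inner c M / matrix_inner c c)) c)"
    by (rule sum.cong[OF refl eq[symmetric]])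
  then show ?thesis using u by simp
qed

text \<open>Gram-Schmidt without normalisation, since square roots leave the rationals. A vector
  that becomes zero may be kept, as it is orthogonal to everything.\<close>

lemma orthogonal_spanning_set:
  fixes B :: "(rat^'n::finite^'m::finite) set"
  assumes "finite B"
  obtains C where "finite C" "\<And>c d. c \<in> C \<Longrightarrow> d \<in> C \<Longrightarrow> c \<noteq> d \<Longrightarrow> matrix_inner c d = 0"
    "mat_vs.span C = mat_vs.span B"
proof -
  have "\<exists>C. finite C \<and> (\<forall>c\<in>C. \<forall>d\<in>C. c \<noteq> d \<longrightarrow> matrix_inner c d = 0) \<and>
      mat_vs.span C = mat_vs.span B"
    using assms
  proof induction
    case empty
    then show ?case by (intro exI[of _ "{}"]) auto
  next
    case (insert a B)
    then obtain C where C: "finite C" "\<forall>c\<in>C. \<forall>d\<in>C. c \<noteq> d \<longrightarrow> matrix_inner c d = 0"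
      "mat_vs.span C = mat_vs.span B" by blast
    define p where "p = (\<Sum>c\<in>C. map_matrix ((*) (matrix_inner c a / matrix_inner c c)) c)"
    have p: "p \<in> mat_vs.span C"
      unfolding p_def by (intro mat_vs.span_sum mat_vs.span_scale mat_vs.span_base)
    have orth: "matrix_inner d (a - p) = 0" if "d \<in> C" for d
    proof -
      have "matrix_inner d p = (\<Sum>c\<in>C. if c = d then matrix_inner d a / matrix_inner d d * matrix_inner d d else 0)"
        unfolding p_def matrix_inner_sum_scale using C(2) that by (intro sum.cong) auto
      also have "\<dots> = matrix_inner d a / matrix_inner d d * matrix_inner d d"
        using that C(1) by simp
      also have "\<dots> = matrix_inner d a"
      proof (cases "matrix_inner d d = 0")
        case True
        then have "d = 0" by (simp add: matrix_inner_self_eq_0)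
        then show ?thesis by (simp add: matrix_inner_def)
      qed simp
      finally show ?thesis by (simp add: matrix_inner_diff_right)
    qed
    have "mat_vs.span (insert (a - p) C) = mat_vs.span (insert a B)"
    proof -
      have pC: "p \<in> mat_vs.span (insert y C)" for y
        using p mat_vs.span_mono[of C "insert y C"] by auto
      have "a - p \<in> mat_vs.span (insert a C)"
        by (intro mat_vs.span_diff pC mat_vs.span_base) simp
      moreover have "a \<in> mat_vs.span (insert (a - p) C)"
        using mat_vs.span_add[OF mat_vs.span_base[of "a - p" "insert (a - p) C"] pC[of "a - p"]] by simp
      ultimately have "mat_vs.span (insert (a - p) C) = mat_vs.span (insert a C)"
        by (auto intro!: mat_vs.span_base simp: mat_vs.span_eq)
      also have "\<dots> = mat_vs.span (insert a B)"
        using C(3) by (simp add: mat_vs.span_insert)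
      finally show ?thesis .
    qed
    moreover have "matrix_inner (a - p) d = 0" if "d \<in> C" for d
      using orth[OF that] by (simp only: matrix_inner_commute)
    ultimately show ?case
      using C(1,2) orth
      by (intro exI[of _ "insert (a - p) C"]) auto
  qed
  then obtain C where "finite C" "\<forall>c\<in>C. \<forall>d\<in>C. c \<noteq> d \<longrightarrow> matrix_inner c d = 0"
      "mat_vs.span C = mat_vs.span B" by (elim exE conjE)
  then show ?thesis by (intro that[of C]) simp_all
qed

lemma matrix_subspace_finite_spanning:
  fixes W :: "('a::field^'n::finite^'m::finite) set"
  assumes "mat_vs.subspace W"
  obtains B where "finite B" "mat_vs.span B = W"
proof -
  define U :: "('a^'n^'m) set" where
    "U = (\<lambda>(i, j). \<chi> k l. if k = i \<and> l = j then 1 else 0) ` UNIV"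
  have "finite U" by (simp add: U_def)
  have U: "M \<in> mat_vs.span U" for M :: "'a^'n^'m"
  proof -
    have "M = (\<Sum>i\<in>UNIV. \<Sum>j\<in>UNIV. map_matrix ((*) (M $ i $ j)) (\<chi> k l. if k = i \<and> l = j then 1 else 0))"
    proof -
      have "(\<Sum>i\<in>UNIV. \<Sum>j\<in>UNIV. M $ i $ j * (if k = i \<and> l = j then 1 else 0)) = M $ k $ l" for k l
      proof -
        have "(\<Sum>i\<in>UNIV. \<Sum>j\<in>UNIV. M $ i $ j * (if k = i \<and> l = j then 1 else 0)) =
            (\<Sum>i\<in>UNIV. if k = i then M $ i $ l else 0)"
          by (intro sum.cong refl) (simp add: if_distrib cong: if_cong)
        then show ?thesis by simp
      qed
      then show ?thesis by (simp add: vec_eq_iff sum_nth2)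
    qed
    moreover have "\<dots> \<in> mat_vs.span U"
      by (intro mat_vs.span_sum mat_vs.span_scale mat_vs.span_base) (auto simp: U_def)
    ultimately show ?thesis by simp
  qed
  obtain B where B: "B \<subseteq> W" "mat_vs.independent B" "W \<subseteq> mat_vs.span B"
    by (rule mat_vs.basis_exists[of W])
  have "finite B"
    using mat_vs.independent_span_bound[OF \<open>finite U\<close> B(2)] U by blast
  moreover have "mat_vs.span B = W"
    using B(1,3) mat_vs.span_minimal[OF B(1) assms] by blast
  ultimately show ?thesis by (rule that)
qed

lemma matrix_subalgebra_subspace: "matrix_subalgebra A \<Longrightarrow> mat_vs.subspace A"
  for A :: "('a::field^'n::finite^'n) set"
proof -
  assume A: "matrix_subalgebra A"
  have "map_matrix ((*) 0) (mat 1) \<in> A"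
    using A unfolding matrix_subalgebra_def by blast
  moreover have "map_matrix ((*) 0) (mat 1) = (0 :: 'a^'n^'n)"
    by (simp add: vec_eq_iff)
  ultimately show ?thesis
    using A unfolding matrix_subalgebra_def mat_vs.subspace_def by metis
qed

definition adj :: "complex^'n^'m \<Rightarrow> complex^'m::finite^'n::finite" where
  "adj M = (\<chi> i j. cnj (M $ j $ i))"

lemma adj_mult: "adj (A ** B) = adj B ** adj A"
  by (simp add: adj_def vec_eq_iff matrix_matrix_mult_def mult.commute)

lemma adj_adj [simp]: "adj (adj A) = A"
  by (simp add: adj_def vec_eq_iff)

lemma mult_adj_eq_0: "A ** adj A = 0 \<Longrightarrow> A = 0"
proof -
  assume "A ** adj A = 0"
  then have "(A ** adj A) $ i $ i = 0" for i by simp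
  then have "(\<Sum>j\<in>UNIV. complex_of_real ((cmod (A $ i $ j))\<^sup>2)) = 0" for i
    by (simp add: matrix_matrix_mult_def adj_def complex_norm_square del: of_real_power)
  then have "(\<Sum>j\<in>UNIV. (cmod (A $ i $ j))\<^sup>2) = 0" for i
    by (metis of_real_eq_0_iff of_real_sum)
  then show "A = 0"
    by (auto simp: vec_eq_iff sum_nonneg_eq_0_iff)
qed

text \<open>By normality the self-adjoint matrix \<open>adj A ** A\<close> has square
  \<open>(adj A ** adj A) ** (A ** A) = 0\<close>. Positivity in the form of
  \<open>mult_adj_eq_0\<close> then applies twice.\<close>

lemma nilpotent_normal_eq_0:
  assumes "A ** A = 0" "A ** adj A = adj A ** A"
  shows "A = 0"
proof -
  define W where "W = adj A ** A"
  have "adj W = W" by (simp add: W_def adj_mult)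
  moreover have "W ** W = adj A ** (A ** adj A) ** A"
    by (simp add: W_def matrix_mul_assoc)
  moreover have "\<dots> = (adj A ** adj A) ** (A ** A)"
    by (simp add: assms(2) matrix_mul_assoc)
  ultimately have "W ** adj W = 0" by (simp add: assms(1))
  then have "W = 0" by (rule mult_adj_eq_0)
  then have "adj A ** adj (adj A) = 0" by (simp add: W_def)
  then have "adj A = 0" by (rule mult_adj_eq_0)
  then show ?thesis by (simp add: adj_def vec_eq_iff)
qed

text \<open>Abstracts the pair \<open>\<rat>T_x\<close>, \<open>T_x\<close>: a rational form that
  spans the complex algebra and is closed under transposition, so that the trace form can be used
  inside it.\<close>

locale rational_star_algebra =
  fixes Tq :: "(rat^'n::finite^'n) set" and Tc :: "(complex^'n^'n) set"
  assumes Tq: "matrix_subalgebra Tq" and Tc: "matrix_subalgebra Tc"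
    and transpose_closed: "M \<in> Tq \<Longrightarrow> transpose M \<in> Tq"
    and cmat_closed: "M \<in> Tq \<Longrightarrow> cmat M \<in> Tc"
    and Tc_span: "Tc \<subseteq> mat_vs.span (cmat ` Tq)"
begin

lemma Tq_one: "mat 1 \<in> Tq" and Tq_add: "M \<in> Tq \<Longrightarrow> N \<in> Tq \<Longrightarrow> M + N \<in> Tq"
  and Tq_mult: "M \<in> Tq \<Longrightarrow> N \<in> Tq \<Longrightarrow> M ** N \<in> Tq"
  and Tq_scale: "M \<in> Tq \<Longrightarrow> map_matrix ((*) q) M \<in> Tq"
  using Tq unfolding matrix_subalgebra_def by auto

lemma Tc_one: "mat 1 \<in> Tc" and Tc_add: "Z \<in> Tc \<Longrightarrow> Y \<in> Tc \<Longrightarrow> Z + Y \<in> Tc"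
  and Tc_mult: "Z \<in> Tc \<Longrightarrow> Y \<in> Tc \<Longrightarrow> Z ** Y \<in> Tc"
  and Tc_scale: "Z \<in> Tc \<Longrightarrow> map_matrix ((*) c) Z \<in> Tc"
  for Z Y :: "complex^'n^'n"
  using Tc unfolding matrix_subalgebra_def by auto

lemmas Tq_subspace = matrix_subalgebra_subspace[OF Tq]
  and Tc_subspace = matrix_subalgebra_subspace[OF Tc]

lemmas Tq_zero = mat_vs.subspace_0[OF Tq_subspace]
  and Tq_diff = mat_vs.subspace_diff[OF Tq_subspace]
  and Tq_sum = mat_vs.subspace_sum[OF Tq_subspace]
  and Tc_zero = mat_vs.subspace_0[OF Tc_subspace]
  and Tc_diff = mat_vs.subspace_diff[OF Tc_subspace]
  and Tc_sum = mat_vs.subspace_sum[OF Tc_subspace]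

text \<open>It may contain 0. What matters is the explicit coordinate formula, with quotients of
  inner products as coefficients.\<close>

definition orth_basis :: "(rat^'n^'n) set" where
  "orth_basis = (SOME C. finite C \<and> (\<forall>c\<in>C. \<forall>d\<in>C. c \<noteq> d \<longrightarrow> matrix_inner c d = 0) \<and>
     mat_vs.span C = Tq)"

lemma orth_basis:
  shows finite_orth_basis: "finite orth_basis"
    and orth_basis_orthogonal: "c \<in> orth_basis \<Longrightarrow> d \<in> orth_basis \<Longrightarrow> c \<noteq> d \<Longrightarrow> matrix_inner c d = 0"
    and span_orth_basis: "mat_vs.span orth_basis = Tq"
proof -
  obtain B where B: "finite B" "mat_vs.span B = Tq"
    using matrix_subspace_finite_spanning[OF Tq_subspace] by blast
  then have "\<exists>C. finite C \<and> (\<forall>c\<in>C. \<forall>d\<in>C. c \<noteq> d \<longrightarrow> matrix_inner c d = 0) \<and>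
     mat_vs.span C = Tq"
    using orthogonal_spanning_set[OF B(1)] by metis
  from someI_ex[OF this] show "finite orth_basis"
    "c \<in> orth_basis \<Longrightarrow> d \<in> orth_basis \<Longrightarrow> c \<noteq> d \<Longrightarrow> matrix_inner c d = 0"
    "mat_vs.span orth_basis = Tq"
    unfolding orth_basis_def by auto
qed

lemma orth_basis_Tq: "c \<in> orth_basis \<Longrightarrow> c \<in> Tq"
  using span_orth_basis mat_vs.span_base by blast

lemma Tq_expansion:
  "M \<in> Tq \<Longrightarrow> M = (\<Sum>c\<in>orth_basis. map_matrix ((*) (matrix_inner c M / matrix_inner c c)) c)"
  using orthogonal_expansion[OF finite_orth_basis orth_basis_orthogonal] span_orth_basis by simp

text \<open>The expression \<open>P Z\<close> is complex-linear in \<open>Z\<close> and reproduces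
  rational elements by \<open>Tq_expansion\<close>; these span.\<close>

lemma Tc_expansion:
  assumes "Z \<in> Tc"
  shows "Z = (\<Sum>c\<in>orth_basis.
    map_matrix ((*) (matrix_inner (cmat c) Z / of_rat (matrix_inner c c))) (cmat c))"
proof -
  define P where "P Z = (\<Sum>c\<in>orth_basis.
    map_matrix ((*) (matrix_inner (cmat c) Z / of_rat (matrix_inner c c))) (cmat c))" for Z
  have P_lin: "P (map_matrix ((*) k) Z + Y) = map_matrix ((*) k) (P Z) + P Y" for k Z Y
    by (simp add: P_def vec_eq_iff matrix_inner_def sum_nth2 sum.distrib sum_distrib_left
        add_divide_distrib distrib_left distrib_right sum_divide_distrib mult.left_commute
        sum_distrib_right mult.assoc)
  have "Z \<in> mat_vs.span (cmat ` Tq)" using assms Tc_span by blast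
  then have "Z = P Z"
  proof (induction rule: mat_vs.span_induct_alt)
    case base
    then show ?case by (simp add: P_def matrix_inner_def vec_eq_iff sum_nth2)
  next
    case (step k Z Y)
    then obtain M where M: "M \<in> Tq" "Z = cmat M" by auto
    have "cmat M = P (cmat M)"
      by (subst Tq_expansion[OF M(1)])
        (simp add: P_def cmat_sum cmat_scale cmat_inner of_rat_divide)
    then show ?case using step M by (metis P_lin)
  qed
  then show ?thesis by (simp add: P_def)
qed

text \<open>Descent: for a rational matrix the coefficients of the complex expansion are
  rational.\<close>

lemma Tq_if_cmat: "cmat M \<in> Tc \<Longrightarrow> M \<in> Tq"
proof -
  assume "cmat M \<in> Tc"
  then have "cmat M = cmat (\<Sum>c\<in>orth_basis. map_matrix ((*) (matrix_inner c M / matrix_inner c c)) c)"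
    by (subst Tc_expansion) (simp_all add: cmat_sum cmat_scale cmat_inner of_rat_divide)
  then have "M = (\<Sum>c\<in>orth_basis. map_matrix ((*) (matrix_inner c M / matrix_inner c c)) c)"
    by (simp add: cmat_eq_iff)
  moreover have "\<dots> \<in> Tq"
    by (intro Tq_sum Tq_scale orth_basis_Tq)
  ultimately show "M \<in> Tq" by simp
qed

lemma Tc_combination: "(\<And>a. a \<in> A \<Longrightarrow> f a \<in> Tq) \<Longrightarrow> (\<Sum>a\<in>A. map_matrix ((*) (k a)) (cmat (f a))) \<in> Tc"
  by (intro Tc_sum Tc_scale cmat_closed)

text \<open>Conjugation fixes the rational matrices \<open>cmat c\<close>, so \<open>adj\<close>
  conjugates the coefficients and transposes the spanning set.\<close>

lemma adj_closed: "Z \<in> Tc \<Longrightarrow> adj Z \<in> Tc"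
proof -
  assume "Z \<in> Tc"
  define k where "k c = cnj (matrix_inner (cmat c) Z / of_rat (matrix_inner c c))" for c
  have "adj Z = (\<Sum>c\<in>orth_basis. map_matrix ((*) (k c)) (cmat (transpose c)))"
    using arg_cong[OF Tc_expansion[OF \<open>Z \<in> Tc\<close>], of adj]
    by (simp add: adj_def k_def vec_eq_iff sum_nth2 transpose_def)
  then show "adj Z \<in> Tc"
    using Tc_combination[of orth_basis transpose] orth_basis_Tq transpose_closed by simp
qed

lemma Tc_commute:
  assumes "\<And>M. M \<in> Tq \<Longrightarrow> W ** cmat M = cmat M ** W" and "Z \<in> Tc"
  shows "W ** Z = Z ** W"
proof -
  obtain k where Z: "Z = (\<Sum>c\<in>orth_basis. map_matrix ((*) (k c)) (cmat c))"
    using that[OF Tc_expansion[OF assms(2)]] .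
  show ?thesis
    unfolding Z using assms(1)
    by (simp add: matrix_mult_sum_left matrix_mult_sum_right map_matrix_mult_left
      map_matrix_mult_right orth_basis_Tq)
qed

end


section \<open>Representations with one-dimensional weight spaces\<close>

lemma matrix_sub_ldistrib: "M ** (A - B) = M ** A - M ** B"
  for M :: "'a::ring_1^'n::finite^'m::finite"
  by (simp add: vec_eq_iff matrix_matrix_mult_def right_diff_distrib sum_subtractf)

lemma matrix_sub_rdistrib: "(A - B) ** M = A ** M - B ** M"
  for M :: "'a::ring_1^'n::finite^'m::finite"
  by (simp add: vec_eq_iff matrix_matrix_mult_def left_diff_distrib sum_subtractf)

text \<open>\<open>m Z s t\<close> stands for the matrix coefficient of \<open>Z\<close> in a basis
  of weight vectors, where \<open>E u\<close> acts as a diagonal matrix unit. Irreducibility enters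
  as a nonzero coefficient of some rational element at every position.\<close>

locale thin_representation = rational_star_algebra Tq Tc
  for Tq :: "(rat^'n::finite^'n) set" and Tc :: "(complex^'n^'n) set" +
  fixes I :: "'i set" and m :: "complex^'n^'n \<Rightarrow> 'i \<Rightarrow> 'i \<Rightarrow> complex" and E :: "'i \<Rightarrow> rat^'n^'n"
  assumes finite_I: "finite I" and I_nonempty: "I \<noteq> {}"
    and m_add: "\<lbrakk>Z \<in> Tc; W \<in> Tc; s \<in> I; t \<in> I\<rbrakk> \<Longrightarrow> m (Z + W) s t = m Z s t + m W s t"
    and m_scale: "\<lbrakk>Z \<in> Tc; s \<in> I; t \<in> I\<rbrakk> \<Longrightarrow> m (map_matrix ((*) c) Z) s t = c * m Z s t"
    and m_mult: "\<lbrakk>Z \<in> Tc; W \<in> Tc; s \<in> I; t \<in> I\<rbrakk> \<Longrightarrow> m (Z ** W) s t = (\<Sum>u\<in>I. m Z s u * m W u t)"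
    and m_one: "\<lbrakk>s \<in> I; t \<in> I\<rbrakk> \<Longrightarrow> m (mat 1) s t = (if s = t then 1 else 0)"
    and E_Tq: "u \<in> I \<Longrightarrow> E u \<in> Tq"
    and m_E: "\<lbrakk>u \<in> I; s \<in> I; t \<in> I\<rbrakk> \<Longrightarrow> m (cmat (E u)) s t = (if s = u \<and> t = u then 1 else 0)"
    and irreducible: "\<lbrakk>s \<in> I; t \<in> I\<rbrakk> \<Longrightarrow> \<exists>M\<in>Tq. m (cmat M) s t \<noteq> 0"
begin

lemma m_zero: "s \<in> I \<Longrightarrow> t \<in> I \<Longrightarrow> m 0 s t = 0"
  using m_add[OF Tc_zero Tc_zero, of s t] by simp

lemma m_diff: "\<lbrakk>Z \<in> Tc; W \<in> Tc; s \<in> I; t \<in> I\<rbrakk> \<Longrightarrow> m (Z - W) s t = m Z s t - m W s t"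
  using m_add[of "Z - W" W s t] by (simp add: Tc_diff)

lemma m_sum:
  assumes "\<And>a. a \<in> A \<Longrightarrow> f a \<in> Tc" "s \<in> I" "t \<in> I"
  shows "m (sum f A) s t = (\<Sum>a\<in>A. m (f a) s t)"
  using assms(1)
proof (induction A rule: infinite_finite_induct)
  case (insert x F)
  then show ?case using assms by (simp add: m_add Tc_sum)
qed (simp_all add: m_zero assms)

lemma m_combination:
  assumes "\<And>a. a \<in> A \<Longrightarrow> f a \<in> Tq" "s \<in> I" "t \<in> I"
  shows "m (\<Sum>a\<in>A. map_matrix ((*) (k a)) (cmat (f a))) s t = (\<Sum>a\<in>A. k a * m (cmat (f a)) s t)"
  using assms by (simp add: m_sum m_scale Tc_scale cmat_closed)

lemma m_E_left: "\<lbrakk>Z \<in> Tc; u \<in> I; s \<in> I; t \<in> I\<rbrakk> \<Longrightarrow>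
    m (cmat (E u) ** Z) s t = (if s = u then m Z u t else 0)"
  using finite_I by (auto simp: m_mult m_E E_Tq cmat_closed if_distrib[of "\<lambda>x. x * _"] cong: if_cong)

lemma m_E_right: "\<lbrakk>Z \<in> Tc; u \<in> I; s \<in> I; t \<in> I\<rbrakk> \<Longrightarrow>
    m (Z ** cmat (E u)) s t = (if t = u then m Z s u else 0)"
  using finite_I by (auto simp: m_mult m_E E_Tq cmat_closed if_distrib[of "\<lambda>x. _ * x"] cong: if_cong)

text \<open>\<open>E u\<close> acts with rank one, so inserting it replaces the sum of a matrix
  product by a single product.\<close>

lemma m_compress:
  assumes "M \<in> Tq" "N \<in> Tq" "u \<in> I" "s \<in> I" "t \<in> I"
  shows "m (cmat (M ** E u ** N)) s t = m (cmat M) s u * m (cmat N) u t"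
proof -
  have "m (cmat (M ** E u ** N)) s t = m (cmat M ** (cmat (E u) ** cmat N)) s t"
    by (simp add: cmat_mult matrix_mul_assoc)
  also have "\<dots> = (\<Sum>v\<in>I. m (cmat M) s v * (if v = u then m (cmat N) u t else 0))"
    using assms by (simp add: m_mult[of "cmat M"] m_E_left cmat_closed E_Tq Tc_mult)
  also have "\<dots> = m (cmat M) s u * m (cmat N) u t"
    using finite_I assms by (simp add: if_distrib cong: if_cong)
  finally show ?thesis .
qed

definition chi :: "complex^'n^'n \<Rightarrow> complex" where
  "chi Z = (\<Sum>s\<in>I. m Z s s)"

lemma chi_commute: "Z \<in> Tc \<Longrightarrow> W \<in> Tc \<Longrightarrow> chi (Z ** W) = chi (W ** Z)"
  unfolding chi_def by (simp add: m_mult mult.commute) (subst sum.swap, simp)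

lemma chi_combination:
  "(\<And>a. a \<in> A \<Longrightarrow> f a \<in> Tq) \<Longrightarrow>
    chi (\<Sum>a\<in>A. map_matrix ((*) (k a)) (cmat (f a))) = (\<Sum>a\<in>A. k a * chi (cmat (f a)))"
  unfolding chi_def by (simp add: m_combination sum_distrib_left) (rule sum.swap)

lemma chi_one: "chi (mat 1) = of_nat (card I)"
  by (simp add: chi_def m_one)

section \<open>The field formed by the diagonal coefficients\<close>

definition diag_values :: "'i \<Rightarrow> complex set" where
  "diag_values s = (\<lambda>M. m (cmat M) s s) ` Tq"

context
  fixes s assumes s: "s \<in> I"
begin

text \<open>At \<open>(s, s)\<close> the product \<open>M ** N\<close> has a sum of products,
  whereas \<open>M ** E s ** N\<close> has the desired product itself.\<close>

lemma diag_values_mult: "x \<in> diag_values s \<Longrightarrow> y \<in> diag_values s \<Longrightarrow> x * y \<in> diag_values s"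
proof -
  assume "x \<in> diag_values s" "y \<in> diag_values s"
  then obtain M N where MN: "M \<in> Tq" "N \<in> Tq" "x = m (cmat M) s s" "y = m (cmat N) s s"
    by (auto simp: diag_values_def)
  then have "x * y = m (cmat (M ** E s ** N)) s s"
    using s by (simp add: m_compress)
  moreover have "M ** E s ** N \<in> Tq"
    using MN s by (intro Tq_mult E_Tq)
  ultimately show ?thesis
    unfolding diag_values_def by blast
qed

lemma diag_values_add: "x \<in> diag_values s \<Longrightarrow> y \<in> diag_values s \<Longrightarrow> x + y \<in> diag_values s"
proof -
  assume "x \<in> diag_values s" "y \<in> diag_values s"
  then obtain M N where MN: "M \<in> Tq" "N \<in> Tq" "x = m (cmat M) s s" "y = m (cmat N) s s"
    by (auto simp: diag_values_def)
  then have "x + y = m (cmat (M + N)) s s"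
    using s by (simp add: cmat_add m_add cmat_closed)
  then show ?thesis
    unfolding diag_values_def using Tq_add[OF MN(1,2)] by blast
qed

lemma diag_values_Rats: "q \<in> \<rat> \<Longrightarrow> q \<in> diag_values s"
proof -
  assume "q \<in> \<rat>"
  then obtain r where "q = of_rat r" by (rule Rats_cases)
  then have "q = m (cmat (map_matrix ((*) r) (mat 1))) s s"
    using s by (simp add: cmat_scale cmat_one m_scale m_one Tc_one)
  then show ?thesis
    unfolding diag_values_def using Tq_scale[OF Tq_one] by blast
qed

lemma diag_values_sum: "(\<And>a. a \<in> A \<Longrightarrow> f a \<in> diag_values s) \<Longrightarrow> sum f A \<in> diag_values s"
  by (induction A rule: infinite_finite_induct) (auto intro: diag_values_add diag_values_Rats)

text \<open>The values lie in the finite-dimensional rational span of those of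
  \<open>orth_basis\<close>, and multiplication by \<open>x\<close> maps the generators back into
  it.\<close>

lemma diag_values_algebraic:
  assumes "x \<in> diag_values s" shows "algebraic x"
proof -
  define B where "B = (\<lambda>c. m (cmat c) s s) ` orth_basis"
  have B: "m (cmat M) s s \<in> rat_vs.span B" if "M \<in> Tq" for M
  proof -
    have "m (cmat M) s s = m (cmat (\<Sum>c\<in>orth_basis. map_matrix ((*) (matrix_inner c M / matrix_inner c c)) c)) s s"
      using Tq_expansion[OF that] by simp
    also have "\<dots> = (\<Sum>c\<in>orth_basis. of_rat (matrix_inner c M / matrix_inner c c) * m (cmat c) s s)"
      unfolding cmat_sum cmat_scale using s by (intro m_combination orth_basis_Tq)
    also have "\<dots> \<in> rat_vs.span B"
      by (intro rat_vs.span_sum rat_vs.span_scale rat_vs.span_base) (auto simp: B_def)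
    finally show ?thesis .
  qed
  obtain M where M: "M \<in> Tq" "x = m (cmat M) s s"
    using assms by (auto simp: diag_values_def)
  show ?thesis
  proof (rule algebraic_if_finite_rat_span[of B])
    show "finite B" by (simp add: B_def finite_orth_basis)
    show "1 \<in> rat_vs.span B"
      using B[OF Tq_one] s by (simp add: cmat_one m_one)
    fix b assume "b \<in> B"
    then obtain c where "c \<in> orth_basis" and c2: "b = m (cmat c) s s"
      unfolding B_def by blast
    then have c: "c \<in> Tq" "b = m (cmat c) s s"
      using orth_basis_Tq by auto
    show "x * b \<in> rat_vs.span B"
      unfolding M(2) c(2) using M c s
      by (subst m_compress[symmetric]) (auto intro!: B Tq_mult E_Tq)
  qed
qed

text \<open>Algebraicity supplies inverses: \<open>inverse x\<close> is a rational polynomial in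
  \<open>x\<close>.\<close>

lemma diag_values_inverse: "x \<in> diag_values s \<Longrightarrow> inverse x \<in> diag_values s"
proof (cases "x = 0")
  assume x: "x \<in> diag_values s" and "x \<noteq> 0"
  then obtain r where r: "\<And>i. coeff r i \<in> \<rat>" "inverse x = poly r x"
    using inverse_eq_poly_if_algebraic[OF diag_values_algebraic] by metis
  have pow: "x ^ i \<in> diag_values s" for i
    by (induction i) (auto intro: diag_values_mult x diag_values_Rats)
  then show ?thesis
    unfolding r(2) poly_altdef
    by (intro diag_values_sum diag_values_mult[OF diag_values_Rats[OF r(1)] pow])
qed simp

lemma diag_values_divide: "x \<in> diag_values s \<Longrightarrow> y \<in> diag_values s \<Longrightarrow> x / y \<in> diag_values s"
  by (simp add: divide_inverse diag_values_mult diag_values_inverse)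

end

text \<open>For a value \<open>x\<close> at \<open>t\<close> and nonzero coefficients
  \<open>a\<close> at \<open>(s, t)\<close> and \<open>b\<close> at \<open>(t, s)\<close>, both
  \<open>a * x * b\<close> and \<open>a * b\<close> are values at \<open>s\<close>; their quotient
  is \<open>x\<close>.\<close>

lemma diag_values_subset:
  assumes s: "s \<in> I" and t: "t \<in> I"
  shows "diag_values t \<subseteq> diag_values s"
proof
  fix x assume "x \<in> diag_values t"
  then obtain M where M: "M \<in> Tq" "x = m (cmat M) t t"
    by (auto simp: diag_values_def)
  obtain A where A: "A \<in> Tq" "m (cmat A) s t \<noteq> 0" using irreducible s t by blast
  obtain B where B: "B \<in> Tq" "m (cmat B) t s \<noteq> 0" using irreducible s t by blast
  have "m (cmat A) s t * m (cmat B) t s \<in> diag_values s"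
    using A B s t by (subst m_compress[symmetric]) (auto simp: diag_values_def intro!: Tq_mult E_Tq)
  moreover have "m (cmat A) s t * m (cmat M) t t * m (cmat B) t s \<in> diag_values s"
  proof -
    have "m (cmat A) s t * m (cmat M) t t * m (cmat B) t s = m (cmat (A ** E t ** M ** E t ** B)) s s"
      using A B M s t by (simp add: m_compress Tq_mult E_Tq)
    then show ?thesis
      using A B M s t by (auto simp: diag_values_def intro!: Tq_mult E_Tq)
  qed
  ultimately have "m (cmat A) s t * m (cmat M) t t * m (cmat B) t s / (m (cmat A) s t * m (cmat B) t s)
      \<in> diag_values s"
    using diag_values_divide[OF s] by blast
  then show "x \<in> diag_values s" using A B M by simp
qed

definition K :: "complex set" where
  "K = (\<lambda>M. chi (cmat M)) ` Tq"

lemma K_eq_diag_values: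
  assumes s: "s \<in> I" shows "K = diag_values s"
proof
  show "K \<subseteq> diag_values s"
  proof
    fix x assume "x \<in> K"
    then obtain M where M: "M \<in> Tq" "x = (\<Sum>t\<in>I. m (cmat M) t t)"
      by (auto simp: K_def chi_def)
    have "m (cmat M) t t \<in> diag_values s" if "t \<in> I" for t
      using diag_values_subset[OF s that] M by (auto simp: diag_values_def)
    then show "x \<in> diag_values s" unfolding M(2) by (rule diag_values_sum[OF s])
  qed
  show "diag_values s \<subseteq> K"
  proof
    fix x assume "x \<in> diag_values s"
    then obtain M where M: "M \<in> Tq" "x = m (cmat M) s s"
      by (auto simp: diag_values_def)
    have "chi (cmat (E s ** M)) = (\<Sum>t\<in>I. if t = s then m (cmat M) s s else 0)"
      unfolding chi_def using M s by (intro sum.cong refl) (auto simp: cmat_mult m_E_left cmat_closed)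
    also have "\<dots> = x" using finite_I s M by simp
    finally show "x \<in> K"
      unfolding K_def using M s by (auto intro!: image_eqI[of _ _ "E s ** M"] Tq_mult E_Tq)
  qed
qed

section \<open>Rescaling the basis to coefficients in \<open>K\<close>\<close>

definition s0 :: 'i where "s0 = (SOME s. s \<in> I)"

lemma s0: "s0 \<in> I"
  unfolding s0_def using I_nonempty by (simp add: some_in_eq)

lemmas K_s0 = K_eq_diag_values[OF s0]
lemmas K_mult = diag_values_mult[OF s0, folded K_s0]
  and K_add = diag_values_add[OF s0, folded K_s0]
  and K_Rats = diag_values_Rats[OF s0, folded K_s0]
  and K_sum = diag_values_sum[OF s0, folded K_s0]
  and K_inverse = diag_values_inverse[OF s0, folded K_s0]
  and K_divide = diag_values_divide[OF s0, folded K_s0]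
  and K_algebraic = diag_values_algebraic[OF s0, folded K_s0]

lemma chi_K: "M \<in> Tq \<Longrightarrow> chi (cmat M) \<in> K"
  by (simp add: K_def)

lemma m_diag_K: "M \<in> Tq \<Longrightarrow> s \<in> I \<Longrightarrow> m (cmat M) s s \<in> K"
  unfolding K_eq_diag_values[of s] diag_values_def by (rule imageI)

definition col :: "'i \<Rightarrow> rat^'n^'n" where
  "col s = (SOME M. M \<in> Tq \<and> m (cmat M) s s0 \<noteq> 0)"

definition row :: "'i \<Rightarrow> rat^'n^'n" where
  "row s = (SOME M. M \<in> Tq \<and> m (cmat M) s0 s \<noteq> 0)"

lemma col: "s \<in> I \<Longrightarrow> col s \<in> Tq" "s \<in> I \<Longrightarrow> m (cmat (col s)) s s0 \<noteq> 0"
  and row: "s \<in> I \<Longrightarrow> row s \<in> Tq" "s \<in> I \<Longrightarrow> m (cmat (row s)) s0 s \<noteq> 0"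
proof -
  assume s: "s \<in> I"
  have "\<exists>M. M \<in> Tq \<and> m (cmat M) s s0 \<noteq> 0" "\<exists>M. M \<in> Tq \<and> m (cmat M) s0 s \<noteq> 0"
    using irreducible s s0 by auto
  from this[THEN someI_ex]
  show "col s \<in> Tq" "m (cmat (col s)) s s0 \<noteq> 0" "row s \<in> Tq" "m (cmat (row s)) s0 s \<noteq> 0"
    unfolding col_def row_def by auto
qed

text \<open>\<open>E s ** col s\<close> carries the basis vector at \<open>s0\<close> to
  \<open>\<alpha> s\<close> times the one at \<open>s\<close>, so the rescaled vectors all arise
  from one vector by rational elements.\<close>

definition \<alpha> :: "'i \<Rightarrow> complex" where
  "\<alpha> s = m (cmat (col s)) s s0"

lemma \<alpha>_nonzero: "s \<in> I \<Longrightarrow> \<alpha> s \<noteq> 0"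
  by (simp add: \<alpha>_def col)

text \<open>The matrix coefficients with respect to the rescaled basis \<open>\<alpha> s \<cdot> v\<^sub>s\<close>; on the rational form
  they take values in \<open>K\<close>.\<close>

definition n :: "complex^'n^'n \<Rightarrow> 'i \<Rightarrow> 'i \<Rightarrow> complex" where
  "n Z s t = m Z s t * \<alpha> t / \<alpha> s"

lemma n_add: "\<lbrakk>Z \<in> Tc; W \<in> Tc; s \<in> I; t \<in> I\<rbrakk> \<Longrightarrow> n (Z + W) s t = n Z s t + n W s t"
  by (simp add: n_def m_add distrib_right add_divide_distrib)

lemma n_diff: "\<lbrakk>Z \<in> Tc; W \<in> Tc; s \<in> I; t \<in> I\<rbrakk> \<Longrightarrow> n (Z - W) s t = n Z s t - n W s t"
  by (simp add: n_def m_diff left_diff_distrib diff_divide_distrib)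

lemma n_sum:
  "(\<And>a. a \<in> A \<Longrightarrow> f a \<in> Tc) \<Longrightarrow> s \<in> I \<Longrightarrow> t \<in> I \<Longrightarrow> n (sum f A) s t = (\<Sum>a\<in>A. n (f a) s t)"
  by (simp add: n_def m_sum sum_distrib_right sum_divide_distrib)

lemma n_mult: "\<lbrakk>Z \<in> Tc; W \<in> Tc; s \<in> I; t \<in> I\<rbrakk> \<Longrightarrow> n (Z ** W) s t = (\<Sum>u\<in>I. n Z s u * n W u t)"
  by (simp add: n_def m_mult \<alpha>_nonzero sum_distrib_right sum_divide_distrib mult.assoc)

lemma n_eq_0_iff: "s \<in> I \<Longrightarrow> t \<in> I \<Longrightarrow> n Z s t = 0 \<longleftrightarrow> m Z s t = 0"
  by (simp add: n_def \<alpha>_nonzero)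

text \<open>With \<open>b\<close> the coefficient of \<open>row s\<close> at \<open>(s0, s)\<close>,
  both \<open>b * m (cmat M) s t * \<alpha> t\<close> and \<open>b * \<alpha> s\<close> are
  coefficients of rational elements at \<open>(s0, s0)\<close>; their quotient is the rescaled
  coefficient.\<close>

lemma n_K:
  assumes "M \<in> Tq" "s \<in> I" "t \<in> I"
  shows "n (cmat M) s t \<in> K"
proof -
  let ?b = "m (cmat (row s)) s0 s"
  have "?b * m (cmat M) s t * \<alpha> t = m (cmat (row s ** E s ** M ** E t ** col t)) s0 s0"
    using assms s0 by (simp add: m_compress Tq_mult E_Tq col row \<alpha>_def)
  then have 1: "?b * m (cmat M) s t * \<alpha> t \<in> K"
    using assms s0 by (simp add: m_diag_K Tq_mult E_Tq col row)
  have "?b * \<alpha> s = m (cmat (row s ** E s ** col s)) s0 s0"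
    using assms s0 by (simp add: m_compress Tq_mult E_Tq col row \<alpha>_def)
  then have "?b * \<alpha> s \<in> K"
    using assms s0 by (simp add: m_diag_K Tq_mult E_Tq col row)
  with 1 have "?b * m (cmat M) s t * \<alpha> t / (?b * \<alpha> s) \<in> K" by (rule K_divide)
  then show ?thesis
    using row(2)[OF assms(2)] by (simp add: n_def)
qed

text \<open>The element passes from \<open>t\<close> to \<open>s\<close> through \<open>s0\<close>:
  \<open>row t\<close>, then a rational \<open>L\<close>, then \<open>col s\<close>. The value
  \<open>k / b\<close> prescribed for \<open>L\<close> at \<open>(s0, s0)\<close> compensates the
  factor \<open>b\<close> that \<open>row t\<close> contributes after rescaling.\<close>

lemma n_surj_unit:
  assumes "s \<in> I" "t \<in> I" "k \<in> K"
  shows "\<exists>M\<in>Tq. \<forall>u\<in>I. \<forall>v\<in>I. n (cmat M) u v = (if u = s \<and> v = t then k else 0)"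
proof -
  define b where "b = m (cmat (row t)) s0 t * \<alpha> t"
  have "b = m (cmat (row t ** E t ** col t)) s0 s0"
    using assms s0 by (simp add: b_def m_compress Tq_mult E_Tq col row \<alpha>_def)
  then have "b \<in> K"
    using assms s0 by (simp add: m_diag_K Tq_mult E_Tq col row)
  have "b \<noteq> 0"
    using assms by (simp add: b_def row \<alpha>_nonzero)
  then have "k / b \<in> diag_values s0"
    using K_divide[OF assms(3) \<open>b \<in> K\<close>] by (simp add: K_s0)
  then obtain L where L: "L \<in> Tq" "m (cmat L) s0 s0 = k / b"
    by (auto simp: diag_values_def)
  define N where "N = col s ** E s0 ** L ** E s0 ** row t"
  have N: "N \<in> Tq"
    using assms L s0 by (simp add: N_def Tq_mult E_Tq col row)
  have "m (cmat N) s t * \<alpha> t = \<alpha> s * (k / b) * b"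
    using assms L s0 by (simp add: N_def m_compress Tq_mult E_Tq col row \<alpha>_def b_def)
  then have Nst: "m (cmat N) s t * \<alpha> t / \<alpha> s = k"
    using \<open>b \<noteq> 0\<close> \<alpha>_nonzero[OF assms(1)] by simp
  have "n (cmat (E s ** N ** E t)) u v = (if u = s \<and> v = t then k else 0)" if "u \<in> I" "v \<in> I" for u v
    using that assms N Nst
    by (auto simp: n_def cmat_mult m_E_left m_E_right Tc_mult cmat_closed E_Tq)
  then show ?thesis
    using N assms by (intro bexI[of _ "E s ** N ** E t"]) (auto intro!: Tq_mult E_Tq)
qed

lemma n_surj:
  assumes "\<And>s t. s \<in> I \<Longrightarrow> t \<in> I \<Longrightarrow> f s t \<in> K"
  obtains M where "M \<in> Tq" "\<And>s t. s \<in> I \<Longrightarrow> t \<in> I \<Longrightarrow> n (cmat M) s t = f s t"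
proof -
  have "\<forall>p\<in>I \<times> I. \<exists>M. M \<in> Tq \<and>
      (\<forall>u\<in>I. \<forall>v\<in>I. n (cmat M) u v = (if u = fst p \<and> v = snd p then f (fst p) (snd p) else 0))"
  proof
    fix p assume "p \<in> I \<times> I"
    then have "fst p \<in> I" "snd p \<in> I" by auto
    from n_surj_unit[OF this assms[OF this]]
    show "\<exists>M. M \<in> Tq \<and> (\<forall>u\<in>I. \<forall>v\<in>I. n (cmat M) u v =
        (if u = fst p \<and> v = snd p then f (fst p) (snd p) else 0))"
      by (simp add: Bex_def)
  qed
  then obtain N where N0: "\<forall>p\<in>I \<times> I. N p \<in> Tq \<and> (\<forall>u\<in>I. \<forall>v\<in>I. n (cmat (N p)) u v =
      (if u = fst p \<and> v = snd p then f (fst p) (snd p) else 0))"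
    by (rule bchoice[THEN exE])
  have N: "N p \<in> Tq"
      "u \<in> I \<Longrightarrow> v \<in> I \<Longrightarrow> n (cmat (N p)) u v = (if u = fst p \<and> v = snd p then f (fst p) (snd p) else 0)"
    if "p \<in> I \<times> I" for p u v
    using bspec[OF N0 that] by simp_all
  have "n (cmat (\<Sum>p\<in>I\<times>I. N p)) s t = f s t" if "s \<in> I" "t \<in> I" for s t
  proof -
    have "n (cmat (\<Sum>p\<in>I\<times>I. N p)) s t = (\<Sum>p\<in>I\<times>I. n (cmat (N p)) s t)"
      unfolding cmat_sum using N(1) that by (intro n_sum cmat_closed)
    also have "\<dots> = (\<Sum>p\<in>I\<times>I. if p = (s, t) then f s t else 0)"
      using N(2) that by (intro sum.cong) auto
    also have "\<dots> = f s t" using finite_I that by simp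
    finally show ?thesis .
  qed
  with Tq_sum[OF N(1)] show ?thesis by (rule that)
qed

text \<open>Schur's lemma by hand: commuting with \<open>E t\<close> kills the off-diagonal
  coefficients, and commuting with \<open>col s\<close> equates the diagonal coefficient at
  \<open>s\<close> with the one at \<open>s0\<close>.\<close>

lemma m_central:
  assumes Z: "Z \<in> Tc" "\<And>M. M \<in> Tq \<Longrightarrow> Z ** cmat M = cmat M ** Z"
  shows "\<exists>c. \<forall>s\<in>I. \<forall>t\<in>I. m Z s t = (if s = t then c else 0)"
proof -
  have off: "m Z s t = 0" if "s \<in> I" "t \<in> I" "s \<noteq> t" for s t
  proof -
    have "m (Z ** cmat (E t)) s t = m (cmat (E t) ** Z) s t"
      using Z(2) E_Tq that by simp
    then show ?thesis using that Z(1) by (simp add: m_E_left m_E_right)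
  qed
  have "m Z s s = m Z s0 s0" if s: "s \<in> I" for s
  proof -
    have C: "cmat (col s) \<in> Tc" using col s cmat_closed by blast
    have "m (Z ** cmat (col s)) s s0 = m (cmat (col s) ** Z) s s0"
      using Z(2) col s by simp
    moreover have "m (Z ** cmat (col s)) s s0 = (\<Sum>u\<in>I. if u = s then m Z s s * \<alpha> s else 0)"
      using off s s0 by (subst m_mult[OF Z(1) C s s0], intro sum.cong) (auto simp: \<alpha>_def)
    moreover have "m (cmat (col s) ** Z) s s0 = (\<Sum>u\<in>I. if u = s0 then \<alpha> s * m Z s0 s0 else 0)"
      using off s s0 by (subst m_mult[OF C Z(1) s s0], intro sum.cong) (auto simp: \<alpha>_def)
    ultimately show ?thesis
      using finite_I s s0 \<alpha>_nonzero[OF s] by simp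
  qed
  then show ?thesis using off by (intro exI[of _ "m Z s0 s0"]) auto
qed

section \<open>The element \<open>z\<close> dual to the character, and the idempotent
  \<open>e\<close>\<close>

definition annihilates :: "complex^'n^'n \<Rightarrow> bool" where
  "annihilates Z \<longleftrightarrow> (\<forall>s\<in>I. \<forall>t\<in>I. m Z s t = 0)"

definition acts_as_one :: "complex^'n^'n \<Rightarrow> bool" where
  "acts_as_one Z \<longleftrightarrow> (\<forall>s\<in>I. \<forall>t\<in>I. m Z s t = (if s = t then 1 else 0))"

lemma annihilates_mult: "annihilates Z \<Longrightarrow> Z \<in> Tc \<Longrightarrow> W \<in> Tc \<Longrightarrow> annihilates (Z ** W)"
  by (simp add: annihilates_def m_mult)

lemma annihilates_one_diff: "acts_as_one Z \<Longrightarrow> Z \<in> Tc \<Longrightarrow> annihilates (mat 1 - Z)"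
  by (simp add: annihilates_def acts_as_one_def m_diff m_one Tc_one)

lemma m_mult_acts_as_one:
  "acts_as_one W \<Longrightarrow> Z \<in> Tc \<Longrightarrow> W \<in> Tc \<Longrightarrow> s \<in> I \<Longrightarrow> t \<in> I \<Longrightarrow> m (Z ** W) s t = m Z s t"
  using finite_I by (simp add: acts_as_one_def m_mult if_distrib[of "\<lambda>x. _ * x"] cong: if_cong)

lemma chi_annihilates: "annihilates Z \<Longrightarrow> chi Z = 0"
  by (simp add: chi_def annihilates_def)

text \<open>The character is \<open>\<chi>(Z) = trace (z Z)\<close>; the idempotent \<open>e\<^sub>\<chi>\<close> is a scalar multiple of \<open>z\<close>.\<close>

definition z :: "complex^'n^'n" where
  "z = (\<Sum>c\<in>orth_basis.
     map_matrix ((*) (chi (cmat c) / of_rat (matrix_inner c c))) (cmat (transpose c)))"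

lemma z_coefficient_K: "c \<in> orth_basis \<Longrightarrow> chi (cmat c) / of_rat (matrix_inner c c) \<in> K"
  by (intro K_divide chi_K orth_basis_Tq) (auto intro: K_Rats)

lemma z_Tc: "z \<in> Tc"
  unfolding z_def by (intro Tc_combination transpose_closed orth_basis_Tq)

lemma trace_sum: "trace (sum f A) = (\<Sum>a\<in>A. trace (f a))"
  for f :: "'b \<Rightarrow> complex^'n^'n"
  unfolding trace_def by (simp add: sum_nth2) (rule sum.swap)

text \<open>The trace of \<open>z ** Z\<close> pairs each transposed basis element with
  \<open>Z\<close>. This yields the coordinates of \<open>Z\<close>, weighted by the values of
  \<open>chi\<close> on the basis, and linearity adds them up to \<open>chi Z\<close>.\<close>

lemma trace_z: "Z \<in> Tc \<Longrightarrow> trace (z ** Z) = chi Z"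
proof -
  assume Z: "Z \<in> Tc"
  have tr: "trace (map_matrix ((*) k) A) = k * trace A" for k and A :: "complex^'n^'n"
    by (simp add: trace_def sum_distrib_left)
  have "trace (z ** Z) = (\<Sum>c\<in>orth_basis. chi (cmat c) / of_rat (matrix_inner c c) * matrix_inner (cmat c) Z)"
    by (simp add: z_def matrix_mult_sum_left map_matrix_mult_left trace_sum tr
        matrix_inner_eq_trace cmat_transpose)
  also have "\<dots> = chi (\<Sum>c\<in>orth_basis. map_matrix ((*) (matrix_inner (cmat c) Z / of_rat (matrix_inner c c))) (cmat c))"
    by (subst chi_combination) (auto simp: orth_basis_Tq mult.commute)
  also have "\<dots> = chi Z" using Tc_expansion[OF Z] by simp
  finally show ?thesis .
qed

text \<open>The coordinates of \<open>Y\<close> are, up to scalars, its trace pairings with the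
  transposed basis elements, which belong to the algebra.\<close>

lemma trace_form_nondegenerate:
  assumes "Y \<in> Tc" "\<And>Z. Z \<in> Tc \<Longrightarrow> trace (Y ** Z) = 0"
  shows "Y = 0"
proof -
  have "matrix_inner (cmat c) Y = 0" if "c \<in> orth_basis" for c
  proof -
    have "matrix_inner (cmat c) Y = trace (Y ** cmat (transpose c))"
      by (simp add: matrix_inner_eq_trace cmat_transpose trace_mul_sym[of Y])
    also have "\<dots> = 0"
      using that by (intro assms(2) cmat_closed transpose_closed orth_basis_Tq)
    finally show ?thesis .
  qed
  then have "(\<Sum>c\<in>orth_basis. map_matrix ((*) (matrix_inner (cmat c) Y / of_rat (matrix_inner c c))) (cmat c)) = 0"
    by (intro sum.neutral) (simp add: vec_eq_iff)
  then show ?thesis using Tc_expansion[OF assms(1)] by simp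
qed

text \<open>\<open>chi\<close> takes equal values on \<open>M ** Z\<close> and
  \<open>Z ** M\<close>, so \<open>z ** M\<close> and \<open>M ** z\<close> have the same trace
  pairing with every \<open>Z\<close>.\<close>

lemma z_central: "M \<in> Tc \<Longrightarrow> z ** M = M ** z"
proof -
  assume M: "M \<in> Tc"
  have "z ** M - M ** z = 0"
  proof (rule trace_form_nondegenerate)
    show "z ** M - M ** z \<in> Tc" by (intro Tc_diff Tc_mult M z_Tc)
    fix Z assume Z: "Z \<in> Tc"
    have "trace (M ** z ** Z) = trace (z ** (Z ** M))"
      using trace_mul_sym[of M "z ** Z"] by (simp add: matrix_mul_assoc)
    also have "\<dots> = chi (M ** Z)"
      using M Z by (simp add: trace_z Tc_mult chi_commute)
    also have "\<dots> = trace (z ** M ** Z)"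
      using M Z by (simp add: trace_z[symmetric] Tc_mult matrix_mul_assoc)
    finally show "trace ((z ** M - M ** z) ** Z) = 0"
      by (simp add: trace_sub matrix_sub_rdistrib)
  qed
  then show ?thesis by simp
qed

text \<open>The elements acting as zero form a right ideal on which \<open>chi\<close> vanishes, so
  \<open>z ** Z\<close> pairs to zero with the whole algebra.\<close>

lemma z_annihilates: "annihilates Z \<Longrightarrow> Z \<in> Tc \<Longrightarrow> z ** Z = 0"
  by (rule trace_form_nondegenerate)
    (auto simp: matrix_mul_assoc[symmetric] trace_z Tc_mult z_Tc chi_annihilates annihilates_mult)

lemma z_algebraic: "algebraic (z $ i $ j)"
proof -
  have "z $ i $ j = (\<Sum>c\<in>orth_basis.
      (chi (cmat c) / of_rat (matrix_inner c c)) * of_rat (c $ j $ i))"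
    by (simp add: z_def sum_nth2 transpose_def)
  then show ?thesis
    by (simp only:, intro algebraic_sum algebraic_mult K_algebraic[OF z_coefficient_K])
      (auto intro: rat_imp_algebraic)
qed

definition z_scalar :: complex where "z_scalar = m z s0 s0"

lemma m_z: "s \<in> I \<Longrightarrow> t \<in> I \<Longrightarrow> m z s t = (if s = t then z_scalar else 0)"
proof -
  obtain c where c: "\<forall>s\<in>I. \<forall>t\<in>I. m z s t = (if s = t then c else 0)"
    using m_central[OF z_Tc z_central[OF cmat_closed]] ..
  then have "z_scalar = c" using s0 by (simp add: z_scalar_def)
  then show "s \<in> I \<Longrightarrow> t \<in> I \<Longrightarrow> m z s t = (if s = t then z_scalar else 0)"
    using c by simp
qed

text \<open>Otherwise \<open>z\<close> acts as zero, so \<open>z ** z = 0\<close>. Being central,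
  \<open>z\<close> commutes with its adjoint and hence vanishes, against
  \<open>chi (mat 1) = card I\<close>.\<close>

lemma z_scalar_nonzero: "z_scalar \<noteq> 0"
proof
  assume "z_scalar = 0"
  then have "annihilates z" by (simp add: annihilates_def m_z)
  then have "z ** z = 0" using z_Tc by (rule z_annihilates)
  moreover have "z ** adj z = adj z ** z"
    by (intro z_central adj_closed z_Tc)
  ultimately have "z = 0" by (rule nilpotent_normal_eq_0)
  then have "chi (mat 1) = 0" using trace_z[OF Tc_one] by (simp add: trace_def)
  then show False using finite_I I_nonempty by (simp add: chi_one)
qed

lemma z_scalar_algebraic: "algebraic z_scalar"
proof -
  have "z_scalar = (\<Sum>c\<in>orth_basis. chi (cmat c) / of_rat (matrix_inner c c) * m (cmat (transpose c)) s0 s0)"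
    unfolding z_scalar_def z_def using s0
    by (intro m_combination transpose_closed orth_basis_Tq)
  also have "\<dots> \<in> K"
    by (intro K_sum K_mult z_coefficient_K m_diag_K s0 transpose_closed orth_basis_Tq)
  finally show ?thesis by (rule K_algebraic)
qed

definition e :: "complex^'n^'n" where
  "e = map_matrix ((*) (inverse z_scalar)) z"

lemma e_Tc: "e \<in> Tc" and e_central: "M \<in> Tc \<Longrightarrow> e ** M = M ** e"
  and e_acts: "acts_as_one e" and e_algebraic: "algebraic (e $ i $ j)"
  and e_annihilates: "annihilates Z \<Longrightarrow> Z \<in> Tc \<Longrightarrow> e ** Z = 0"
proof -
  show "e \<in> Tc" by (simp add: e_def Tc_scale z_Tc)
  show "M \<in> Tc \<Longrightarrow> e ** M = M ** e"
    by (simp add: e_def map_matrix_mult_left map_matrix_mult_right z_central)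
  show "acts_as_one e"
    using z_scalar_nonzero by (simp add: acts_as_one_def e_def m_scale z_Tc m_z)
  show "algebraic (e $ i $ j)"
    by (auto simp: e_def intro!: algebraic_mult algebraic_inverse z_scalar_algebraic z_algebraic)
  show "annihilates Z \<Longrightarrow> Z \<in> Tc \<Longrightarrow> e ** Z = 0"
    by (simp add: e_def map_matrix_mult_left z_annihilates vec_eq_iff[of _ 0])
qed

lemma e_mult_acts_as_one: "acts_as_one Z \<Longrightarrow> Z \<in> Tc \<Longrightarrow> e ** Z = e"
  using e_annihilates[OF annihilates_one_diff, of Z] Tc_diff[OF Tc_one]
  by (simp add: matrix_sub_ldistrib)

lemma e_idem: "e ** e = e"
  using e_acts e_Tc by (rule e_mult_acts_as_one)

lemma e_nonzero: "e \<noteq> 0"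
proof
  assume "e = 0"
  moreover have "m e s0 s0 = 1" using e_acts s0 by (simp add: acts_as_one_def)
  ultimately show False using m_zero[OF s0 s0] by simp
qed

text \<open>A central idempotent acts by a scalar \<open>c\<close> with
  \<open>c * c = c\<close>.\<close>

lemma central_idempotent_cases:
  assumes "central_idempotent Tc f"
  shows "annihilates f \<or> acts_as_one f"
proof -
  have f: "f \<in> Tc" "f ** f = f" "\<And>M. M \<in> Tc \<Longrightarrow> f ** M = M ** f"
    using assms by (auto simp: central_idempotent_def)
  obtain c where c: "\<forall>s\<in>I. \<forall>t\<in>I. m f s t = (if s = t then c else 0)"
    using m_central[OF f(1) f(3)[OF cmat_closed]] ..
  have "c = m (f ** f) s0 s0" using c s0 f(2) by simp
  also have "\<dots> = (\<Sum>u\<in>I. if u = s0 then c * c else 0)"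
    using c s0 by (subst m_mult[OF f(1) f(1) s0 s0], intro sum.cong) auto
  also have "\<dots> = c * c" using finite_I s0 by simp
  finally have "c = 0 \<or> c = 1" by simp
  then show ?thesis using c by (auto simp: annihilates_def acts_as_one_def)
qed

lemma e_central_idempotent: "central_idempotent Tc e"
  unfolding central_idempotent_def by (intro conjI ballI e_Tc e_idem e_central)

text \<open>A summand \<open>f\<close> satisfies \<open>e ** f = f\<close>; if it acts as zero it
  vanishes, and if it acts as one it equals \<open>e\<close>.\<close>

lemma e_centrally_primitive: "centrally_primitive Tc e"
  unfolding centrally_primitive_def
proof (intro conjI allI impI)
  fix f g
  assume *: "central_idempotent Tc f \<and> central_idempotent Tc g \<and> f ** g = 0 \<and> f + g = e"
  then have fg: "f \<in> Tc" "g \<in> Tc" "f ** f = f" "g ** g = g" "f ** g = 0" "g ** f = 0" "f + g = e"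
    by (auto simp: central_idempotent_def)
  have ef: "e ** f = f" "e ** g = g"
    using fg by (simp_all add: fg(7)[symmetric] matrix_add_rdistrib)
  show "f = 0 \<or> g = 0"
  proof (cases "annihilates f")
    case True
    then show ?thesis using e_annihilates fg ef by metis
  next
    case False
    then have "acts_as_one f" using central_idempotent_cases * by blast
    then have "e = f" using e_mult_acts_as_one fg ef by metis
    then show ?thesis using fg by simp
  qed
qed (simp_all add: e_nonzero e_central_idempotent)

text \<open>As \<open>chi f\<close> is nonzero, \<open>f\<close> acts as one. Hence
  \<open>e ** f = e\<close>, and \<open>f = (f - e) + e\<close> splits \<open>f\<close> into
  orthogonal central idempotents.\<close>

lemma centrally_primitive_eq_e:
  assumes f: "centrally_primitive Tc f" "chi f \<noteq> 0"
  shows "f = e"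
proof -
  have cf: "f \<in> Tc" "f ** f = f" "\<And>M. M \<in> Tc \<Longrightarrow> f ** M = M ** f" "central_idempotent Tc f"
    using f by (auto simp: centrally_primitive_def central_idempotent_def)
  have "acts_as_one f"
    using central_idempotent_cases[OF cf(4)] f(2) chi_annihilates by blast
  then have ef: "e ** f = e" using e_mult_acts_as_one cf by blast
  have fe: "f ** e = e" using cf(3) e_Tc ef by metis
  have "central_idempotent Tc (f - e)"
    unfolding central_idempotent_def
  proof (intro conjI ballI)
    show "f - e \<in> Tc" by (intro Tc_diff cf(1) e_Tc)
    show "(f - e) ** (f - e) = f - e"
      by (simp add: matrix_sub_ldistrib matrix_sub_rdistrib ef fe e_idem cf(2))
    show "(f - e) ** M = M ** (f - e)" if "M \<in> Tc" for M
      using cf(3)[OF that] e_central[OF that] by (simp add: matrix_sub_ldistrib matrix_sub_rdistrib)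
  qed
  moreover have "(f - e) ** e = 0" by (simp add: matrix_sub_rdistrib fe e_idem)
  ultimately have "f - e = 0 \<or> e = 0"
    using f(1) e_central_idempotent unfolding centrally_primitive_def
    by (metis diff_add_cancel)
  then show ?thesis using e_nonzero by simp
qed

lemma chi_e: "chi e \<noteq> 0"
proof -
  have "chi e = (\<Sum>s\<in>I. 1)"
    unfolding chi_def using e_acts by (intro sum.cong) (simp_all add: acts_as_one_def)
  then show ?thesis using finite_I I_nonempty by simp
qed

end


section \<open>Galois conjugates of the character idempotent\<close>

context
  fixes \<sigma> :: "complex \<Rightarrow> complex"
  assumes \<sigma>: "\<sigma> \<in> ring_iso algebraic_numbers algebraic_numbers"
begin

lemma aut_algebraic: "algebraic a \<Longrightarrow> algebraic (\<sigma> a)"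
  and aut_add: "algebraic a \<Longrightarrow> algebraic b \<Longrightarrow> \<sigma> (a + b) = \<sigma> a + \<sigma> b"
  and aut_mult: "algebraic a \<Longrightarrow> algebraic b \<Longrightarrow> \<sigma> (a * b) = \<sigma> a * \<sigma> b"
  and aut_one: "\<sigma> 1 = 1"
  and aut_bij: "bij_betw \<sigma> {a. algebraic a} {a. algebraic a}"
  using ring_iso_memE[OF \<sigma>] by (simp_all add: algebraic_numbers_def ring_of_type_algebra_def)

lemma aut_zero: "\<sigma> 0 = 0"
  using aut_add[of 0 0] by simp

lemma aut_eq_iff: "algebraic a \<Longrightarrow> algebraic b \<Longrightarrow> \<sigma> a = \<sigma> b \<longleftrightarrow> a = b"
  using inj_on_eq_iff[OF bij_betw_imp_inj_on[OF aut_bij], of a b] by simp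

lemma aut_sum: "(\<And>i. i \<in> A \<Longrightarrow> algebraic (f i)) \<Longrightarrow> \<sigma> (sum f A) = (\<Sum>i\<in>A. \<sigma> (f i))"
  by (induction A rule: infinite_finite_induct) (simp_all add: aut_zero aut_add algebraic_sum)

lemma aut_rat: "\<sigma> (of_rat q) = of_rat q"
proof -
  have nat: "\<sigma> (of_nat n) = of_nat n" for n
    by (induction n) (simp_all add: aut_zero aut_add aut_one)
  have "\<sigma> (- 1) = - 1"
    using aut_add[of "-1" 1] by (simp add: aut_zero aut_one eq_neg_iff_add_eq_0)
  then have "\<sigma> (- 1 * of_nat n) = - of_nat n" for n
    by (subst aut_mult) (simp_all add: nat)
  then have int: "\<sigma> (of_int k) = of_int k" for k
    using nat by (cases k rule: int_cases2) simp_all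
  obtain a b where q: "q = Rat.Fract a b" "b > 0" by (cases q) auto
  have "\<sigma> (of_rat q * of_int b) = \<sigma> (of_int a)"
    using q by (simp add: of_rat_rat)
  then have "\<sigma> (of_rat q) * of_int b = of_int a"
    by (subst (asm) aut_mult) (simp_all add: int rat_imp_algebraic)
  then show ?thesis using q by (simp add: of_rat_rat field_simps)
qed

lemma aut_power: "algebraic a \<Longrightarrow> algebraic (a ^ k) \<and> \<sigma> (a ^ k) = \<sigma> a ^ k"
  by (induction k) (simp_all add: aut_one aut_mult algebraic_mult)

lemma aut_poly_root:
  assumes "\<And>i. coeff p i \<in> \<rat>" "poly p a = 0" "algebraic a"
  shows "poly p (\<sigma> a) = 0"
proof -
  have rat: "\<sigma> (coeff p i) = coeff p i" for i
    using assms(1)[of i] by (auto elim!: Rats_cases simp: aut_rat)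
  have "\<sigma> (poly p a) = (\<Sum>i\<le>degree p. \<sigma> (coeff p i * a ^ i))"
    unfolding poly_altdef
    by (intro aut_sum algebraic_mult) (simp_all add: assms aut_power rat_imp_algebraic)
  also have "\<dots> = poly p (\<sigma> a)"
    unfolding poly_altdef
    by (intro sum.cong refl) (simp add: aut_mult rat assms aut_power rat_imp_algebraic)
  finally show ?thesis using assms(2) by (simp add: aut_zero)
qed

lemma aut_matrix_mult:
  assumes "\<And>i j. algebraic (A $ i $ j)" "\<And>i j. algebraic (B $ i $ j)"
  shows "map_matrix \<sigma> (A ** B) = map_matrix \<sigma> A ** map_matrix \<sigma> B"
proof -
  have "\<sigma> (\<Sum>k\<in>UNIV. A $ i $ k * B $ k $ j) = (\<Sum>k\<in>UNIV. \<sigma> (A $ i $ k) * \<sigma> (B $ k $ j))" for i j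
    by (subst aut_sum) (simp_all add: assms aut_mult algebraic_mult)
  then show ?thesis by (simp add: vec_eq_iff matrix_matrix_mult_def)
qed

lemma aut_cmat: "map_matrix \<sigma> (cmat M) = cmat M"
  by (simp add: vec_eq_iff aut_rat)

lemma aut_inverse_ex:
  "\<exists>\<tau>\<in>ring_iso algebraic_numbers algebraic_numbers. \<forall>a. algebraic a \<longrightarrow> \<tau> (\<sigma> a) = a \<and> \<sigma> (\<tau> a) = a"
proof -
  let ?A = "{a :: complex. algebraic a}"
  let ?\<tau> = "inv_into ?A \<sigma>"
  have bij: "bij_betw ?\<tau> ?A ?A" by (rule bij_betw_inv_into[OF aut_bij])
  have 1: "?\<tau> (\<sigma> a) = a" if "algebraic a" for a
    using bij_betw_inv_into_left[OF aut_bij] that by simp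
  have 2: "\<sigma> (?\<tau> a) = a" if "algebraic a" for a
    using bij_betw_inv_into_right[OF aut_bij] that by simp
  have alg: "algebraic (?\<tau> a)" if "algebraic a" for a
    using bij that by (auto simp: bij_betw_def)
  have "?\<tau> (a + b) = ?\<tau> a + ?\<tau> b" if "algebraic a" "algebraic b" for a b
    using that by (subst aut_eq_iff[symmetric]) (simp_all add: alg algebraic_add aut_add 2)
  moreover have "?\<tau> (a * b) = ?\<tau> a * ?\<tau> b" if "algebraic a" "algebraic b" for a b
    using that by (subst aut_eq_iff[symmetric]) (simp_all add: alg algebraic_mult aut_mult 2)
  moreover have "?\<tau> 1 = 1"
    using 1[of 1] by (simp add: aut_one)
  ultimately have "?\<tau> \<in> ring_iso algebraic_numbers algebraic_numbers"
    using alg bij by (intro ring_iso_memI)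
      (simp_all add: algebraic_numbers_def ring_of_type_algebra_def)
  then show ?thesis using 1 2 by blast
qed

end

lemma finite_vec_entries:
  assumes "finite S"
  shows "finite {v :: 'a^'n::finite. \<forall>i. v $ i \<in> S}"
proof (rule finite_imageD)
  show "inj_on vec_nth {v :: 'a^'n. \<forall>i. v $ i \<in> S}"
    by (auto simp: inj_on_def vec_eq_iff)
  have "vec_nth ` {v :: 'a^'n. \<forall>i. v $ i \<in> S} \<subseteq> UNIV \<rightarrow>\<^sub>E S"
    by auto
  then show "finite (vec_nth ` {v :: 'a^'n. \<forall>i. v $ i \<in> S})"
    by (rule finite_subset) (simp add: finite_PiE assms)
qed

text \<open>The entries of a conjugate are roots of fixed rational polynomials, one for each
  position.\<close>

lemma finite_galois_conjugates:
  fixes M :: "complex^'n::finite^'n"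
  assumes "\<And>i j. algebraic (M $ i $ j)"
  shows "finite (galois_conjugates M)"
proof -
  have "\<forall>i j. \<exists>p. (\<forall>k. coeff p k \<in> \<rat>) \<and> p \<noteq> 0 \<and> poly p (M $ i $ j) = 0"
    using assms unfolding algebraic_altdef by simp
  then obtain p where p: "\<And>i j k. coeff (p i j) k \<in> \<rat>" "\<And>i j. p i j \<noteq> 0"
    "\<And>i j. poly (p i j) (M $ i $ j) = 0"
    by metis
  define R where "R = (\<Union>i. \<Union>j. {a. poly (p i j) a = 0})"
  have "finite R"
    unfolding R_def using p(2) by (simp add: poly_roots_finite)
  then have "finite {v :: complex^'n. \<forall>j. v $ j \<in> R}"
    by (rule finite_vec_entries)
  then have "finite {N :: complex^'n^'n. \<forall>i. N $ i \<in> {v. \<forall>j. v $ j \<in> R}}"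
    by (rule finite_vec_entries)
  moreover have "galois_conjugates M \<subseteq> {N. \<forall>i. N $ i \<in> {v. \<forall>j. v $ j \<in> R}}"
    unfolding galois_conjugates_def R_def using aut_poly_root p assms by fastforce
  ultimately show ?thesis by (rule rev_finite_subset)
qed

lemma id_aut: "(\<lambda>a. a) \<in> ring_iso algebraic_numbers algebraic_numbers"
  by (intro ring_iso_memI) (auto simp: bij_betw_def)

lemma self_galois_conjugate: "M \<in> galois_conjugates M"
  unfolding galois_conjugates_def using id_aut
  by (auto simp: vec_eq_iff intro!: exI[of _ "\<lambda>a. a"])

lemma galois_conjugates_aut:
  assumes "\<sigma> \<in> ring_iso algebraic_numbers algebraic_numbers" "N \<in> galois_conjugates M"
  shows "map_matrix \<sigma> N \<in> galois_conjugates M"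
proof -
  obtain \<tau> where \<tau>: "\<tau> \<in> ring_iso algebraic_numbers algebraic_numbers" "N = map_matrix \<tau> M"
    using assms(2) by (auto simp: galois_conjugates_def)
  have "map_matrix \<sigma> N = map_matrix (\<sigma> \<circ> \<tau>) M"
    by (simp add: \<tau>(2) vec_eq_iff)
  then show ?thesis
    unfolding galois_conjugates_def using ring_iso_set_trans[OF \<tau>(1) assms(1)] by blast
qed

lemma galois_conjugates_algebraic:
  assumes "\<And>i j. algebraic (M $ i $ j)" "N \<in> galois_conjugates M"
  shows "algebraic (N $ i $ j)"
  using assms by (auto simp: galois_conjugates_def aut_algebraic)

text \<open>An automorphism permutes the conjugates and so fixes every entry of their sum;
  \<open>rational_if_fixed_by_automorphisms\<close> applies.\<close>

lemma galois_conjugates_sum_rational: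
  fixes M :: "complex^'n::finite^'n"
  assumes alg: "\<And>i j. algebraic (M $ i $ j)"
  obtains N :: "rat^'n^'n" where "cmat N = \<Sum>(galois_conjugates M)"
proof -
  let ?G = "galois_conjugates M"
  note algG = galois_conjugates_algebraic[OF alg]
  have fin: "finite ?G" using alg by (rule finite_galois_conjugates)
  have "\<Sum>?G $ i $ j \<in> \<rat>" for i j
  proof (rule rational_if_fixed_by_automorphisms)
    show "algebraic (\<Sum>?G $ i $ j)"
      unfolding sum_nth2 by (intro algebraic_sum algG)
    fix \<sigma>
    assume \<sigma>: "\<sigma> \<in> ring_iso algebraic_numbers algebraic_numbers"
    have inj: "inj_on (map_matrix \<sigma>) ?G"
      by (auto simp: inj_on_def vec_eq_iff aut_eq_iff[OF \<sigma>] algG)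
    have "map_matrix \<sigma> ` ?G \<subseteq> ?G" using galois_conjugates_aut[OF \<sigma>] by blast
    then have img: "map_matrix \<sigma> ` ?G = ?G" using endo_inj_surj[OF fin _ inj] by simp
    have "\<sigma> (\<Sum>?G $ i $ j) = (\<Sum>N\<in>?G. map_matrix \<sigma> N $ i $ j)"
      unfolding sum_nth2 by (subst aut_sum[OF \<sigma>]) (simp_all add: algG)
    also have "\<dots> = (\<Sum>N\<in>map_matrix \<sigma> ` ?G. N $ i $ j)"
      by (simp add: sum.reindex[OF inj])
    finally show "\<sigma> (\<Sum>?G $ i $ j) = \<Sum>?G $ i $ j"
      unfolding img sum_nth2 .
  qed
  then have "\<forall>i j. \<exists>q. \<Sum>?G $ i $ j = of_rat q"
    by (meson Rats_cases)
  then obtain q where "\<And>i j. \<Sum>?G $ i $ j = of_rat (q i j)" by metis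
  then have "cmat (\<chi> i j. q i j) = \<Sum>?G" by (simp add: vec_eq_iff)
  then show ?thesis by (rule that)
qed

section \<open>Conjugates of \<open>e\<close> and the rational idempotent\<close>

context thin_representation
begin

text \<open>The spanning matrices \<open>cmat c\<close> have rational entries, so an automorphism
  changes only the coefficients.\<close>

lemma aut_Tc:
  assumes "\<sigma> \<in> ring_iso algebraic_numbers algebraic_numbers" "Z \<in> Tc" "\<And>i j. algebraic (Z $ i $ j)"
  shows "map_matrix \<sigma> Z \<in> Tc"
proof -
  define k where "k c = matrix_inner (cmat c) Z / of_rat (matrix_inner c c)" for c
  have Z: "Z = (\<Sum>c\<in>orth_basis. map_matrix ((*) (k c)) (cmat c))"
    using Tc_expansion[OF assms(2)] by (simp add: k_def)
  have k: "algebraic (k c)" for c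
    unfolding k_def matrix_inner_def divide_inverse
    by (intro algebraic_mult algebraic_sum algebraic_inverse assms(3)) (simp_all add: rat_imp_algebraic)
  have "Z $ i $ j = (\<Sum>c\<in>orth_basis. k c * of_rat (c $ i $ j))" for i j
    by (subst Z) (simp add: sum_nth2)
  moreover have "\<sigma> (\<Sum>c\<in>orth_basis. k c * of_rat (c $ i $ j)) =
      (\<Sum>c\<in>orth_basis. \<sigma> (k c) * of_rat (c $ i $ j))" for i j
    by (subst aut_sum[OF assms(1)])
      (simp_all add: k algebraic_mult rat_imp_algebraic aut_mult[OF assms(1)] aut_rat[OF assms(1)])
  ultimately have "map_matrix \<sigma> Z = (\<Sum>c\<in>orth_basis. map_matrix ((*) (\<sigma> (k c))) (cmat c))"
    by (simp add: vec_eq_iff sum_nth2)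
  then show ?thesis using Tc_combination[OF orth_basis_Tq] by simp
qed

lemma aut_e_central_idempotent:
  assumes \<sigma>: "\<sigma> \<in> ring_iso algebraic_numbers algebraic_numbers"
  shows "central_idempotent Tc (map_matrix \<sigma> e)"
  unfolding central_idempotent_def
proof (intro conjI ballI)
  show "map_matrix \<sigma> e \<in> Tc"
    using \<sigma> e_Tc e_algebraic by (rule aut_Tc)
  show "map_matrix \<sigma> e ** map_matrix \<sigma> e = map_matrix \<sigma> e"
    using aut_matrix_mult[OF \<sigma> e_algebraic e_algebraic] by (simp add: e_idem)
  fix Z assume Z: "Z \<in> Tc"
  show "map_matrix \<sigma> e ** Z = Z ** map_matrix \<sigma> e"
  proof (rule Tc_commute[OF _ Z])
    fix M assume M: "M \<in> Tq"
    have alg: "algebraic (cmat M $ i $ j)" for i j by (simp add: rat_imp_algebraic)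
    have "map_matrix \<sigma> (e ** cmat M) = map_matrix \<sigma> (cmat M ** e)"
      using e_central[OF cmat_closed[OF M]] by simp
    then show "map_matrix \<sigma> e ** cmat M = cmat M ** map_matrix \<sigma> e"
      by (simp only: aut_matrix_mult[OF \<sigma> e_algebraic alg] aut_matrix_mult[OF \<sigma> alg e_algebraic]
          aut_cmat[OF \<sigma>])
  qed
qed

text \<open>The conjugate \<open>f\<close> acts as zero or as one. In the second case
  \<open>e ** f = e\<close>, and the inverse automorphism turns this into \<open>g ** e = g\<close>
  for the conjugate \<open>g\<close> of \<open>e\<close>. Since \<open>g\<close> is nonzero, it acts
  as one too, so \<open>e ** g = e\<close>. Thus \<open>g = e\<close>, and applying
  \<open>\<sigma>\<close> gives \<open>f = e\<close>.\<close>

lemma aut_e_cases: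
  assumes \<sigma>: "\<sigma> \<in> ring_iso algebraic_numbers algebraic_numbers"
  shows "map_matrix \<sigma> e = e \<or> e ** map_matrix \<sigma> e = 0"
proof -
  obtain \<tau> where \<tau>: "\<tau> \<in> ring_iso algebraic_numbers algebraic_numbers"
    "\<And>a. algebraic a \<Longrightarrow> \<tau> (\<sigma> a) = a" "\<And>a. algebraic a \<Longrightarrow> \<sigma> (\<tau> a) = a"
    using aut_inverse_ex[OF \<sigma>] by blast
  define f where "f = map_matrix \<sigma> e"
  define g where "g = map_matrix \<tau> e"
  have f: "central_idempotent Tc f" and g: "central_idempotent Tc g"
    unfolding f_def g_def by (intro aut_e_central_idempotent \<sigma> \<tau>(1))+
  have fT: "f \<in> Tc" and gT: "g \<in> Tc" using f g by (auto simp: central_idempotent_def)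
  have falg: "algebraic (f $ i $ j)" for i j
    by (simp add: f_def aut_algebraic[OF \<sigma>] e_algebraic)
  have \<sigma>g: "map_matrix \<sigma> g = e" and \<tau>f: "map_matrix \<tau> f = e"
    by (simp_all add: g_def f_def vec_eq_iff \<tau> e_algebraic)
  show ?thesis
  proof (cases "annihilates f")
    case True
    then show ?thesis using e_annihilates fT unfolding f_def by blast
  next
    case False
    then have "e ** f = e"
      using central_idempotent_cases[OF f] e_mult_acts_as_one fT by blast
    then have "map_matrix \<tau> (e ** f) = g" by (simp add: g_def)
    then have ge: "g ** e = g"
      by (simp add: aut_matrix_mult[OF \<tau>(1) e_algebraic falg] g_def[symmetric] \<tau>f)
    have "\<not> annihilates g"
    proof
      assume "annihilates g"
      then have "g = 0" using e_annihilates gT e_central ge by metis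
      then have "e = 0" using \<sigma>g by (simp add: vec_eq_iff aut_zero[OF \<sigma>])
      then show False using e_nonzero by simp
    qed
    then have "e ** g = e"
      using central_idempotent_cases[OF g] e_mult_acts_as_one gT by blast
    then have "g = e" using ge e_central gT by metis
    then show ?thesis using \<sigma>g by simp
  qed
qed

text \<open>Undoing the automorphism that yields \<open>g\<close> reduces the claim to
  \<open>aut_e_cases\<close>.\<close>

lemma conjugates_orthogonal:
  assumes "g \<in> galois_conjugates e" "h \<in> galois_conjugates e" "g \<noteq> h"
  shows "g ** h = 0"
proof -
  obtain \<sigma> \<rho> where \<sigma>: "\<sigma> \<in> ring_iso algebraic_numbers algebraic_numbers" "g = map_matrix \<sigma> e"
    and \<rho>: "\<rho> \<in> ring_iso algebraic_numbers algebraic_numbers" "h = map_matrix \<rho> e"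
    using assms(1,2) by (auto simp: galois_conjugates_def)
  obtain \<tau> where \<tau>: "\<tau> \<in> ring_iso algebraic_numbers algebraic_numbers"
    "\<And>a. algebraic a \<Longrightarrow> \<tau> (\<sigma> a) = a" "\<And>a. algebraic a \<Longrightarrow> \<sigma> (\<tau> a) = a"
    using aut_inverse_ex[OF \<sigma>(1)] by blast
  define f where "f = map_matrix (\<tau> \<circ> \<rho>) e"
  have \<tau>\<rho>: "\<tau> \<circ> \<rho> \<in> ring_iso algebraic_numbers algebraic_numbers"
    using ring_iso_set_trans[OF \<rho>(1) \<tau>(1)] .
  have falg: "algebraic (f $ i $ j)" for i j
    using aut_algebraic[OF \<tau>\<rho>] by (simp add: f_def e_algebraic)
  have \<sigma>f: "map_matrix \<sigma> f = h"
    by (simp add: f_def \<rho>(2) vec_eq_iff \<tau>(3) aut_algebraic[OF \<rho>(1)] e_algebraic)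
  have "f \<noteq> e" using \<sigma>f \<sigma>(2) assms(3) by auto
  then have "e ** f = 0" using aut_e_cases[OF \<tau>\<rho>] by (simp add: f_def)
  then have "map_matrix \<sigma> (e ** f) = 0" by (simp add: vec_eq_iff aut_zero[OF \<sigma>(1)])
  then show ?thesis
    by (simp add: aut_matrix_mult[OF \<sigma>(1) e_algebraic falg] \<sigma>f \<sigma>(2))
qed

lemma galois_conjugate_e:
  assumes "g \<in> galois_conjugates e"
  shows "g \<in> Tc" "g ** g = g" "M \<in> Tc \<Longrightarrow> g ** M = M ** g"
  using assms aut_e_central_idempotent
  by (auto simp: galois_conjugates_def central_idempotent_def)

definition e_rat :: "rat^'n^'n" where
  "e_rat = (SOME N. cmat N = \<Sum>(galois_conjugates e))"

lemma cmat_e_rat: "cmat e_rat = \<Sum>(galois_conjugates e)"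
proof -
  obtain N :: "rat^'n^'n" where "cmat N = \<Sum>(galois_conjugates e)"
    by (rule galois_conjugates_sum_rational[OF e_algebraic])
  then show ?thesis unfolding e_rat_def by (rule someI)
qed

lemma e_rat_Tq: "e_rat \<in> Tq"
  by (rule Tq_if_cmat) (simp add: cmat_e_rat Tc_sum galois_conjugate_e)

text \<open>Orthogonality leaves the single summand \<open>e\<close>; it occurs once because the
  conjugates are summed as a set, not over automorphisms.\<close>

lemma e_rat_mult_e: "cmat e_rat ** e = e"
proof -
  have fin: "finite (galois_conjugates e)" using e_algebraic by (rule finite_galois_conjugates)
  have "cmat e_rat ** e = (\<Sum>g\<in>galois_conjugates e. g ** e)"
    by (simp add: cmat_e_rat matrix_mult_sum_left)
  also have "\<dots> = (\<Sum>g\<in>galois_conjugates e. if g = e then e else 0)"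
    by (intro sum.cong refl) (auto simp: e_idem conjugates_orthogonal self_galois_conjugate)
  also have "\<dots> = e" using fin by (simp add: self_galois_conjugate)
  finally show ?thesis .
qed

lemma e_rat_idem: "e_rat ** e_rat = e_rat"
proof -
  have fin: "finite (galois_conjugates e)" using e_algebraic by (rule finite_galois_conjugates)
  have "cmat (e_rat ** e_rat) = (\<Sum>h\<in>galois_conjugates e. \<Sum>g\<in>galois_conjugates e. g ** h)"
    by (simp add: cmat_mult cmat_e_rat matrix_mult_sum_left matrix_mult_sum_right)
  also have "\<dots> = (\<Sum>h\<in>galois_conjugates e. \<Sum>g\<in>galois_conjugates e. if g = h then h else 0)"
    by (intro sum.cong refl) (auto simp: galois_conjugate_e(2) conjugates_orthogonal)
  also have "\<dots> = cmat e_rat" using fin by (simp add: cmat_e_rat)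
  finally show ?thesis by (simp add: cmat_eq_iff)
qed

lemma e_rat_central: "M \<in> Tq \<Longrightarrow> e_rat ** M = M ** e_rat"
proof -
  assume "M \<in> Tq"
  then have "cmat (e_rat ** M) = cmat (M ** e_rat)"
    unfolding cmat_mult cmat_e_rat matrix_mult_sum_left matrix_mult_sum_right
    by (intro sum.cong refl galois_conjugate_e(3) cmat_closed)
  then show ?thesis by (simp add: cmat_eq_iff)
qed

lemma e_rat_acts: "acts_as_one (cmat e_rat)"
proof -
  have "m (cmat e_rat) s t = m (cmat e_rat ** e) s t" if "s \<in> I" "t \<in> I" for s t
    using m_mult_acts_as_one[OF e_acts cmat_closed[OF e_rat_Tq] e_Tc that] by simp
  then show ?thesis using e_acts by (simp add: acts_as_one_def e_rat_mult_e)
qed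

text \<open>\<open>M\<close> is rational, so automorphisms carry \<open>cmat M ** e = 0\<close> to
  every conjugate of \<open>e\<close>. Thus the whole component acts faithfully on the one module,
  although the other conjugates act on it as zero.\<close>

lemma annihilates_mult_e_rat:
  assumes M: "M \<in> Tq" "annihilates (cmat M)"
  shows "M ** e_rat = 0"
proof -
  have alg: "algebraic (cmat M $ i $ j)" for i j by (simp add: rat_imp_algebraic)
  have Me: "cmat M ** e = 0"
    using e_annihilates[OF M(2) cmat_closed[OF M(1)]] e_central[OF cmat_closed[OF M(1)]] by simp
  have "cmat M ** g = 0" if "g \<in> galois_conjugates e" for g
  proof -
    obtain \<sigma> where \<sigma>: "\<sigma> \<in> ring_iso algebraic_numbers algebraic_numbers" "g = map_matrix \<sigma> e"
      using \<open>g \<in> _\<close> by (auto simp: galois_conjugates_def)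
    have "map_matrix \<sigma> (cmat M ** e) = 0" by (simp add: Me vec_eq_iff aut_zero[OF \<sigma>(1)])
    then show ?thesis
      by (simp add: aut_matrix_mult[OF \<sigma>(1) alg e_algebraic] aut_cmat[OF \<sigma>(1)] \<sigma>(2))
  qed
  then have "cmat (M ** e_rat) = cmat 0"
    by (simp add: cmat_mult cmat_e_rat matrix_mult_sum_right cmat_zero)
  then show ?thesis by (simp only: cmat_eq_iff)
qed

text \<open>In a central decomposition of \<open>e_rat\<close> one summand acts as zero on the
  module, since \<open>f\<close> acts as zero or as one; by faithfulness it vanishes.\<close>

lemma e_rat_centrally_primitive: "centrally_primitive Tq e_rat"
  unfolding centrally_primitive_def
proof (intro conjI allI impI)
  show "central_idempotent Tq e_rat"
    unfolding central_idempotent_def by (intro conjI ballI e_rat_Tq e_rat_idem e_rat_central)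
  show "e_rat \<noteq> 0"
    using e_rat_mult_e e_nonzero by (auto simp: cmat_zero)
  fix f g
  assume *: "central_idempotent Tq f \<and> central_idempotent Tq g \<and> f ** g = 0 \<and> f + g = e_rat"
  then have fg: "f \<in> Tq" "g \<in> Tq" "f ** f = f" "g ** g = g" "f ** g = 0" "g ** f = 0" "f + g = e_rat"
    by (auto simp: central_idempotent_def)
  have fer: "f ** e_rat = f" and ger: "g ** e_rat = g"
    using fg by (simp_all add: fg(7)[symmetric] matrix_add_ldistrib)
  have "central_idempotent Tc (cmat f)"
    unfolding central_idempotent_def
  proof (intro conjI ballI)
    show "cmat f \<in> Tc" using fg by (simp add: cmat_closed)
    show "cmat f ** cmat f = cmat f" using fg by (simp flip: cmat_mult)
    show "cmat f ** Z = Z ** cmat f" if "Z \<in> Tc" for Z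
    proof (rule Tc_commute[OF _ that])
      fix M assume "M \<in> Tq"
      then have "f ** M = M ** f" using * by (simp add: central_idempotent_def)
      then show "cmat f ** cmat M = cmat M ** cmat f" by (simp flip: cmat_mult)
    qed
  qed
  then show "f = 0 \<or> g = 0"
  proof (rule central_idempotent_cases[THEN disjE])
    assume "annihilates (cmat f)"
    then show ?thesis using annihilates_mult_e_rat fg fer by metis
  next
    assume "acts_as_one (cmat f)"
    have "cmat g = cmat e_rat - cmat f"
      by (simp add: fg(7)[symmetric] cmat_add)
    then have "annihilates (cmat g)"
      using \<open>acts_as_one (cmat f)\<close> e_rat_acts fg(1) e_rat_Tq
      by (simp add: annihilates_def acts_as_one_def m_diff cmat_closed)
    then show ?thesis using annihilates_mult_e_rat fg ger by metis
  qed
qed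

end


section \<open>The simple component\<close>

context thin_representation
begin

abbreviation K_ring :: "complex ring" where
  "K_ring \<equiv> ring_of_type_algebra\<lparr>carrier := K\<rparr>"

lemma K_subfield: "subfield K ring_of_type_algebra"
proof -
  interpret C: field "ring_of_type_algebra :: complex ring" by (rule field_from_type_algebra)
  have zero: "\<zero>\<^bsub>ring_of_type_algebra\<^esub> = (0::complex)" and one: "\<one>\<^bsub>ring_of_type_algebra\<^esub> = (1::complex)"
    and mult: "\<And>a b :: complex. a \<otimes>\<^bsub>ring_of_type_algebra\<^esub> b = a * b"
    and add: "\<And>a b :: complex. a \<oplus>\<^bsub>ring_of_type_algebra\<^esub> b = a + b"
    and carr: "carrier (ring_of_type_algebra :: complex ring) = UNIV"
    by (simp_all add: ring_of_type_algebra_def)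
  have minus: "\<ominus>\<^bsub>ring_of_type_algebra\<^esub> a = - a" for a :: complex
    by (rule C.minus_equality) (simp_all add: zero add carr)
  have inv: "inv\<^bsub>ring_of_type_algebra\<^esub> a = inverse a" if "a \<noteq> 0" for a :: complex
    by (rule C.comm_inv_char) (simp_all add: one mult carr that)
  show ?thesis
  proof (rule C.subfieldI')
    show "subring K ring_of_type_algebra"
    proof (rule C.subringI)
      show "K \<subseteq> carrier ring_of_type_algebra" by (simp add: carr)
      show "\<one>\<^bsub>ring_of_type_algebra\<^esub> \<in> K" by (simp add: one K_Rats)
      fix a b assume a: "a \<in> K" and b: "b \<in> K"
      show "\<ominus>\<^bsub>ring_of_type_algebra\<^esub> a \<in> K"
        using K_mult[OF K_Rats[of "-1"] a] by (simp add: minus)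
      show "a \<otimes>\<^bsub>ring_of_type_algebra\<^esub> b \<in> K" using a b by (simp add: mult K_mult)
      show "a \<oplus>\<^bsub>ring_of_type_algebra\<^esub> b \<in> K" using a b by (simp add: add K_add)
    qed
    show "inv\<^bsub>ring_of_type_algebra\<^esub> k \<in> K" if "k \<in> K - {\<zero>\<^bsub>ring_of_type_algebra\<^esub>}" for k
      using that by (simp add: zero inv K_inverse)
  qed
qed

lemma generate_field_K: "generate_field ring_of_type_algebra K = K"
proof -
  interpret C: field "ring_of_type_algebra :: complex ring" by (rule field_from_type_algebra)
  have "K \<subseteq> carrier ring_of_type_algebra" by (simp add: ring_of_type_algebra_def)
  then have "generate_field ring_of_type_algebra K \<subseteq> K"
    by (rule C.generate_field_min_subfield1[OF _ K_subfield order_refl])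
  then show ?thesis by (auto intro: generate_field.incl)
qed

lemma K_ring_field: "field K_ring"
proof -
  interpret C: field "ring_of_type_algebra :: complex ring" by (rule field_from_type_algebra)
  show ?thesis using K_subfield by (rule C.subfield_iff(2))
qed

lemma K_ring_finsum:
  assumes "finite A" "\<And>i. i \<in> A \<Longrightarrow> f i \<in> K"
  shows "(\<Oplus>\<^bsub>K_ring\<^esub>i\<in>A. f i) = sum f A"
proof -
  interpret L: field K_ring by (rule K_ring_field)
  show ?thesis
    using assms
  proof (induction A)
    case empty
    show ?case using L.finsum_empty[of f] by (simp add: ring_of_type_algebra_def)
  next
    case (insert x F)
    then have "(\<Oplus>\<^bsub>K_ring\<^esub>i\<in>insert x F. f i) = f x \<oplus>\<^bsub>K_ring\<^esub> (\<Oplus>\<^bsub>K_ring\<^esub>i\<in>F. f i)"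
      by (intro L.finsum_insert) auto
    then show ?case using insert by (simp add: ring_of_type_algebra_def)
  qed
qed

abbreviation component :: "(rat^'n^'n) ring" where
  "component \<equiv> corner_ring Tq e_rat"

lemma component_ops:
  "M \<otimes>\<^bsub>component\<^esub> N = M ** N" "M \<oplus>\<^bsub>component\<^esub> N = M + N" "\<one>\<^bsub>component\<^esub> = e_rat" "\<zero>\<^bsub>component\<^esub> = 0"
  by (simp_all add: corner_ring_def)

lemma component_carrier_iff: "M \<in> carrier component \<longleftrightarrow> M \<in> Tq \<and> M ** e_rat = M"
proof
  assume "M \<in> carrier component"
  then obtain N where N: "N \<in> Tq" "M = N ** e_rat" by (auto simp: corner_ring_def)
  then have "M ** e_rat = M" by (simp add: matrix_mul_assoc[symmetric] e_rat_idem)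
  then show "M \<in> Tq \<and> M ** e_rat = M" using N e_rat_Tq by (simp add: Tq_mult)
next
  assume M: "M \<in> Tq \<and> M ** e_rat = M"
  then have "M ** e_rat \<in> (\<lambda>M. M ** e_rat) ` Tq" by (intro imageI) simp
  then show "M \<in> carrier component" using M by (simp add: corner_ring_def)
qed

lemma component_closed:
  assumes "M \<in> carrier component" "N \<in> carrier component"
  shows "M + N \<in> carrier component" "M - N \<in> carrier component" "M ** N \<in> carrier component"
  using assms
  by (simp_all add: component_carrier_iff Tq_add Tq_diff Tq_mult matrix_add_rdistrib
      matrix_sub_rdistrib matrix_mul_assoc[symmetric])

lemma component_zero: "0 \<in> carrier component" and component_one: "e_rat \<in> carrier component"
  by (simp_all add: component_carrier_iff Tq_zero e_rat_Tq e_rat_idem)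

lemma component_ring: "ring component"
proof (rule ringI)
  show "abelian_group component"
  proof (rule abelian_groupI)
    fix M assume M: "M \<in> carrier component"
    show "\<exists>N\<in>carrier component. N \<oplus>\<^bsub>component\<^esub> M = \<zero>\<^bsub>component\<^esub>"
      using component_closed(2)[OF component_zero M] by (intro bexI[of _ "0 - M"]) (simp_all add: component_ops)
  qed (simp_all add: component_ops component_closed component_zero add.assoc add.commute)
  show "monoid component"
  proof (rule monoidI)
    fix M assume M: "M \<in> carrier component"
    then have "M \<in> Tq" "M ** e_rat = M" by (simp_all add: component_carrier_iff)
    then show "\<one>\<^bsub>component\<^esub> \<otimes>\<^bsub>component\<^esub> M = M" "M \<otimes>\<^bsub>component\<^esub> \<one>\<^bsub>component\<^esub> = M"
      by (simp_all add: component_ops e_rat_central)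
  qed (simp_all add: component_ops component_closed component_one matrix_mul_assoc)
qed (simp_all add: component_ops matrix_add_ldistrib matrix_add_rdistrib)

lemma e_rat_nonzero: "e_rat \<noteq> 0"
  using e_rat_centrally_primitive by (simp add: centrally_primitive_def)

lemma component_eqI:
  assumes "M \<in> carrier component" "N \<in> carrier component"
    and "\<And>s t. s \<in> I \<Longrightarrow> t \<in> I \<Longrightarrow> n (cmat M) s t = n (cmat N) s t"
  shows "M = N"
proof -
  have MN: "M \<in> Tq" "N \<in> Tq" "M - N \<in> Tq" "(M - N) ** e_rat = M - N"
    using assms(1,2) component_closed(2)[OF assms(1,2)] by (simp_all add: component_carrier_iff)
  have "cmat (M - N) = cmat M - cmat N"
    using cmat_add[of "M - N" N] by (simp add: eq_diff_eq)
  then have "annihilates (cmat (M - N))"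
    using assms(3) MN n_eq_0_iff[of _ _ "cmat (M - N)"]
    by (simp add: annihilates_def n_diff cmat_closed)
  then show ?thesis using annihilates_mult_e_rat[OF MN(3)] MN(4) by simp
qed

lemma component_surj:
  assumes "\<And>s t. s \<in> I \<Longrightarrow> t \<in> I \<Longrightarrow> f s t \<in> K"
  shows "\<exists>M\<in>carrier component. \<forall>s\<in>I. \<forall>t\<in>I. n (cmat M) s t = f s t"
proof -
  obtain N where N: "N \<in> Tq" "\<And>s t. s \<in> I \<Longrightarrow> t \<in> I \<Longrightarrow> n (cmat N) s t = f s t"
    using n_surj[of f] assms by blast
  have "n (cmat (N ** e_rat)) s t = f s t" if "s \<in> I" "t \<in> I" for s t
    using N that m_mult_acts_as_one[OF e_rat_acts cmat_closed[OF N(1)] cmat_closed[OF e_rat_Tq] that]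
    by (simp add: n_def cmat_mult)
  moreover have "N ** e_rat \<in> carrier component"
    using N(1) by (simp add: corner_ring_def)
  ultimately show ?thesis by blast
qed

lemma n_cmat_mult:
  "M \<in> Tq \<Longrightarrow> N \<in> Tq \<Longrightarrow> s \<in> I \<Longrightarrow> t \<in> I \<Longrightarrow>
    n (cmat (M ** N)) s t = (\<Sum>u\<in>I. n (cmat M) s u * n (cmat N) u t)"
  by (simp add: cmat_mult n_mult cmat_closed)

text \<open>If \<open>f\<close> has a nonzero entry \<open>c = f\<^sub>i\<^sub>j\<close>, then \<open>u = f E\<^sub>j\<^sub>i f\<close> satisfies \<open>u\<^sup>2 = c u\<close>, so \<open>u = c f\<close>
  in a corner without zero divisors, and \<open>f\<close> has rank one.\<close>

lemma component_corner_commutative: "corner_commutative component"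
  unfolding corner_commutative_def component_ops
proof (intro ballI impI)
  fix f x y
  assume f: "f \<in> carrier component" "f ** f = f" "f \<noteq> 0"
    and zd: "\<forall>x\<in>carrier component. \<forall>y\<in>carrier component.
      (f ** x ** f) ** (f ** y ** f) = 0 \<longrightarrow> f ** x ** f = 0 \<or> f ** y ** f = 0"
    and x: "x \<in> carrier component" and y: "y \<in> carrier component"
  let ?n = "\<lambda>M. n (cmat M)"
  have Tq: "M \<in> carrier component \<Longrightarrow> M \<in> Tq" for M by (simp add: component_carrier_iff)
  have "\<exists>i\<in>I. \<exists>j\<in>I. ?n f i j \<noteq> 0"
  proof (rule ccontr)
    assume "\<not> ?thesis"
    then have "f = 0"
      using m_zero by (intro component_eqI f component_zero) (auto simp: cmat_zero n_eq_0_iff n_def)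
    then show False using f by simp
  qed
  then obtain i j where ij: "i \<in> I" "j \<in> I" "?n f i j \<noteq> 0" by blast
  define c where "c = ?n f i j"
  have cK: "c \<in> K" using f ij by (simp add: c_def n_K Tq)
  \<comment> \<open>\<open>w\<close> acts as the matrix unit at \<open>(j, i)\<close> and
    \<open>k\<close> as the scalar \<open>c\<close>; both are taken inside the component, to which
    the hypothesis on zero divisors refers.\<close>
  obtain w where w: "w \<in> carrier component"
    "\<And>s t. s \<in> I \<Longrightarrow> t \<in> I \<Longrightarrow> ?n w s t = (if s = j \<and> t = i then 1 else 0)"
    using component_surj[of "\<lambda>s t. if s = j \<and> t = i then 1 else 0"] K_Rats by force
  obtain k where k: "k \<in> carrier component"
    "\<And>s t. s \<in> I \<Longrightarrow> t \<in> I \<Longrightarrow> ?n k s t = (if s = t then c else 0)"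
    using component_surj[of "\<lambda>s t. if s = t then c else 0"] K_Rats[of 0] cK by force
  have fw: "?n (f ** w) s t = (if t = i then ?n f s j else 0)" if "s \<in> I" "t \<in> I" for s t
  proof -
    have "?n (f ** w) s t = (\<Sum>u\<in>I. if u = j then (if t = i then ?n f s j else 0) else 0)"
      using that f w by (subst n_cmat_mult) (auto intro!: sum.cong simp: Tq)
    then show ?thesis using finite_I ij by simp
  qed
  have fwf: "?n (f ** w ** f) s t = ?n f s j * ?n f i t" if "s \<in> I" "t \<in> I" for s t
  proof -
    have "?n (f ** w ** f) s t = (\<Sum>u\<in>I. if u = i then ?n f s j * ?n f i t else 0)"
      using that f w fw by (subst n_cmat_mult) (auto intro!: sum.cong simp: Tq Tq_mult)
    then show ?thesis using finite_I ij by simp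
  qed
  have kf: "?n (k ** M) s t = c * ?n M s t" if "s \<in> I" "t \<in> I" "M \<in> carrier component" for s t M
  proof -
    have "?n (k ** M) s t = (\<Sum>u\<in>I. if u = s then c * ?n M s t else 0)"
      using that k by (subst n_cmat_mult) (auto intro!: sum.cong simp: Tq)
    then show ?thesis using finite_I that by simp
  qed
  have fk: "?n (M ** k) s t = c * ?n M s t" if "s \<in> I" "t \<in> I" "M \<in> carrier component" for s t M
  proof -
    have "?n (M ** k) s t = (\<Sum>u\<in>I. if u = t then c * ?n M s t else 0)"
      using that k by (subst n_cmat_mult) (auto intro!: sum.cong simp: Tq)
    then show ?thesis using finite_I that by simp
  qed
  have comm: "M ** k = k ** M" if "M \<in> carrier component" for M
    using that k(1) by (intro component_eqI component_closed) (simp_all add: kf fk)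
  have fkf: "f ** k ** f = k ** f"
    using comm[OF f(1)] f(2) by (metis matrix_mul_assoc)
  have u2: "(f ** w ** f) ** (f ** w ** f) = k ** (f ** w ** f)"
  proof (intro component_eqI)
    fix s t assume st: "s \<in> I" "t \<in> I"
    have "?n ((f ** w ** f) ** (f ** w ** f)) s t = (\<Sum>u\<in>I. ?n f s j * ?n f i u * (?n f u j * ?n f i t))"
      using st f w by (subst n_cmat_mult) (auto intro!: sum.cong simp: Tq Tq_mult fwf)
    also have "\<dots> = ?n f s j * (\<Sum>u\<in>I. ?n f i u * ?n f u j) * ?n f i t"
      by (simp add: sum_distrib_left sum_distrib_right mult.assoc)
    also have "(\<Sum>u\<in>I. ?n f i u * ?n f u j) = ?n (f ** f) i j"
      using ij f by (subst n_cmat_mult) (auto simp: Tq)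
    also have "\<dots> = c" by (simp add: f(2) c_def)
    finally show "?n ((f ** w ** f) ** (f ** w ** f)) s t = ?n (k ** (f ** w ** f)) s t"
      using st f w by (simp add: kf component_closed fwf)
  qed (intro component_closed f w k)+
  \<comment> \<open>With \<open>u = f ** w ** f\<close>, the relation \<open>u ** u = k ** u\<close>
    reads \<open>u ** (f ** (w - k) ** f) = 0\<close>, and \<open>u\<close> is nonzero.\<close>
  have "f ** w ** f = f ** k ** f"
  proof -
    have "(f ** w ** f) ** (f ** (w - k) ** f) = (f ** w ** f) ** (f ** w ** f) - (f ** w ** f) ** (f ** k ** f)"
      by (simp add: matrix_sub_ldistrib matrix_sub_rdistrib)
    also have "(f ** w ** f) ** (f ** k ** f) = k ** (f ** w ** f)"
      unfolding fkf using comm[of "f ** w ** f"] f w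
      by (metis comm component_closed(3) matrix_mul_assoc)
    finally have "(f ** w ** f) ** (f ** (w - k) ** f) = 0" by (simp add: u2)
    then have "f ** w ** f = 0 \<or> f ** (w - k) ** f = 0"
      using zd w(1) component_closed(2)[OF w(1) k(1)] by blast
    moreover have "f ** w ** f \<noteq> 0"
    proof
      assume "f ** w ** f = 0"
      then have "?n f i j * ?n f i j = 0"
        using fwf[OF ij(1,2)] m_zero ij by (simp add: cmat_zero n_def)
      then show False using ij(3) by simp
    qed
    ultimately show ?thesis by (simp add: matrix_sub_ldistrib matrix_sub_rdistrib)
  qed
  then have rank1: "?n f s j * ?n f i t = c * ?n f s t" if "s \<in> I" "t \<in> I" for s t
    using fwf[OF that] kf[OF that f(1)] fkf by simp
  have scalar: "\<exists>a. \<forall>s\<in>I. \<forall>t\<in>I. ?n (f ** M ** f) s t = a * ?n f s t" if M: "M \<in> carrier component" for M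
  proof -
    \<comment> \<open>This is the coefficient of \<open>f ** M ** f\<close> at \<open>(i, j)\<close>
      divided by \<open>c\<close>. The computation below carries a factor \<open>c * c\<close> so
      that \<open>rank1\<close> can be applied to both outer factors \<open>f\<close>.\<close>
    define a where "a = (\<Sum>u\<in>I. \<Sum>v\<in>I. ?n f i u * ?n M u v * ?n f v j) / c"
    have "?n (f ** M ** f) s t = a * ?n f s t" if st: "s \<in> I" "t \<in> I" for s t
    proof -
      have "c * c * ?n (f ** M ** f) s t = (\<Sum>v\<in>I. \<Sum>u\<in>I. (c * ?n f s u) * ?n M u v * (c * ?n f v t))"
        using st f M
        by (subst n_cmat_mult, simp_all add: Tq Tq_mult n_cmat_mult sum_distrib_left sum_distrib_right)
          (simp add: mult_ac)
      also have "\<dots> = (\<Sum>v\<in>I. \<Sum>u\<in>I. (?n f s j * ?n f i u) * ?n M u v * (?n f v j * ?n f i t))"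
        by (intro sum.cong refl) (simp add: rank1 st)
      also have "\<dots> = (\<Sum>v\<in>I. \<Sum>u\<in>I. ?n f i u * ?n M u v * ?n f v j) * (?n f s j * ?n f i t)"
        by (simp add: sum_distrib_left sum_distrib_right mult_ac)
      also have "\<dots> = (a * c) * (c * ?n f s t)"
        using ij(3) by (subst sum.swap) (simp add: a_def c_def[symmetric] rank1 st)
      finally show ?thesis using ij(3) by (simp add: c_def)
    qed
    then show ?thesis by blast
  qed
  obtain a where a: "\<And>s t. s \<in> I \<Longrightarrow> t \<in> I \<Longrightarrow> ?n (f ** x ** f) s t = a * ?n f s t"
    using scalar[OF x] by blast
  obtain b where b: "\<And>s t. s \<in> I \<Longrightarrow> t \<in> I \<Longrightarrow> ?n (f ** y ** f) s t = b * ?n f s t"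
    using scalar[OF y] by blast
  show "(f ** x ** f) ** (f ** y ** f) = (f ** y ** f) ** (f ** x ** f)"
  proof (intro component_eqI)
    fix s t assume st: "s \<in> I" "t \<in> I"
    show "?n ((f ** x ** f) ** (f ** y ** f)) s t = ?n ((f ** y ** f) ** (f ** x ** f)) s t"
      using st f x y
      by (simp add: n_cmat_mult[of "f ** x ** f" "f ** y ** f"] n_cmat_mult[of "f ** y ** f" "f ** x ** f"]
          Tq Tq_mult a b mult_ac)
  qed (intro component_closed f x y)+
qed

text \<open>Taking coefficients is injective by \<open>component_eqI\<close> and surjective by
  \<open>component_surj\<close>; \<open>b\<close> numbers the weights because
  \<open>matrix_ring\<close> is indexed by natural numbers.\<close>

lemma component_iso: "component \<simeq> matrix_ring (card I) K_ring"
proof -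
  let ?d = "card I"
  let ?J = "{..<?d} \<times> {..<?d}"
  obtain b where b: "bij_betw b {..<?d} I"
    using ex_bij_betw_nat_finite[OF finite_I] by (auto simp: atLeast0LessThan)
  have bI: "b i \<in> I" if "i < ?d" for i using b that by (auto simp: bij_betw_def)
  have binj: "b i = b j \<longleftrightarrow> i = j" if "i < ?d" "j < ?d" for i j
    using b that by (auto simp: bij_betw_def inj_on_def)
  define b' where "b' = inv_into {..<?d} b"
  have b': "b' s < ?d" "b (b' s) = s" if "s \<in> I" for s
    using bij_betw_inv_into_right[OF b that] bij_betwE[OF bij_betw_inv_into[OF b]] that
    by (auto simp: b'_def)
  have Tq: "M \<in> carrier component \<Longrightarrow> M \<in> Tq" for M by (simp add: component_carrier_iff)
  define h where "h M = (\<lambda>(i, j)\<in>?J. n (cmat M) (b i) (b j))" for M :: "rat^'n^'n"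
  have closed: "h M \<in> carrier (matrix_ring ?d K_ring)" if "M \<in> carrier component" for M
    using that by (auto simp: h_def matrix_ring_def n_K bI Tq)
  have "h \<in> ring_iso component (matrix_ring ?d K_ring)"
  proof (rule ring_iso_memI)
    fix M N assume M: "M \<in> carrier component" and N: "N \<in> carrier component"
    show "h M \<in> carrier (matrix_ring ?d K_ring)" using M by (rule closed)
    have "n (cmat (M ** N)) (b i) (b j) =
        (\<Oplus>\<^bsub>K_ring\<^esub>k\<in>{..<?d}. h M (i, k) \<otimes>\<^bsub>K_ring\<^esub> h N (k, j))" if ij: "i < ?d" "j < ?d" for i j
    proof -
      have "(\<Oplus>\<^bsub>K_ring\<^esub>k\<in>{..<?d}. h M (i, k) \<otimes>\<^bsub>K_ring\<^esub> h N (k, j)) =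
          (\<Sum>k<?d. h M (i, k) \<otimes>\<^bsub>K_ring\<^esub> h N (k, j))"
        using ij M N
        by (intro K_ring_finsum) (simp_all add: h_def ring_of_type_algebra_def K_mult n_K bI Tq)
      also have "\<dots> = (\<Sum>k<?d. n (cmat M) (b i) (b k) * n (cmat N) (b k) (b j))"
        using ij by (intro sum.cong) (simp_all add: h_def ring_of_type_algebra_def)
      also have "\<dots> = (\<Sum>u\<in>I. n (cmat M) (b i) u * n (cmat N) u (b j))"
        by (rule sum.reindex_bij_betw[OF b])
      also have "\<dots> = n (cmat (M ** N)) (b i) (b j)"
        using M N ij by (simp add: n_cmat_mult Tq bI)
      finally show ?thesis by simp
    qed
    then show "h (M \<otimes>\<^bsub>component\<^esub> N) = h M \<otimes>\<^bsub>matrix_ring ?d K_ring\<^esub> h N"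
      by (auto simp: component_ops matrix_ring_def fun_eq_iff h_def[of "M ** N"])
    show "h (M \<oplus>\<^bsub>component\<^esub> N) = h M \<oplus>\<^bsub>matrix_ring ?d K_ring\<^esub> h N"
      using M N by (auto simp: component_ops matrix_ring_def fun_eq_iff h_def cmat_add n_add
          cmat_closed Tq bI ring_of_type_algebra_def)
  next
    show "h \<one>\<^bsub>component\<^esub> = \<one>\<^bsub>matrix_ring ?d K_ring\<^esub>"
      using e_rat_acts by (auto simp: component_ops matrix_ring_def fun_eq_iff h_def ring_of_type_algebra_def
          acts_as_one_def n_def bI binj \<alpha>_nonzero)
    show "bij_betw h (carrier component) (carrier (matrix_ring ?d K_ring))"
      unfolding bij_betw_def
    proof (intro conjI inj_onI equalityI subsetI)
      fix M N assume M: "M \<in> carrier component" and N: "N \<in> carrier component" and eq: "h M = h N"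
      show "M = N"
      proof (rule component_eqI[OF M N])
        fix s t assume st: "s \<in> I" "t \<in> I"
        have "h M (b' s, b' t) = h N (b' s, b' t)" using eq by simp
        then show "n (cmat M) s t = n (cmat N) s t"
          using st by (simp add: h_def b')
      qed
    next
      fix F assume "F \<in> h ` carrier component"
      then show "F \<in> carrier (matrix_ring ?d K_ring)" using closed by blast
    next
      fix F assume F: "F \<in> carrier (matrix_ring ?d K_ring)"
      have "F (b' s, b' t) \<in> K" if "s \<in> I" "t \<in> I" for s t
        using F b' that by (auto simp: matrix_ring_def PiE_iff)
      then obtain M where M: "M \<in> carrier component"
        "\<And>s t. s \<in> I \<Longrightarrow> t \<in> I \<Longrightarrow> n (cmat M) s t = F (b' s, b' t)"
        using component_surj[of "\<lambda>s t. F (b' s, b' t)"] by blast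
      have b'b: "b' (b i) = i" if "i < ?d" for i
        using bij_betw_inv_into_left[OF b] that by (simp add: b'_def)
      have "h M = F"
      proof
        fix p
        show "h M p = F p"
        proof (cases "p \<in> ?J")
          case True
          then show ?thesis by (auto simp: h_def M bI b'b)
        next
          case False
          then show ?thesis using F by (cases p) (auto simp: h_def matrix_ring_def PiE_iff extensional_def)
        qed
      qed
      then show "F \<in> h ` carrier component" using M(1) by blast
    qed
  qed
  then show ?thesis unfolding is_ring_iso_def by blast
qed

end


section \<open>Thin modules of the Terwilliger algebra\<close>

lemma matrix_subalgebra_terwilliger: "matrix_subalgebra (terwilliger_algebra S x)"
  unfolding terwilliger_algebra_def
  by (rule hull_in) (simp add: matrix_subalgebra_def)

lemma adjacency_in_terwilliger: "s \<in> S \<Longrightarrow> adjacency_matrix s \<in> terwilliger_algebra S x"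
  and dual_idempotent_in_terwilliger: "s \<in> S \<Longrightarrow> dual_idempotent x s \<in> terwilliger_algebra S x"
  unfolding terwilliger_algebra_def by (auto intro: hull_inc)

lemma terwilliger_algebra_minimal:
  assumes "matrix_subalgebra A" "\<And>s. s \<in> S \<Longrightarrow> adjacency_matrix s \<in> A"
    "\<And>s. s \<in> S \<Longrightarrow> dual_idempotent x s \<in> A"
  shows "terwilliger_algebra S x \<subseteq> A"
  unfolding terwilliger_algebra_def by (rule hull_minimal) (use assms in auto)

lemma cmat_adjacency: "cmat (adjacency_matrix s) = adjacency_matrix s"
  and cmat_dual_idempotent: "cmat (dual_idempotent x s) = dual_idempotent x s"
  by (simp_all add: vec_eq_iff adjacency_matrix_def dual_idempotent_def)

lemma matrix_subalgebra_span_cmat: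
  fixes A :: "(rat^'n::finite^'n) set"
  assumes "matrix_subalgebra A"
  shows "matrix_subalgebra (mat_vs.span (cmat ` A))"
proof -
  have A: "mat 1 \<in> A" "\<And>M N. M \<in> A \<Longrightarrow> N \<in> A \<Longrightarrow> M ** N \<in> A"
    using assms by (auto simp: matrix_subalgebra_def)
  have one: "mat 1 \<in> mat_vs.span (cmat ` A)"
    using A(1) by (intro mat_vs.span_base) (auto intro!: image_eqI[of _ _ "mat 1"] simp: cmat_one)
  have 1: "cmat M ** W \<in> mat_vs.span (cmat ` A)" if "M \<in> A" "W \<in> mat_vs.span (cmat ` A)" for M W
    using that(2)
  proof (induction rule: mat_vs.span_induct_alt)
    case base
    then show ?case by (simp add: mat_vs.span_zero)
  next
    case (step c N W)
    then obtain N' where N': "N' \<in> A" "N = cmat N'" by auto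
    then have "cmat M ** N \<in> mat_vs.span (cmat ` A)"
      using A(2)[OF that(1) N'(1)]
      by (intro mat_vs.span_base) (auto intro!: image_eqI[of _ _ "M ** N'"] simp: cmat_mult)
    then show ?case
      using step by (simp add: matrix_add_ldistrib map_matrix_mult_right mat_vs.span_add mat_vs.span_scale)
  qed
  have mult: "Z ** W \<in> mat_vs.span (cmat ` A)"
    if "Z \<in> mat_vs.span (cmat ` A)" "W \<in> mat_vs.span (cmat ` A)" for Z W
    using that(1)
  proof (induction rule: mat_vs.span_induct_alt)
    case base
    then show ?case by (simp add: mat_vs.span_zero)
  next
    case (step c N Z)
    then have "N ** W \<in> mat_vs.span (cmat ` A)" using 1 that(2) by auto
    then show ?case
      using step by (simp add: matrix_add_rdistrib map_matrix_mult_left mat_vs.span_add mat_vs.span_scale)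
  qed
  show ?thesis
    unfolding matrix_subalgebra_def
    by (intro conjI ballI allI one mult mat_vs.span_add mat_vs.span_scale)
qed

text \<open>A scheme is closed under converse, so transposition permutes the adjacency matrices; it
  fixes the dual idempotents. Minimality of the generated algebra does the rest.\<close>

lemma rational_star_algebra_terwilliger:
  fixes S :: "('a::finite \<times> 'a) set set"
  assumes "association_scheme S"
  shows "rational_star_algebra (terwilliger_algebra S x) (terwilliger_algebra S x)"
proof
  let ?Tq = "terwilliger_algebra S x :: (rat^'a^'a) set"
  let ?Tc = "terwilliger_algebra S x :: (complex^'a^'a) set"
  have q: "matrix_subalgebra ?Tq" and c: "matrix_subalgebra ?Tc"
    by (rule matrix_subalgebra_terwilliger)+
  have "?Tq \<subseteq> {M. transpose M \<in> ?Tq}"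
  proof (rule terwilliger_algebra_minimal)
    have "transpose (M + N) = transpose M + transpose N" for M N :: "rat^'a^'a"
      by (simp add: vec_eq_iff transpose_def)
    moreover have "transpose (map_matrix ((*) k) M) = map_matrix ((*) k) (transpose M)" for k and M :: "rat^'a^'a"
      by (simp add: vec_eq_iff transpose_def)
    ultimately show "matrix_subalgebra {M. transpose M \<in> ?Tq}"
      using q by (simp add: matrix_subalgebra_def matrix_transpose_mul)
    fix s assume s: "s \<in> S"
    then have "converse s \<in> S" using assms by (simp add: association_scheme_def)
    moreover have "transpose (adjacency_matrix s) = (adjacency_matrix (converse s) :: rat^'a^'a)"
      by (simp add: vec_eq_iff transpose_def adjacency_matrix_def)
    ultimately show "adjacency_matrix s \<in> {M. transpose M \<in> ?Tq}"
      by (simp add: adjacency_in_terwilliger)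
    have "transpose (dual_idempotent x s) = (dual_idempotent x s :: rat^'a^'a)"
      by (auto simp: vec_eq_iff transpose_def dual_idempotent_def)
    then show "dual_idempotent x s \<in> {M. transpose M \<in> ?Tq}"
      using s by (simp add: dual_idempotent_in_terwilliger)
  qed
  then show "transpose M \<in> ?Tq" if "M \<in> ?Tq" for M using that by blast
  have "?Tq \<subseteq> {M. cmat M \<in> ?Tc}"
  proof (rule terwilliger_algebra_minimal)
    show "matrix_subalgebra {M. cmat M \<in> ?Tc}"
      using c by (simp add: matrix_subalgebra_def cmat_add cmat_mult cmat_scale cmat_one)
  qed (simp_all add: cmat_adjacency cmat_dual_idempotent adjacency_in_terwilliger
      dual_idempotent_in_terwilliger)
  then show "cmat M \<in> ?Tc" if "M \<in> ?Tq" for M using that by blast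
  show "?Tc \<subseteq> mat_vs.span (cmat ` ?Tq)"
  proof (rule terwilliger_algebra_minimal[OF matrix_subalgebra_span_cmat[OF matrix_subalgebra_terwilliger]])
    fix s assume s: "s \<in> S"
    show "adjacency_matrix s \<in> mat_vs.span (cmat ` ?Tq)"
      unfolding cmat_adjacency[symmetric]
      by (intro mat_vs.span_base imageI adjacency_in_terwilliger s)
    show "dual_idempotent x s \<in> mat_vs.span (cmat ` ?Tq)"
      unfolding cmat_dual_idempotent[symmetric]
      by (intro mat_vs.span_base imageI dual_idempotent_in_terwilliger s)
  qed
qed (rule matrix_subalgebra_terwilliger)+

locale thin_terwilliger_module =
  irreducible_module scl "terwilliger_algebra S x :: (complex^'n^'n) set" act V
  for S :: "('n::finite \<times> 'n) set set" and x :: 'n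
    and scl :: "complex \<Rightarrow> 'v::ab_group_add \<Rightarrow> 'v"
    and act :: "complex^'n^'n \<Rightarrow> 'v \<Rightarrow> 'v" and V :: "'v set" +
  assumes scheme: "association_scheme S" and thin: "thin_module S x scl act V"
begin

abbreviation T :: "(complex^'n^'n) set" where
  "T \<equiv> terwilliger_algebra S x"

abbreviation D :: "('n \<times> 'n) set \<Rightarrow> complex^'n^'n" where
  "D s \<equiv> dual_idempotent x s"

sublocale rational_star_algebra "terwilliger_algebra S x" "terwilliger_algebra S x"
  by (rule rational_star_algebra_terwilliger[OF scheme])

lemma D_T: "s \<in> S \<Longrightarrow> D s \<in> T"
  by (rule dual_idempotent_in_terwilliger)

lemma D_mult: "s \<in> S \<Longrightarrow> t \<in> S \<Longrightarrow> D s ** D t = (if s = t then D s else 0)"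
proof -
  assume st: "s \<in> S" "t \<in> S"
  have disj: "s \<inter> t = {}" if "s \<noteq> t"
    using scheme st that by (auto simp: association_scheme_def partition_on_def disjoint_def)
  have "(D s ** D t) $ i $ j = (if i = j \<and> (x, i) \<in> s \<and> (x, i) \<in> t then 1 else 0)" for i j
  proof -
    have "(D s ** D t) $ i $ j = (\<Sum>k\<in>UNIV.
        (if i = k \<and> (x, i) \<in> s then 1 else 0) * (if k = j \<and> (x, k) \<in> t then 1 else 0))"
      by (simp add: matrix_matrix_mult_def dual_idempotent_def)
    also have "\<dots> = (\<Sum>k\<in>UNIV. if k = i then (if i = j \<and> (x, i) \<in> s \<and> (x, i) \<in> t then 1 else 0) else 0)"
      by (intro sum.cong) auto
    finally show ?thesis by simp
  qed
  then show ?thesis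
    using disj by (auto simp: vec_eq_iff dual_idempotent_def)
qed

lemma sum_D: "(\<Sum>s\<in>S. D s) = mat 1"
proof -
  have "(\<Sum>s\<in>S. D s $ i $ j) = (mat 1 :: complex^'n^'n) $ i $ j" for i j
  proof (cases "i = j")
    case True
    have U: "\<Union>S = UNIV" and disj: "\<And>s t. s \<in> S \<Longrightarrow> t \<in> S \<Longrightarrow> s \<noteq> t \<Longrightarrow> s \<inter> t = {}"
      using scheme by (auto simp: association_scheme_def partition_on_def disjoint_def)
    have "(x, i) \<in> \<Union>S" by (simp add: U)
    then obtain r where r: "r \<in> S" "(x, i) \<in> r" ..
    have "(\<Sum>s\<in>S. D s $ i $ j) = (\<Sum>s\<in>S. if s = r then 1 else 0)"
    proof (intro sum.cong refl)
      fix s assume "s \<in> S"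
      then have "(x, i) \<in> s \<longleftrightarrow> s = r" using r disj[of s r] by blast
      then show "D s $ i $ j = (if s = r then 1 else 0)"
        using True by (simp add: dual_idempotent_def)
    qed
    also have "\<dots> = 1" using r by simp
    finally show ?thesis using True by (simp add: mat_def)
  qed (simp add: dual_idempotent_def mat_def)
  then show ?thesis by (simp add: vec_eq_iff sum_nth2)
qed

lemma act_zero_right: "M \<in> T \<Longrightarrow> act M 0 = 0"
  using act_add_right[of M 0 0] subspace_0[OF subspace_V] by simp

lemma act_zero_left: "v \<in> V \<Longrightarrow> act 0 v = 0"
  using act_add_left[OF Tc_zero Tc_zero, of v] by simp

lemma act_sum_left:
  assumes "\<And>a. a \<in> A \<Longrightarrow> f a \<in> T" "v \<in> V"
  shows "act (sum f A) v = (\<Sum>a\<in>A. act (f a) v)"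
  using assms(1)
proof (induction A rule: infinite_finite_induct)
  case (insert a F)
  then show ?case using assms(2) by (simp add: act_add_left Tc_sum)
qed (simp_all add: act_zero_left assms(2))

lemma act_sum_right:
  assumes "\<And>a. a \<in> A \<Longrightarrow> f a \<in> V" "M \<in> T"
  shows "act M (sum f A) = (\<Sum>a\<in>A. act M (f a))"
  using assms(1)
proof (induction A rule: infinite_finite_induct)
  case (insert a F)
  then show ?case using assms(2) by (simp add: act_add_right subspace_sum[OF subspace_V])
qed (simp_all add: act_zero_right assms(2))

lemma cyclic:
  assumes "v \<in> V" "v \<noteq> 0" "w \<in> V"
  shows "\<exists>M\<in>T. w = act M v"
proof -
  let ?W = "(\<lambda>M. act M v) ` T"
  have "?W = {0} \<or> ?W = V"
  proof (rule simple)
    show "subspace ?W"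
    proof (rule subspaceI)
      show "0 \<in> ?W" using act_zero_left[OF assms(1)] Tc_zero by (intro image_eqI[of _ _ 0]) auto
      show "a + b \<in> ?W" if "a \<in> ?W" "b \<in> ?W" for a b
        using that assms(1) by (auto simp: act_add_left[symmetric] intro!: imageI Tc_add)
      show "scl c a \<in> ?W" if "a \<in> ?W" for c a
        using that assms(1) by (auto simp: act_scale_left[symmetric] intro!: imageI Tc_scale)
    qed
    show "?W \<subseteq> V" using act_closed assms(1) by auto
    show "act M a \<in> ?W" if "M \<in> T" "a \<in> ?W" for M a
      using that assms(1) by (auto simp: act_mult[symmetric] intro!: imageI Tc_mult)
  qed
  moreover have "v \<in> ?W"
    using act_one[OF assms(1)] Tc_one by (intro image_eqI[of _ _ "mat 1"]) auto
  ultimately have "?W = V" using assms(2) by auto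
  then show ?thesis using assms(3) by blast
qed

text \<open>\<open>V\<close> is cyclic, so the images of one vector under the finite set
  \<open>orth_basis\<close> span it.\<close>

lemma finite_dimensional: "\<exists>B. finite B \<and> V \<subseteq> span B"
proof -
  obtain v where v: "v \<in> V" "v \<noteq> 0"
    using nonzero subspace_0[OF subspace_V] by blast
  let ?B = "(\<lambda>c. act (cmat c) v) ` orth_basis"
  have "V \<subseteq> span ?B"
  proof
    fix w assume "w \<in> V"
    then obtain M where M: "M \<in> T" "w = act M v" using cyclic v by blast
    define k where "k c = matrix_inner (cmat c) M / of_rat (matrix_inner c c)" for c
    have "M = (\<Sum>c\<in>orth_basis. map_matrix ((*) (k c)) (cmat c))"
      using Tc_expansion[OF M(1)] by (simp add: k_def)
    then have "w = act (\<Sum>c\<in>orth_basis. map_matrix ((*) (k c)) (cmat c)) v"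
      using M(2) by simp
    also have "\<dots> = (\<Sum>c\<in>orth_basis. scl (k c) (act (cmat c) v))"
      using v by (subst act_sum_left)
        (simp_all add: Tc_scale cmat_closed orth_basis_Tq act_scale_left)
    also have "\<dots> \<in> span ?B"
      by (intro span_sum span_scale span_base) auto
    finally show "w \<in> span ?B" .
  qed
  then show ?thesis using finite_orth_basis by (intro exI[of _ ?B]) simp
qed

definition I :: "('n \<times> 'n) set set" where
  "I = {s \<in> S. act (D s) ` V \<noteq> {0}}"

lemma I_S: "s \<in> I \<Longrightarrow> s \<in> S"
  by (simp add: I_def)

lemma weight_space_line:
  assumes s: "s \<in> I"
  shows "\<exists>v. v \<in> act (D s) ` V \<and> v \<noteq> 0 \<and> (\<forall>w\<in>V. \<exists>k. act (D s) w = scl k v)"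
proof -
  let ?W = "act (D s) ` V"
  have WV: "?W \<subseteq> V" using act_closed D_T I_S[OF s] by auto
  obtain B where B: "B \<subseteq> ?W" "independent B" "?W \<subseteq> span B" "card B = dim ?W"
    by (rule basis_exists)
  \<comment> \<open>Finiteness has to come first: an infinite \<open>B\<close> would also satisfy
    \<open>card B \<le> 1\<close>.\<close>
  obtain F where "finite F" "V \<subseteq> span F" using finite_dimensional by blast
  then have "finite B" using independent_span_bound[of F B] B(1,2) WV by blast
  have "card B \<le> 1" using B(4) thin I_S[OF s] by (simp add: thin_module_def)
  moreover have "B \<noteq> {}"
  proof
    assume "B = {}"
    then have "?W \<subseteq> {0}" using B(3) by simp
    moreover have "?W \<noteq> {}" using subspace_0[OF subspace_V] by auto
    ultimately have "?W = {0}" by (simp add: subset_singleton_iff)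
    then show False using s by (simp add: I_def)
  qed
  ultimately have "card B = 1" using \<open>finite B\<close> by (metis card_0_eq le_antisym less_one not_le)
  then obtain v where v: "B = {v}" by (auto simp: card_1_singleton_iff)
  have "\<exists>k. act (D s) w = scl k v" if "w \<in> V" for w
    using B(3) that unfolding v span_singleton by blast
  moreover have "v \<noteq> 0" using B(2) v dependent_zero by blast
  ultimately show ?thesis using B(1) v by blast
qed

definition weight_vector :: "('n \<times> 'n) set \<Rightarrow> 'v" where
  "weight_vector s = (SOME v. v \<in> act (D s) ` V \<and> v \<noteq> 0 \<and> (\<forall>w\<in>V. \<exists>k. act (D s) w = scl k v))"

text \<open>The coordinate of \<open>w\<close> along the line of weight \<open>s\<close>, onto which
  \<open>act (D s)\<close> projects.\<close>

definition \<phi> :: "('n \<times> 'n) set \<Rightarrow> 'v \<Rightarrow> complex" where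
  "\<phi> s w = (SOME k. act (D s) w = scl k (weight_vector s))"

lemma weight_vector:
  assumes "s \<in> I"
  shows weight_vector_image: "weight_vector s \<in> act (D s) ` V" and weight_vector_nonzero: "weight_vector s \<noteq> 0"
    and weight_vector_V: "weight_vector s \<in> V"
    and \<phi>: "w \<in> V \<Longrightarrow> act (D s) w = scl (\<phi> s w) (weight_vector s)"
proof -
  note * = someI_ex[OF weight_space_line[OF assms], folded weight_vector_def]
  then show "weight_vector s \<in> act (D s) ` V" "weight_vector s \<noteq> 0" by blast+
  then show "weight_vector s \<in> V" using act_closed D_T I_S[OF assms] by auto
  assume "w \<in> V"
  then have "\<exists>k. act (D s) w = scl k (weight_vector s)" using * by blast
  then show "act (D s) w = scl (\<phi> s w) (weight_vector s)" unfolding \<phi>_def by (rule someI_ex)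
qed

lemma \<phi>_unique: "s \<in> I \<Longrightarrow> w \<in> V \<Longrightarrow> act (D s) w = scl k (weight_vector s) \<Longrightarrow> \<phi> s w = k"
  using \<phi>[of s w] weight_vector_nonzero[of s] by simp

lemma \<phi>_add: "s \<in> I \<Longrightarrow> v \<in> V \<Longrightarrow> w \<in> V \<Longrightarrow> \<phi> s (v + w) = \<phi> s v + \<phi> s w"
  by (rule \<phi>_unique)
    (simp_all add: act_add_right D_T I_S \<phi> scale_left_distrib subspace_add[OF subspace_V])

lemma \<phi>_scale: "s \<in> I \<Longrightarrow> w \<in> V \<Longrightarrow> \<phi> s (scl c w) = c * \<phi> s w"
  by (rule \<phi>_unique)
    (simp_all add: act_scale_right D_T I_S \<phi> subspace_scale[OF subspace_V])

lemma \<phi>_zero: "s \<in> I \<Longrightarrow> \<phi> s 0 = 0"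
  by (rule \<phi>_unique) (simp_all add: act_zero_right D_T I_S subspace_0[OF subspace_V])

lemma \<phi>_sum: "s \<in> I \<Longrightarrow> (\<And>a. a \<in> A \<Longrightarrow> f a \<in> V) \<Longrightarrow> \<phi> s (sum f A) = (\<Sum>a\<in>A. \<phi> s (f a))"
  by (induction A rule: infinite_finite_induct)
    (simp_all add: \<phi>_zero \<phi>_add subspace_sum[OF subspace_V])

lemma act_D_weight_vector: "s \<in> S \<Longrightarrow> t \<in> I \<Longrightarrow> act (D s) (weight_vector t) = (if s = t then weight_vector t else 0)"
proof -
  assume s: "s \<in> S" and t: "t \<in> I"
  obtain u where u: "u \<in> V" "weight_vector t = act (D t) u" using weight_vector_image[OF t] by blast
  have "act (D s) (weight_vector t) = act (D s ** D t) u"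
    using s t u by (simp add: act_mult D_T I_S)
  then show ?thesis using s t u by (auto simp: D_mult I_S act_zero_left)
qed

lemma \<phi>_weight_vector: "s \<in> I \<Longrightarrow> t \<in> I \<Longrightarrow> \<phi> s (weight_vector t) = (if s = t then 1 else 0)"
  by (rule \<phi>_unique) (simp_all add: weight_vector_V act_D_weight_vector I_S)

text \<open>The dual idempotents add up to the identity, and those outside \<open>I\<close> act as
  zero.\<close>

lemma weight_expansion:
  assumes w: "w \<in> V"
  shows "w = (\<Sum>s\<in>I. scl (\<phi> s w) (weight_vector s))"
proof -
  have "w = act (\<Sum>s\<in>S. D s) w" using w by (simp add: sum_D act_one)
  also have "\<dots> = (\<Sum>s\<in>S. act (D s) w)" using w by (intro act_sum_left D_T)
  also have "\<dots> = (\<Sum>s\<in>I. act (D s) w)"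
    using w by (intro sum.mono_neutral_right) (auto simp: I_def)
  also have "\<dots> = (\<Sum>s\<in>I. scl (\<phi> s w) (weight_vector s))"
    using w by (intro sum.cong) (simp_all add: \<phi>)
  finally show ?thesis .
qed

definition coefficient :: "complex^'n^'n \<Rightarrow> ('n \<times> 'n) set \<Rightarrow> ('n \<times> 'n) set \<Rightarrow> complex" where
  "coefficient Z s t = \<phi> s (act Z (weight_vector t))"

sublocale thin_representation "terwilliger_algebra S x" "terwilliger_algebra S x" I coefficient
  "dual_idempotent x"
proof
  show "finite I" by simp
  show "I \<noteq> {}"
    using weight_expansion nonzero subspace_0[OF subspace_V] by fastforce
  fix Z W s t
  assume st: "s \<in> I" "t \<in> I"
  note [simp] = weight_vector_V[OF st(1)] weight_vector_V[OF st(2)]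
  show "coefficient (mat 1) s t = (if s = t then 1 else 0)"
    using st by (simp add: coefficient_def act_one \<phi>_weight_vector)
  assume Z: "Z \<in> T"
  show "coefficient (map_matrix ((*) c) Z) s t = c * coefficient Z s t" for c
    using st Z by (simp add: coefficient_def act_scale_left \<phi>_scale act_closed)
  assume W: "W \<in> T"
  show "coefficient (Z + W) s t = coefficient Z s t + coefficient W s t"
    using st Z W by (simp add: coefficient_def act_add_left \<phi>_add act_closed)
  have "coefficient (Z ** W) s t = \<phi> s (act Z (act W (weight_vector t)))"
    using Z W by (simp add: coefficient_def act_mult)
  also have "act W (weight_vector t) = (\<Sum>u\<in>I. scl (coefficient W u t) (weight_vector u))"
    unfolding coefficient_def using W by (intro weight_expansion act_closed) simp_all
  also have "act Z \<dots> = (\<Sum>u\<in>I. scl (coefficient W u t) (act Z (weight_vector u)))"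
    using Z by (subst act_sum_right)
      (simp_all add: weight_vector_V subspace_scale[OF subspace_V] act_scale_right)
  also have "\<phi> s \<dots> = (\<Sum>u\<in>I. coefficient Z s u * coefficient W u t)"
    using Z st by (subst \<phi>_sum)
      (simp_all add: weight_vector_V subspace_scale[OF subspace_V] act_closed \<phi>_scale coefficient_def mult.commute)
  finally show "coefficient (Z ** W) s t = (\<Sum>u\<in>I. coefficient Z s u * coefficient W u t)" .
next
  fix u assume u: "u \<in> I"
  show "dual_idempotent x u \<in> (terwilliger_algebra S x :: (rat^'n^'n) set)"
    using u by (simp add: dual_idempotent_in_terwilliger I_S)
  show "coefficient (cmat (dual_idempotent x u)) s t = (if s = u \<and> t = u then 1 else 0)"
    if "s \<in> I" "t \<in> I" for s t
    using that u by (simp add: cmat_dual_idempotent coefficient_def act_D_weight_vector I_S \<phi>_weight_vector \<phi>_zero)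
next
  fix s t assume st: "s \<in> I" "t \<in> I"
  \<comment> \<open>Irreducibility yields a complex \<open>Z\<close> with coefficient 1 at
    \<open>(s, t)\<close>. As the rational elements span, their coefficients there cannot all
    vanish.\<close>
  obtain Z where Z: "Z \<in> T" "weight_vector s = act Z (weight_vector t)"
    using cyclic[OF weight_vector_V[OF st(2)] weight_vector_nonzero[OF st(2)] weight_vector_V[OF st(1)]] by blast
  show "\<exists>M\<in>terwilliger_algebra S x. coefficient (cmat M) s t \<noteq> 0"
  proof (rule ccontr)
    assume "\<not> ?thesis"
    then have 0: "coefficient (cmat M) s t = 0" if "M \<in> terwilliger_algebra S x" for M
      using that by blast
    have "W \<in> T \<and> coefficient W s t = 0" if "W \<in> mat_vs.span (cmat ` terwilliger_algebra S x)" for W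
      using that
    proof (induction rule: mat_vs.span_induct_alt)
      case base
      then show ?case using st by (simp add: coefficient_def act_zero_left weight_vector_V \<phi>_zero Tc_zero)
    next
      case (step c N W)
      then obtain M where M: "M \<in> terwilliger_algebra S x" "N = cmat M" by blast
      then have N: "N \<in> T" "coefficient N s t = 0" using 0 cmat_closed by auto
      then show ?case
        using step.IH st
        by (simp add: coefficient_def act_add_left act_scale_left \<phi>_add \<phi>_scale act_closed weight_vector_V
            subspace_scale[OF subspace_V] Tc_add Tc_scale)
    qed
    then have "coefficient Z s t = 0" using Z(1) Tc_span by blast
    moreover have "coefficient Z s t = 1"
      using st by (simp add: coefficient_def Z(2)[symmetric] \<phi>_weight_vector)
    ultimately show False by simp
  qed
qed

lemma dual_diameter: "dual_diameter S x act V = card I"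
  by (simp add: dual_diameter_def I_def)

text \<open>\<open>trace_on\<close> uses some arbitrary basis \<open>B\<close>. Expanding
  \<open>act Z b\<close> in weight vectors and interchanging the sums reassembles, for each
  \<open>s\<close>, the weight vector from its \<open>B\<close>-coordinates inside
  \<open>\<phi> s\<close> of \<open>act Z\<close>; this is the diagonal coefficient.\<close>

lemma trace_on_eq_chi:
  assumes Z: "Z \<in> T"
  shows "trace_on V (act Z) = chi Z"
proof -
  define B where "B = (SOME B. B \<subseteq> V \<and> independent B \<and> span B = V)"
  have "\<exists>B. B \<subseteq> V \<and> independent B \<and> span B = V"
    using basis_exists[of V] span_minimal[OF _ subspace_V] by (metis subset_antisym)
  from someI_ex[OF this, folded B_def] have B: "B \<subseteq> V" "independent B" "span B = V" by auto
  obtain F where "finite F" "V \<subseteq> span F" using finite_dimensional by auto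
  then have fin: "finite B" using independent_span_bound[of F B] B(1,2) by auto
  have BV: "b \<in> V" if "b \<in> B" for b using B(1) that by auto
  have "representation B (act Z b) b = (\<Sum>s\<in>I. \<phi> s (act Z b) * representation B (weight_vector s) b)"
    if "b \<in> B" for b
  proof -
    have "representation B (act Z b) b = representation B (\<Sum>s\<in>I. scl (\<phi> s (act Z b)) (weight_vector s)) b"
      using weight_expansion[OF act_closed[OF Z BV[OF that]]]
      by (rule arg_cong[where f = "\<lambda>v. representation B v b"])
    also have "\<dots> = (\<Sum>s\<in>I. representation B (scl (\<phi> s (act Z b)) (weight_vector s)) b)"
      using B by (subst representation_sum) (simp_all add: subspace_scale[OF subspace_V] weight_vector_V)
    also have "\<dots> = (\<Sum>s\<in>I. \<phi> s (act Z b) * representation B (weight_vector s) b)"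
      using B by (intro sum.cong refl) (simp add: representation_scale weight_vector_V)
    finally show ?thesis .
  qed
  then have "trace_on V (act Z) = (\<Sum>b\<in>B. \<Sum>s\<in>I. \<phi> s (act Z b) * representation B (weight_vector s) b)"
    by (simp add: trace_on_def B_def[symmetric])
  also have "\<dots> = (\<Sum>s\<in>I. \<Sum>b\<in>B. \<phi> s (act Z b) * representation B (weight_vector s) b)"
    by (rule sum.swap)
  also have "\<dots> = (\<Sum>s\<in>I. \<phi> s (act Z (\<Sum>b\<in>B. scl (representation B (weight_vector s) b) b)))"
    by (intro sum.cong refl)
      (simp add: act_sum_right Z BV subspace_scale[OF subspace_V] \<phi>_sum act_closed
        act_scale_right \<phi>_scale mult.commute)
  also have "\<dots> = chi Z"
    unfolding chi_def coefficient_def using B fin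
    by (intro sum.cong refl) (simp add: sum_representation_eq weight_vector_V)
  finally show ?thesis .
qed

context
  fixes ch assumes ch: "is_character T scl act V ch"
begin

lemma ch_eq_chi: "Z \<in> T \<Longrightarrow> ch Z = chi Z"
  using ch by (simp add: is_character_def trace_on_eq_chi)

lemma character_idempotent_eq: "character_idempotent S x ch = e"
  unfolding character_idempotent_def
proof (rule the_equality)
  show "centrally_primitive T e \<and> ch e \<noteq> 0"
    using e_centrally_primitive chi_e by (simp add: ch_eq_chi e_Tc)
  fix f assume f: "centrally_primitive T f \<and> ch f \<noteq> 0"
  then have "f \<in> T" by (simp add: centrally_primitive_def central_idempotent_def)
  then show "f = e" using f centrally_primitive_eq_e by (simp add: ch_eq_chi)
qed

lemma rational_idempotent_eq: "rational_idempotent S x ch = e_rat"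
  unfolding rational_idempotent_def character_idempotent_eq
proof (rule the_equality)
  show "centrally_primitive (terwilliger_algebra S x) e_rat \<and> cmat e_rat = \<Sum>(galois_conjugates e)"
    using e_rat_centrally_primitive cmat_e_rat by simp
  fix f :: "rat^'n^'n"
  assume "centrally_primitive (terwilliger_algebra S x) f \<and> cmat f = \<Sum>(galois_conjugates e)"
  then show "f = e_rat" by (simp add: cmat_e_rat[symmetric] cmat_eq_iff)
qed

lemma simple_component_eq: "simple_component S x ch = component"
  by (simp add: simple_component_def rational_idempotent_eq)

lemma character_field_eq: "character_field S x ch = K_ring"
proof -
  have "(\<lambda>M. ch (cmat M)) ` (terwilliger_algebra S x :: (rat^'n^'n) set) = K"
    unfolding K_def by (intro image_cong refl ch_eq_chi cmat_closed)
  then show ?thesis by (simp add: character_field_def generate_field_K)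
qed

lemma schur_index_and_component:
  "rational_schur_index S x ch = 1 \<and>
   simple_component S x ch \<simeq> matrix_ring (dual_diameter S x act V) (character_field S x ch)"
proof
  show iso: "simple_component S x ch \<simeq> matrix_ring (dual_diameter S x act V) (character_field S x ch)"
    unfolding simple_component_eq character_field_eq dual_diameter by (rule component_iso)
  \<comment> \<open>A right inverse of the character on rational elements embeds the field of values
    into the rational matrices, as \<open>rational_schur_index_eq_1I\<close> requires.\<close>
  define pick where "pick k = (SOME M. M \<in> terwilliger_algebra S x \<and> chi (cmat M) = k)" for k
  have pick: "chi (cmat (pick k)) = k" if "k \<in> K" for k
  proof -
    have "\<exists>M. M \<in> terwilliger_algebra S x \<and> chi (cmat M) = k"
      using that by (auto simp: K_def)
    from someI_ex[OF this] show ?thesis by (simp add: pick_def)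
  qed
  then have "inj_on pick K" by (rule inj_on_inverseI)
  then have "inj_on pick (carrier (character_field S x ch))"
    by (simp add: character_field_eq)
  with component_ring _ component_corner_commutative iso K_ring_field
  show "rational_schur_index S x ch = 1"
    unfolding simple_component_eq[symmetric] character_field_eq[symmetric]
    by (rule rational_schur_index_eq_1I)
      (simp add: simple_component_eq component_ops e_rat_nonzero)
qed

end

end

theorem theorem5p1:
  fixes S :: "('n::finite \<times> 'n) set set"
    and x :: 'n
    and scl :: "complex \<Rightarrow> 'v::ab_group_add \<Rightarrow> 'v"
    and act :: "complex^'n^'n \<Rightarrow> 'v \<Rightarrow> 'v"
    and V :: "'v set"
    and ch :: "complex^'n^'n \<Rightarrow> complex"
  assumes "association_scheme S"
    and "irreducible_module scl (terwilliger_algebra S x) act V"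
    and "thin_module S x scl act V"
    and "is_character (terwilliger_algebra S x) scl act V ch"
  shows "rational_schur_index S x ch = 1 \<and>
         simple_component S x ch \<simeq> matrix_ring (dual_diameter S x act V) (character_field S x ch)"
proof -
  interpret irreducible_module scl "terwilliger_algebra S x" act V by fact
  interpret thin_terwilliger_module S x scl act V
    by unfold_locales (fact assms)+
  show ?thesis using assms(4) by (rule schur_index_and_component)
qed

end
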